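(* Let $a,b,c,d$ be positive integers with $d<b\le c$ and $b\equiv c \pmod 2$. Then, as the positive integer $N\to\infty$, $$\frac{M(H_{2aN,bN,cN;dN})}{M(H_{2aN,bN,cN})}\sim \frac{2^{7/24}e^{1/8}}{A^{3/2}N^{1/8}}\,K_1\,K_2^{N/2}\,K_3^{N^2/2}$$ and $$\frac{M(H_{2aN+1,bN,cN;dN})}{M(H_{2aN+1,bN,cN})}\sim \frac{e^{1/8}}{2^{5/24}A^{3/2}N^{1/8}}\,L_1\,L_2^{N/2}\,K_3^{N^2/2},$$ where, writing $s=\tfrac12 b+\tfrac12 c$, $$K_1=\Big[\tfrac{a+d}{ad}\Big]^{1/8}\Big[\tfrac{bc(a+b-d)(a+c-d)}{(a+b)(a+c)(b-d)(c-d)}\Big]^{1/12}\Big[\tfrac{(a+s)(s-d)}{s(a+s-d)}\Big]^{1/24},$$ $$K_2=\frac{a^{a}d^{d}s^{s}(a+s-d)^{a+s-d}}{(a+d)^{a+d}(a+s)^{a+s}(s-d)^{s-d}},$$ $$K_3=\frac{s^{2s^2}}{b^{b^2}c^{c^2}}\cdot\frac{(a+s-d)^{2(a+s-d)^2}}{(a+b-d)^{(a+b-d)^2}(a+c-d)^{(a+c-d)^2}}\cdot\frac{(b-d)^{(b-d)^2}(c-d)^{(c-d)^2}}{(s-d)^{2(s-d)^2}}\cdot\frac{(a+b)^{(a+b)^2}(a+c)^{(a+c)^2}}{(a+s)^{2(a+s)^2}},$$ $$L_1=\Big[\tfrac{a+s-d}{a+s}\Big]^{11/24}\Big[\tfrac{(a+b)(a+c)}{(a+b-d)(a+c-d)}\Big]^{5/12}\Big[\tfrac{a+d}{ad}\Big]^{1/8}\Big[\tfrac{bc}{(b-d)(c-d)}\Big]^{1/12}\Big[\tfrac{s-d}{s}\Big]^{1/24},$$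 $$L_2=\Big[\frac{(a+d)^{a+d}}{a^{a}d^{d}}\cdot\frac{(a+s)^{a+s}(s-d)^{s-d}}{(a+s-d)^{a+s-d}s^{s}}\Big]\cdot\Big[\frac{1}{4^{d}}\cdot\frac{(a+b)^{a+b}(a+c)^{a+c}}{(a+s)^{2(a+s)}}\cdot\frac{(a+s-d)^{2(a+s-d)}}{(a+b-d)^{a+b-d}(a+c-d)^{a+c-d}}\Big]^{2}.$$
   Context: Work on the triangular lattice of unit equilateral triangles in which one family of lattice lines is vertical. For nonnegative integers $p,b,c$, $H_{p,b,c}$ denotes the hexagon on this lattice whose side lengths, listed clockwise starting from the (vertical) left side, are $p,b,c,p,b,c$. For nonnegative integers $p,b,c,d$ with $d\le\min(b,c)$, let $\ell$ be the perpendicular bisector (a horizontal line) of the left side of $H_{p,b,c}$, label the unit triangles of $H_{p,b,c}$ whose interiors meet $\ell$ by $1,2,3,\dots$ from left to right, and let $H_{p,b,c;d}$ be the region obtained from $H_{p,b,c}$ by deleting the unit triangles labeled $1,2,\dots,2d$ (so $H_{p,b,c;0}=H_{p,b,c}$). For a region $R$, $M(R)$ denotes the number of lozenge tilings of $R$. $f(N)\sim g(N)$ means $f(N)/g(N)\to1$. $A$ is the Glaisher–Kinkelin constant, $A=\lim_{n\to\infty}\frac{(2\pi)^{n/2}n^{\frac12 n^2-\frac1{12}}e^{-\frac34 n^2+\frac1{12}}}{G(n+1)}=1.2824\ldots$, where $G$ is the Barnes $G$-function, $G(n)=\prod_{i=0}^{n-2}i!$ for positive integers $n$. *)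

theory Defs
  imports Complex_Main
begin

(* Triangular lattice with vertical lattice lines.  Lattice points are (x,T) with
   x, T integers, T = x (mod 2); the actual point is (x*sqrt 3/2, T/2).
   A unit triangle is encoded by (k,u): it lies in the vertical strip k <= x <= k+1
   and its horizontal median is at height T = u.  If u - k is odd it points right
   (vertical edge on x = k), otherwise it points left (vertical edge on x = k+1). *)

definition tri_vertices :: "int \<times> int \<Rightarrow> (int \<times> int) set" where
  "tri_vertices t = (case t of (k,u) \<Rightarrow>
     (if odd (u - k) then {(k, u - 1), (k, u + 1), (k + 1, u)}
      else {(k + 1, u - 1), (k + 1, u + 1), (k, u)}))"

definition tri_adj :: "int \<times> int \<Rightarrow> int \<times> int \<Rightarrow> bool" where
  "tri_adj t t' = (case t of (k,u) \<Rightarrow> case t' of (k',u') \<Rightarrow>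
     (k = k' \<and> \<bar>u - u'\<bar> = 1) \<or>
     (u = u' \<and> ((k' = k + 1 \<and> even (u - k)) \<or> (k = k' + 1 \<and> even (u - k')))))"

(* Closed hexagon H_{p,b,c} in doubled coordinates; vertices (0,0),(0,2p),(b,2p+b),
   (b+c,2p+b-c),(b+c,b-c),(c,-c); side lengths clockwise from the left side:
   p,b,c,p,b,c. *)
definition in_hexagon :: "nat \<Rightarrow> nat \<Rightarrow> nat \<Rightarrow> int \<times> int \<Rightarrow> bool" where
  "in_hexagon p b c v = (case v of (x,T) \<Rightarrow>
     0 \<le> x \<and> x \<le> int b + int c \<and>
     T \<le> 2 * int p + x \<and> T \<le> 2 * int p + 2 * int b - x \<and>
     - x \<le> T \<and> x - 2 * int c \<le> T)"

definition hex :: "nat \<Rightarrow> nat \<Rightarrow> nat \<Rightarrow> (int \<times> int) set" where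
  "hex p b c = {t. \<forall>v \<in> tri_vertices t. in_hexagon p b c v}"

(* The unit triangles whose interiors meet the horizontal line T = p (the
   perpendicular bisector of the left side) are exactly those with u = p.
   The triangle's label (left to right) is 1 + number of such triangles of
   H_{p,b,c} strictly to its left. H_{p,b,c;d} removes labels 1..2d. *)
definition hexd :: "nat \<Rightarrow> nat \<Rightarrow> nat \<Rightarrow> nat \<Rightarrow> (int \<times> int) set" where
  "hexd p b c d = hex p b c -
     {t \<in> hex p b c. snd t = int p \<and>
        card {t' \<in> hex p b c. snd t' = int p \<and> fst t' < fst t} < 2 * d}"

definition lozenge_tilings :: "(int \<times> int) set \<Rightarrow> (int \<times> int) set set set" where
  "lozenge_tilings R = {L. (\<forall>l \<in> L. \<exists>t t'. l = {t, t'} \<and> tri_adj t t') \<and>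
       \<Union>L = R \<and> (\<forall>l \<in> L. \<forall>l' \<in> L. l \<noteq> l' \<longrightarrow> l \<inter> l' = {})}"

definition M :: "(int \<times> int) set \<Rightarrow> nat" where
  "M R = card (lozenge_tilings R)"

(* Glaisher-Kinkelin constant, via the limit in the paper; G(n+1) = prod_{i<n} i! *)
definition glaisher :: real where
  "glaisher = lim (\<lambda>n. (2 * pi) powr (real n / 2) *
      real n powr (real n ^ 2 / 2 - 1 / 12) * exp (- 3 / 4 * real n ^ 2 + 1 / 12)
      / (\<Prod>i<n. fact i))"

definition K1 :: "real \<Rightarrow> real \<Rightarrow> real \<Rightarrow> real \<Rightarrow> real" where
  "K1 a b c d = (let s = b / 2 + c / 2 in
     ((a + d) / (a * d)) powr (1/8) *
     ((b * c * (a + b - d) * (a + c - d)) / ((a + b) * (a + c) * (b - d) * (c - d))) powr (1/12) *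
     (((a + s) * (s - d)) / (s * (a + s - d))) powr (1/24))"

definition K2 :: "real \<Rightarrow> real \<Rightarrow> real \<Rightarrow> real \<Rightarrow> real" where
  "K2 a b c d = (let s = b / 2 + c / 2 in
     (a powr a * d powr d * s powr s * (a + s - d) powr (a + s - d)) /
     ((a + d) powr (a + d) * (a + s) powr (a + s) * (s - d) powr (s - d)))"

definition K3 :: "real \<Rightarrow> real \<Rightarrow> real \<Rightarrow> real \<Rightarrow> real" where
  "K3 a b c d = (let s = b / 2 + c / 2 in
     (s powr (2 * s^2) / (b powr (b^2) * c powr (c^2))) *
     ((a + s - d) powr (2 * (a + s - d)^2) /
        ((a + b - d) powr ((a + b - d)^2) * (a + c - d) powr ((a + c - d)^2))) *
     ((b - d) powr ((b - d)^2) * (c - d) powr ((c - d)^2) / (s - d) powr (2 * (s - d)^2)) *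
     ((a + b) powr ((a + b)^2) * (a + c) powr ((a + c)^2) / (a + s) powr (2 * (a + s)^2)))"

definition L1 :: "real \<Rightarrow> real \<Rightarrow> real \<Rightarrow> real \<Rightarrow> real" where
  "L1 a b c d = (let s = b / 2 + c / 2 in
     ((a + s - d) / (a + s)) powr (11/24) *
     (((a + b) * (a + c)) / ((a + b - d) * (a + c - d))) powr (5/12) *
     ((a + d) / (a * d)) powr (1/8) *
     ((b * c) / ((b - d) * (c - d))) powr (1/12) *
     ((s - d) / s) powr (1/24))"

definition L2 :: "real \<Rightarrow> real \<Rightarrow> real \<Rightarrow> real \<Rightarrow> real" where
  "L2 a b c d = (let s = b / 2 + c / 2 in
     ((a + d) powr (a + d) / (a powr a * d powr d) *
      ((a + s) powr (a + s) * (s - d) powr (s - d) / ((a + s - d) powr (a + s - d) * s powr s))) *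
     (1 / 4 powr d *
      ((a + b) powr (a + b) * (a + c) powr (a + c) / (a + s) powr (2 * (a + s))) *
      ((a + s - d) powr (2 * (a + s - d)) /
         ((a + b - d) powr (a + b - d) * (a + c - d) powr (a + c - d)))) ^ 2)"

end

theory Submission
  imports Defs "HOL-Analysis.Gamma_Function" "HOL-Real_Asymp.Real_Asymp"
    "Jordan_Normal_Form.Determinant"
begin

text \<open>
  On every vertical lattice line, the unit edges that are not covered by a lozenge form a particle
  configuration, and from one line to the next each particle moves half a unit up or down. The number
  of tilings is therefore a determinant of counts of single lattice paths. The slit acts as a wall, so
  these counts are given by the reflection principle up to the tip of the slit.

  Fix \<open>n = b + c\<close> and put \<open>a = p div 2\<close>. After factorials have been pulled out of column \<open>j\<close>, row \<open>i\<close> is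
  a polynomial evaluated at \<open>b + j\<close>, and the determinant is a polynomial \<open>W\<close> in \<open>b\<close>. The rows that belong
  to paths above the slit vanish at \<open>0, \<dots>, a + d - 1\<close>, the rows below the slit at the mirror images of
  these points. Hence every term of the Leibniz expansion is divisible by the product of
  \<open>(b + i - k) (c + i - k)\<close> over \<open>i < p - a\<close> and \<open>k < d\<close>. Combining each row with its mirror image turns
  the rows into \<open>a\<close> odd polynomials of degree at most \<open>p - 1\<close> and \<open>p - a\<close> even polynomials of degree at
  most \<open>p - 1 + 2 d\<close>, which forces \<open>deg W \<le> 2 d (p - a)\<close>. So \<open>W\<close> is a constant multiple of the product.
  The constant is read off at \<open>b = d\<close>, where the matrix is block triangular and both blocks reduce to
  Vandermonde determinants in the squares of the positions. The asymptotics of the resulting product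
  of factorials follow from Stirling's formula and the definition of the Glaisher constant.
\<close>

subsection \<open>Determinants of functions of two indices\<close>

text \<open>The delicate point is the degree bound. The entries have degree up to
  \<open>2 * d + p - 1\<close>, so the Leibniz expansion alone allows degree
  \<open>p * (2 * d + p - 1)\<close>, whereas the divisor has degree \<open>2 * d * (p - a)\<close>;
  the cofactor is a constant only because the true degree drops all the way. Two effects close the
  gap. A row minus its mirror image counts unrestricted paths, and the Chu-Vandermonde identity sums
  these to a polynomial of degree at most \<open>p - 1\<close> times a factor depending on
  \<open>n\<close> alone. And a determinant of powers of \<open>X + z j\<close> loses at least
  \<open>0 + 1 + ... + (p - 1)\<close> from its exponent sum, because equal exponents give equal
  rows. The count \<open>p - a\<close> instead of \<open>a\<close> is due to odd \<open>p\<close>: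
  the particle resting at the slit is its own mirror image and belongs both to the rows above and to
  the rows below. The full hexagon is the case of an empty slit, so one formula serves numerator and
  denominator.\<close>

definition detf :: "nat \<Rightarrow> (nat \<Rightarrow> nat \<Rightarrow> 'a) \<Rightarrow> 'a :: comm_ring_1" where
  "detf n f = Determinant.det (Matrix.mat n n (\<lambda>(i, j). f i j))"

lemma detf_cong:
  assumes "\<And>i j. i < n \<Longrightarrow> j < n \<Longrightarrow> f i j = g i j"
  shows "detf n f = detf n g"
  unfolding detf_def by (rule arg_cong[where f = Determinant.det]) (auto simp: assms)

lemma detf_leibniz:
  "detf n f = (\<Sum>\<pi> | \<pi> permutes {0..<n}. signof \<pi> * (\<Prod>i = 0..<n. f i (\<pi> i)))"
  unfolding detf_def
  by (subst Determinant.det_def'[where n = n]) (auto intro!: sum.cong prod.cong simp: permutes_in_image)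

lemma detf_transpose: "detf n (\<lambda>i j. f j i) = detf n f"
proof -
  have "Matrix.mat n n (\<lambda>(i, j). f j i) = transpose_mat (Matrix.mat n n (\<lambda>(i, j). f i j))"
    by auto
  then show ?thesis
    unfolding detf_def by (simp add: Determinant.det_transpose[where n = n])
qed

text \<open>Multilinearity in all rows at once. It serves to split entries that are sums into many
  determinants, most of which then vanish for having equal or zero rows.\<close>

lemma detf_expand_rows:
  assumes "\<And>i. i < n \<Longrightarrow> finite (A i)"
  shows "detf n (\<lambda>i j. \<Sum>m\<in>A i. g i m j) = (\<Sum>\<phi>\<in>PiE {0..<n} A. detf n (\<lambda>i j. g i (\<phi> i) j))"
proof -
  have "(\<Prod>i = 0..<n. \<Sum>m\<in>A i. g i m (\<pi> i)) = (\<Sum>\<phi>\<in>PiE {0..<n} A. \<Prod>i = 0..<n. g i (\<phi> i) (\<pi> i))" for \<pi>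
    by (rule prod_sum_PiE) (use assms in auto)
  then show ?thesis
    unfolding detf_leibniz by (simp add: sum_distrib_left sum.swap[of _ "{\<pi>. \<pi> permutes {0..<n}}"])
qed

lemma detf_expand_cols:
  assumes "\<And>j. j < n \<Longrightarrow> finite (A j)"
  shows "detf n (\<lambda>i j. \<Sum>m\<in>A j. g j m i) = (\<Sum>\<phi>\<in>PiE {0..<n} A. detf n (\<lambda>i j. g j (\<phi> j) i))"
  using detf_expand_rows[of n A g, OF assms] detf_transpose[of n "\<lambda>j i. \<Sum>m\<in>A j. g j m i"]
    detf_transpose[of n "\<lambda>j i. g j (\<phi> j) i" for \<phi>]
  by simp

lemma detf_mult_rows: "detf n (\<lambda>i j. c i * f i j) = (\<Prod>i = 0..<n. c i) * detf n f"
  unfolding detf_leibniz by (simp add: prod.distrib sum_distrib_left mult_ac)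

lemma detf_mult_cols: "detf n (\<lambda>i j. c j * f i j) = (\<Prod>i = 0..<n. c i) * detf n f"
  using detf_mult_rows[of n c "\<lambda>j i. f i j"] detf_transpose[of n f]
    detf_transpose[of n "\<lambda>i j. c j * f i j"] by simp

lemma detf_proportional_rows:
  fixes f :: "nat \<Rightarrow> nat \<Rightarrow> 'a :: comm_ring_1"
  assumes "i < n" "k < n" "i \<noteq> k" "\<And>j. j < n \<Longrightarrow> f i j = c * f k j"
  shows "detf n f = 0"
proof -
  define g where "g = (\<lambda>i'. if i' = i then f k else f i')"
  define c' where "c' = (\<lambda>i'. if i' = i then c else 1)"
  have "detf n f = detf n (\<lambda>i j. c' i * g i j)"
    by (rule detf_cong) (auto simp: g_def c'_def assms)
  also have "\<dots> = (\<Prod>i = 0..<n. c' i) * detf n g"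
    by (rule detf_mult_rows)
  also have "detf n g = 0"
    unfolding detf_def
    by (rule Determinant.det_identical_rows[where n = n and i = i and j = k])
       (use assms in \<open>auto simp: g_def Matrix.row_def\<close>)
  finally show ?thesis by simp
qed

lemma detf_identical_rows:
  assumes "i < n" "k < n" "i \<noteq> k" "\<And>j. j < n \<Longrightarrow> f i j = f k j"
  shows "detf n f = 0"
  by (rule detf_proportional_rows[of i n k f 1]) (use assms in auto)

lemma detf_identical_cols:
  assumes "i < n" "k < n" "i \<noteq> k" "\<And>j. j < n \<Longrightarrow> f j i = f j k"
  shows "detf n f = 0"
  using detf_identical_rows[of i n k "\<lambda>i j. f j i"] assms detf_transpose[of n f] by auto

lemma detf_zero_row:
  assumes "i < n" "\<And>j. j < n \<Longrightarrow> f i j = 0"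
  shows "detf n f = 0"
  unfolding detf_leibniz
proof (rule sum.neutral, safe)
  fix \<pi> assume "\<pi> permutes {0..<n}"
  then have "\<pi> i < n" using assms(1) permutes_in_image[of \<pi> "{0..<n}" i] by simp
  then have "(\<Prod>i = 0..<n. f i (\<pi> i)) = 0" using assms by (intro prod_zero bexI[of _ i]) auto
  then show "signof \<pi> * (\<Prod>i = 0..<n. f i (\<pi> i)) = 0" by simp
qed

lemma detf_zero_col:
  assumes "i < n" "\<And>j. j < n \<Longrightarrow> f j i = 0"
  shows "detf n f = 0"
  using detf_zero_row[of i n "\<lambda>i j. f j i"] assms detf_transpose[of n f] by auto

lemma detf_mult:
  "detf n (\<lambda>i j. \<Sum>k = 0..<n. f i k * g k j) = detf n f * detf n g"
proof -
  have "Matrix.mat n n (\<lambda>(i, j). \<Sum>k = 0..<n. f i k * g k j)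
      = Matrix.mat n n (\<lambda>(i, j). f i j) * Matrix.mat n n (\<lambda>(i, j). g i j)"
    by (rule eq_matI) (auto simp: scalar_prod_def)
  then show ?thesis
    unfolding detf_def by (simp add: Determinant.det_mult[where n = n])
qed

lemma detf_upper_triangular:
  assumes "\<And>i j. i < n \<Longrightarrow> j < i \<Longrightarrow> f i j = 0"
  shows "detf n f = (\<Prod>i = 0..<n. f i i)"
  unfolding detf_def
  by (subst Determinant.det_upper_triangular[where n = n])
     (use assms in \<open>auto simp: upper_triangular_def diag_mat_def prod.list_conv_set_nth
        simp flip: prod.distinct_set_conv_list intro!: prod.cong\<close>)

lemma detf_lower_triangular:
  assumes "\<And>i j. j < n \<Longrightarrow> i < j \<Longrightarrow> f i j = 0"
  shows "detf n f = (\<Prod>i = 0..<n. f i i)"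
  using detf_upper_triangular[of n "\<lambda>i j. f j i"] assms detf_transpose[of n f] by auto

lemma detf_block:
  fixes f :: "nat \<Rightarrow> nat \<Rightarrow> 'a :: idom"
  assumes "\<And>i j. k \<le> i \<Longrightarrow> i < k + l \<Longrightarrow> j < k \<Longrightarrow> f i j = 0"
  shows "detf (k + l) f = detf k f * detf l (\<lambda>i j. f (k + i) (k + j))"
proof -
  have "Matrix.mat (k + l) (k + l) (\<lambda>(i, j). f i j)
      = four_block_mat (Matrix.mat k k (\<lambda>(i, j). f i j)) (Matrix.mat k l (\<lambda>(i, j). f i (k + j)))
          (0\<^sub>m l k) (Matrix.mat l l (\<lambda>(i, j). f (k + i) (k + j)))"
    by (rule eq_matI) (auto simp: assms)
  then show ?thesis
    unfolding detf_def
    by (simp add: Determinant.det_four_block_mat_lower_left_zero[where n = k and m = l])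
qed

text \<open>Reversing rows and columns together conjugates every permutation by the reversal, which
  preserves signs.\<close>

lemma detf_reverse:
  "detf n (\<lambda>i j. f (n - 1 - i) (n - 1 - j)) = detf n f"
proof -
  define \<rho> where "\<rho> i = (if i < n then n - 1 - i else i)" for i
  have inv: "\<rho> (\<rho> i) = i" for i by (auto simp: \<rho>_def)
  have \<rho>: "\<rho> permutes {0..<n}"
    by (rule bij_imp_permutes) (auto intro!: bij_betwI[of _ _ _ \<rho>] simp: inv, auto simp: \<rho>_def)
  have comp: "signof (\<rho> \<circ> \<pi> \<circ> \<rho>) = (signof \<pi> :: 'a)" if "\<pi> permutes {0..<n}" for \<pi>
  proof -
    have p: "permutation \<rho>" "permutation \<pi>"
      using \<rho> that by (auto intro: permutation_permutes[THEN iffD2] exI[of _ "{0..<n}"])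
    have "sign (\<rho> \<circ> \<pi> \<circ> \<rho>) = sign \<rho> * sign \<rho> * sign \<pi>"
      using p by (simp add: sign_compose permutation_compose mult_ac)
    then show ?thesis by (simp add: sign_idempotent)
  qed
  show ?thesis
    unfolding detf_leibniz
  proof (rule sum.reindex_bij_witness[of _ "\<lambda>\<pi>. \<rho> \<circ> \<pi> \<circ> \<rho>" "\<lambda>\<pi>. \<rho> \<circ> \<pi> \<circ> \<rho>"]; (safe)?)
    fix \<pi> assume \<pi>: "\<pi> permutes {0..<n}"
    show "\<rho> \<circ> (\<rho> \<circ> \<pi> \<circ> \<rho>) \<circ> \<rho> = \<pi>" "\<rho> \<circ> (\<rho> \<circ> \<pi> \<circ> \<rho>) \<circ> \<rho> = \<pi>" by (auto simp: inv)
    show "(\<rho> \<circ> \<pi> \<circ> \<rho>) permutes {0..<n}" "(\<rho> \<circ> \<pi> \<circ> \<rho>) permutes {0..<n}"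
      using \<rho> \<pi> by (auto intro: permutes_compose)
    have "(\<Prod>i = 0..<n. f (n - 1 - i) (n - 1 - \<pi> i)) = (\<Prod>i = 0..<n. f i ((\<rho> \<circ> \<pi> \<circ> \<rho>) i))"
      by (rule prod.reindex_bij_witness[of _ \<rho> \<rho>])
         (use \<pi> in \<open>auto simp: inv, auto simp: \<rho>_def permutes_in_image dest: permutes_in_image\<close>)
    then show "signof (\<rho> \<circ> \<pi> \<circ> \<rho>) * (\<Prod>i = 0..<n. f i ((\<rho> \<circ> \<pi> \<circ> \<rho>) i))
        = signof \<pi> * (\<Prod>i = 0..<n. f (n - 1 - i) (n - 1 - \<pi> i))"
      using comp[OF \<pi>] by simp
  qed
qed

lemma poly_detf: "poly (detf n f) x = detf n (\<lambda>i j. poly (f i j) x)"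
  unfolding detf_leibniz by (simp add: poly_sum poly_prod sign_def)

text \<open>Passing from powers to the Newton basis \<open>P i\<close> multiplies by a unitriangular
  coefficient matrix, and \<open>P i\<close> vanishes at \<open>x j\<close> for
  \<open>j < i\<close>, so the new matrix is triangular.\<close>

lemma detf_vandermonde:
  fixes x :: "nat \<Rightarrow> 'a :: idom"
  shows "detf n (\<lambda>i j. x j ^ i) = (\<Prod>j = 0..<n. \<Prod>i = 0..<j. x j - x i)"
proof -
  define P where "P i = (\<Prod>k = 0..<i. [:- x k, 1:])" for i
  have deg: "degree (P i) = i" for i
    unfolding P_def by (subst degree_prod_sum_eq) auto
  have lead: "coeff (P i) i = 1" for i
    using lead_coeff_prod[of "\<lambda>k. [:- x k, 1:]" "{0..<i}"] deg[of i] by (simp add: P_def)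
  have val: "poly (P i) y = (\<Prod>k = 0..<i. y - x k)" for i y
    by (simp add: P_def poly_prod)
  have "detf n (\<lambda>i j. poly (P i) (x j)) = detf n (\<lambda>i j. \<Sum>k = 0..<n. coeff (P i) k * x j ^ k)"
  proof (rule detf_cong)
    fix i j assume "i < n" "j < n"
    have "poly (P i) (x j) = (\<Sum>k\<le>i. coeff (P i) k * x j ^ k)"
      by (simp add: poly_altdef deg)
    also have "\<dots> = (\<Sum>k = 0..<n. coeff (P i) k * x j ^ k)"
      by (rule sum.mono_neutral_left) (use \<open>i < n\<close> in \<open>auto simp: deg coeff_eq_0\<close>)
    finally show "poly (P i) (x j) = (\<Sum>k = 0..<n. coeff (P i) k * x j ^ k)" .
  qed
  also have "\<dots> = detf n (\<lambda>i k. coeff (P i) k) * detf n (\<lambda>k j. x j ^ k)"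
    by (rule detf_mult)
  also have "detf n (\<lambda>i k. coeff (P i) k) = 1"
    by (subst detf_lower_triangular) (auto simp: deg lead coeff_eq_0)
  finally have "detf n (\<lambda>k j. x j ^ k) = detf n (\<lambda>i j. poly (P i) (x j))" by simp
  also have "\<dots> = (\<Prod>i = 0..<n. poly (P i) (x i))"
    by (rule detf_upper_triangular) (auto simp: val intro!: prod_zero)
  finally show ?thesis by (simp add: val)
qed

subsection \<open>Tilings of the part to the left of a vertical line\<close>

lemma tri_adj_sym: "tri_adj t t' \<Longrightarrow> tri_adj t' t"
  by (auto simp: tri_adj_def split: prod.splits)

lemma lozenge_tilings_adj:
  "L \<in> lozenge_tilings R \<Longrightarrow> l \<in> L \<Longrightarrow> \<exists>t t'. l = {t, t'} \<and> tri_adj t t'"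
  by (simp add: lozenge_tilings_def)

lemma lozenge_tilings_Union: "L \<in> lozenge_tilings R \<Longrightarrow> \<Union>L = R"
  by (simp add: lozenge_tilings_def)

lemma lozenge_tilings_unique:
  assumes "L \<in> lozenge_tilings R" "l \<in> L" "l' \<in> L" "t \<in> l" "t \<in> l'"
  shows "l = l'"
proof -
  have "\<forall>l\<in>L. \<forall>l'\<in>L. l \<noteq> l' \<longrightarrow> l \<inter> l' = {}"
    using assms(1) by (simp add: lozenge_tilings_def)
  then show ?thesis using assms by blast
qed

lemma lozenge_tilingsI:
  assumes "\<And>l. l \<in> L \<Longrightarrow> \<exists>t t'. l = {t, t'} \<and> tri_adj t t'" "\<Union>L = R"
    and "\<And>l l' t. l \<in> L \<Longrightarrow> l' \<in> L \<Longrightarrow> t \<in> l \<Longrightarrow> t \<in> l' \<Longrightarrow> l = l'"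
  shows "L \<in> lozenge_tilings R"
proof -
  have "\<forall>l\<in>L. \<forall>l'\<in>L. l \<noteq> l' \<longrightarrow> l \<inter> l' = {}" using assms(3) by blast
  then show ?thesis using assms(1,2) by (simp add: lozenge_tilings_def)
qed

lemma lozenge_tilingsD:
  assumes "L \<in> lozenge_tilings R" "t \<in> R"
  obtains t' where "{t, t'} \<in> L" "tri_adj t t'" "t' \<in> R"
proof -
  from assms obtain l where l: "l \<in> L" "t \<in> l"
    using lozenge_tilings_Union[OF assms(1)] by blast
  obtain t1 t2 where t: "l = {t1, t2}" "tri_adj t1 t2"
    using lozenge_tilings_adj[OF assms(1) l(1)] by blast
  have "t1 \<in> R" "t2 \<in> R" using lozenge_tilings_Union[OF assms(1)] l t by blast+
  then show ?thesis
    using l t that[of t1] that[of t2] tri_adj_sym[of t1 t2] by (auto simp: insert_commute)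
qed

lemma finite_lozenge_tilings: "finite R \<Longrightarrow> finite (lozenge_tilings R)"
  by (rule finite_subset[of _ "Pow (Pow R)"]) (use lozenge_tilings_Union in blast, simp)

lemma lozenge_tilings_empty: "lozenge_tilings {} = {{}}"
  by (auto simp: lozenge_tilings_def)

lemma lozenge_tilings_Un:
  assumes "L \<in> lozenge_tilings Y" "D \<in> lozenge_tilings X" "X \<inter> Y = {}"
  shows "L \<union> D \<in> lozenge_tilings (X \<union> Y)"
proof -
  have U: "\<Union>L = Y" "\<Union>D = X" using assms lozenge_tilings_Union by blast+
  show ?thesis
  proof (rule lozenge_tilingsI)
    fix l assume "l \<in> L \<union> D"
    then show "\<exists>t t'. l = {t, t'} \<and> tri_adj t t'"
      using lozenge_tilings_adj[OF assms(1)] lozenge_tilings_adj[OF assms(2)] by (elim UnE) simp_all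
  next
    show "\<Union>(L \<union> D) = X \<union> Y" using U by blast
  next
    fix l l' t assume *: "l \<in> L \<union> D" "l' \<in> L \<union> D" "t \<in> l" "t \<in> l'"
    then have "l \<in> L \<and> l' \<in> L \<or> l \<in> D \<and> l' \<in> D" using U assms(3) by blast
    then show "l = l'"
      using * lozenge_tilings_unique[OF assms(1), of l l' t] lozenge_tilings_unique[OF assms(2), of l l' t]
      by blast
  qed
qed

lemma lozenge_tilings_Diff:
  assumes "L \<in> lozenge_tilings (X \<union> Y)" "D \<subseteq> L" "\<Union>D = X" "X \<inter> Y = {}"
  shows "L - D \<in> lozenge_tilings Y"
proof -
  have "\<Union>(L - D) \<subseteq> Y"
  proof
    fix t assume "t \<in> \<Union>(L - D)"
    then obtain l where l: "l \<in> L" "l \<notin> D" "t \<in> l" by auto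
    then have "t \<in> X \<union> Y" using lozenge_tilings_Union[OF assms(1)] by blast
    moreover have "t \<notin> X"
    proof
      assume "t \<in> X"
      then obtain l' where "l' \<in> D" "t \<in> l'" using assms(3) by auto
      then show False using lozenge_tilings_unique[OF assms(1), of l l' t] l assms(2) by auto
    qed
    ultimately show "t \<in> Y" by simp
  qed
  moreover have "Y \<subseteq> \<Union>(L - D)"
  proof
    fix t assume "t \<in> Y"
    then have "t \<in> \<Union>L" "t \<notin> \<Union>D" using lozenge_tilings_Union[OF assms(1)] assms(3,4) by blast+
    then show "t \<in> \<Union>(L - D)" by blast
  qed
  ultimately have "\<Union>(L - D) = Y" by blast
  then show ?thesis
    using lozenge_tilings_adj[OF assms(1)] lozenge_tilings_unique[OF assms(1)]
    by (intro lozenge_tilingsI) blast+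
qed

lemma lozenge_tilings_nonempty: "L \<in> lozenge_tilings R \<Longrightarrow> l \<in> L \<Longrightarrow> l \<noteq> {}"
  using lozenge_tilings_adj[of L R l] by auto

text \<open>Forced lozenges can be cut away without changing the count; this is how a strip is
  removed from the region.\<close>

lemma card_lozenge_tilings_fixed:
  assumes "D \<in> lozenge_tilings X" "X \<inter> Y = {}"
  shows "card {L \<in> lozenge_tilings (X \<union> Y). D \<subseteq> L} = card (lozenge_tilings Y)"
proof -
  have D: "\<Union>D = X" using lozenge_tilings_Union assms(1) by blast
  have dj: "L \<inter> D = {}" if "L \<in> lozenge_tilings Y" for L
  proof (rule ccontr)
    assume "L \<inter> D \<noteq> {}"
    then obtain l where l: "l \<in> L" "l \<in> D" by auto
    then have "l \<subseteq> X" "l \<subseteq> Y" using lozenge_tilings_Union[OF assms(1)] lozenge_tilings_Union[OF that] by blast+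
    then show False using lozenge_tilings_nonempty[OF that l(1)] assms(2) by auto
  qed
  have "bij_betw (\<lambda>L. L \<union> D) (lozenge_tilings Y) {L \<in> lozenge_tilings (X \<union> Y). D \<subseteq> L}"
  proof (rule bij_betwI[where g = "\<lambda>L. L - D"])
    show "(\<lambda>L. L \<union> D) \<in> lozenge_tilings Y \<rightarrow> {L \<in> lozenge_tilings (X \<union> Y). D \<subseteq> L}"
      using lozenge_tilings_Un[OF _ assms] by simp
    show "(\<lambda>L. L - D) \<in> {L \<in> lozenge_tilings (X \<union> Y). D \<subseteq> L} \<rightarrow> lozenge_tilings Y"
      using lozenge_tilings_Diff[OF _ _ D assms(2)] by simp
    show "L \<union> D - D = L" if "L \<in> lozenge_tilings Y" for L
      using dj[OF that] by blast
    show "L - D \<union> D = L" if "L \<in> {L \<in> lozenge_tilings (X \<union> Y). D \<subseteq> L}" for L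
      using that by blast
  qed
  then show ?thesis by (simp add: bij_betw_same_card)
qed

text \<open>The part of \<open>R\<close> to the left of the vertical line \<open>x = k\<close>, where of the triangles with an
  edge on that line only those at heights in \<open>S\<close> are kept; the others are thought of as being
  covered by lozenges that straddle the line.\<close>

definition left_part :: "(int \<times> int) set \<Rightarrow> int \<Rightarrow> int set \<Rightarrow> (int \<times> int) set" where
  "left_part R k S = {(x, u) \<in> R. x < k \<and> (x = k - 1 \<and> even (u - x) \<longrightarrow> u \<in> S)}"

text \<open>The last strip is filled first. A kept left-pointing triangle has lost its right
  neighbour, so its partner is one of two right-pointing triangles in the same strip; this choice is
  the step \<open>\<epsilon> j\<close>. Every other right-pointing triangle of the strip is forced
  into a lozenge across the line \<open>x = k\<close>. Thus \<open>\<epsilon>\<close> fixes all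
  lozenges that meet the strip, what remains is again a left part, and \<open>valid\<close> says
  that the forced lozenges exist and are disjoint.\<close>

lemma M_left_part_Suc:
  fixes s :: "nat \<Rightarrow> int"
  assumes R: "finite R" and J: "finite J" and s: "inj_on s J"
    and sR: "\<And>j. j \<in> J \<Longrightarrow> (k, s j) \<in> R \<and> even (s j - k)"
    and conv: "\<And>u. (k - 1, u) \<in> R \<Longrightarrow> odd (u - k) \<Longrightarrow> (k, u) \<in> R"
  defines "valid \<equiv> \<lambda>\<epsilon>. inj_on (\<lambda>j. s j + \<epsilon> j) J \<and> (\<forall>j\<in>J. (k, s j + \<epsilon> j) \<in> R) \<and>
     (\<forall>u. (k, u) \<in> R \<and> odd (u - k) \<and> u \<notin> (\<lambda>j. s j + \<epsilon> j) ` J \<longrightarrow> (k - 1, u) \<in> R)"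
  shows "M (left_part R (k + 1) (s ` J)) =
    (\<Sum>\<epsilon>\<in>PiE J (\<lambda>_. {-1, 1}). if valid \<epsilon> then M (left_part R k ((\<lambda>j. s j + \<epsilon> j) ` J)) else 0)"
proof -
  define E where "E = PiE J (\<lambda>_. {-1, 1 :: int})"
  define im where "im \<epsilon> = (\<lambda>j. s j + \<epsilon> j) ` J" for \<epsilon>
  define rest where "rest \<epsilon> = {u. (k, u) \<in> R \<and> odd (u - k) \<and> u \<notin> im \<epsilon>}" for \<epsilon>
  define D where "D \<epsilon> = (\<lambda>j. {(k, s j), (k, s j + \<epsilon> j)}) ` J \<union> (\<lambda>u. {(k - 1, u), (k, u)}) ` rest \<epsilon>" for \<epsilon>
  define X where "X \<epsilon> = \<Union>(D \<epsilon>)" for \<epsilon>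
  define T where "T = lozenge_tilings (left_part R (k + 1) (s ` J))"
  have finE: "finite E" unfolding E_def using J by (intro finite_PiE) auto
  have pm: "\<epsilon> j = -1 \<or> \<epsilon> j = 1" if "\<epsilon> \<in> E" "j \<in> J" for \<epsilon> j
    using that by (auto simp: E_def)
  have oddim: "odd (s j + \<epsilon> j - k)" if "\<epsilon> \<in> E" "j \<in> J" for \<epsilon> j
    using pm[OF that] sR[OF that(2)] by auto
  have ex: "\<exists>\<epsilon>\<in>E. valid \<epsilon> \<and> D \<epsilon> \<subseteq> L" if L: "L \<in> T" for L
  proof -
    have "\<exists>e. (e = -1 \<or> e = 1) \<and> {(k, s j), (k, s j + e)} \<in> L \<and> (k, s j + e) \<in> R" if j: "j \<in> J" for j
    proof -
      have "(k, s j) \<in> left_part R (k + 1) (s ` J)" using sR[OF j] j by (auto simp: left_part_def)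
      then obtain t' where t': "{(k, s j), t'} \<in> L" "tri_adj (k, s j) t'" "t' \<in> left_part R (k + 1) (s ` J)"
        using lozenge_tilingsD L unfolding T_def by blast
      obtain k' u' where [simp]: "t' = (k', u')" by (cases t')
      have "k' = k" "\<bar>s j - u'\<bar> = 1"
        using t'(2,3) sR[OF j] by (auto simp: tri_adj_def left_part_def)
      then have "(k', u') = (k, s j + (u' - s j)) \<and> (u' - s j = -1 \<or> u' - s j = 1)" by auto
      then show ?thesis
        using t' by (intro exI[of _ "u' - s j"]) (auto simp: left_part_def)
    qed
    then obtain e where e: "\<And>j. j \<in> J \<Longrightarrow> (e j = -1 \<or> e j = 1) \<and> {(k, s j), (k, s j + e j)} \<in> L \<and> (k, s j + e j) \<in> R"
      by metis
    define \<epsilon> where "\<epsilon> = restrict e J"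
    have \<epsilon>E: "\<epsilon> \<in> E" using e by (auto simp: \<epsilon>_def E_def)
    have \<epsilon>: "{(k, s j), (k, s j + \<epsilon> j)} \<in> L" "(k, s j + \<epsilon> j) \<in> R" if "j \<in> J" for j
      using e that by (auto simp: \<epsilon>_def)
    have inj: "inj_on (\<lambda>j. s j + \<epsilon> j) J"
    proof (rule inj_onI)
      fix i j assume ij: "i \<in> J" "j \<in> J" "s i + \<epsilon> i = s j + \<epsilon> j"
      then have "{(k, s i), (k, s i + \<epsilon> i)} = {(k, s j), (k, s j + \<epsilon> j)}"
        using lozenge_tilings_unique[OF L[unfolded T_def] \<epsilon>(1) \<epsilon>(1), of i j "(k, s i + \<epsilon> i)"] by auto
      then have "s i = s j" using ij by (auto simp: doubleton_eq_iff)
      then show "i = j" using s ij by (auto dest: inj_onD)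
    qed
    have r: "{(k - 1, u), (k, u)} \<in> L \<and> (k - 1, u) \<in> R" if u: "u \<in> rest \<epsilon>" for u
    proof -
      have "(k, u) \<in> left_part R (k + 1) (s ` J)" using u by (auto simp: left_part_def rest_def)
      then obtain t' where t': "{(k, u), t'} \<in> L" "tri_adj (k, u) t'" "t' \<in> left_part R (k + 1) (s ` J)"
        using lozenge_tilingsD L unfolding T_def by blast
      obtain k' u' where [simp]: "t' = (k', u')" by (cases t')
      \<comment> \<open>A partner in the same strip would be a kept left-pointing triangle, but each
        of these is already matched with the triangle its particle moves to.\<close>
      have "k' \<noteq> k"
      proof
        assume [simp]: "k' = k"
        have "u' = u + 1 \<or> u' = u - 1" using t'(2) by (auto simp: tri_adj_def)
        then have "even (u' - k)" using u by (auto simp: rest_def)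
        then obtain j where j: "j \<in> J" "u' = s j" using t'(3) by (auto simp: left_part_def)
        then have "{(k, u), (k, s j)} = {(k, s j), (k, s j + \<epsilon> j)}"
          using lozenge_tilings_unique[OF L[unfolded T_def] t'(1) \<epsilon>(1), of j "(k, s j)"] by auto
        then have "u = s j + \<epsilon> j \<or> u = s j" by (auto simp: doubleton_eq_iff)
        then show False using j u sR[of j] by (auto simp: rest_def im_def)
      qed
      then have "k' = k - 1 \<and> u' = u"
        using t'(2) u by (auto simp: tri_adj_def rest_def)
      then show ?thesis using t' by (auto simp: left_part_def insert_commute)
    qed
    have "valid \<epsilon>" using inj \<epsilon> r by (auto simp: valid_def rest_def im_def)
    moreover have "D \<epsilon> \<subseteq> L" using \<epsilon> r by (auto simp: D_def)
    ultimately show ?thesis using \<epsilon>E by auto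
  qed
  have uniq: "\<epsilon> = \<epsilon>'" if "L \<in> T" "\<epsilon> \<in> E" "\<epsilon>' \<in> E" "D \<epsilon> \<subseteq> L" "D \<epsilon>' \<subseteq> L" for \<epsilon> \<epsilon>' L
  proof (rule PiE_ext[OF that(2,3)[unfolded E_def]])
    fix j assume j: "j \<in> J"
    have "{(k, s j), (k, s j + \<epsilon> j)} = {(k, s j), (k, s j + \<epsilon>' j)}"
      by (rule lozenge_tilings_unique[OF that(1)[unfolded T_def], of _ _ "(k, s j)"])
         (use that(4,5) j in \<open>auto simp: D_def\<close>)
    then show "\<epsilon> j = \<epsilon>' j" by (auto simp: doubleton_eq_iff)
  qed
  have split: "left_part R (k + 1) (s ` J) = X \<epsilon> \<union> left_part R k (im \<epsilon>)"
      "X \<epsilon> \<inter> left_part R k (im \<epsilon>) = {}" if "\<epsilon> \<in> E" "valid \<epsilon>" for \<epsilon>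
  proof -
    have X: "X \<epsilon> = {(x, u). x = k \<and> (u \<in> s ` J \<or> u \<in> im \<epsilon> \<or> u \<in> rest \<epsilon>) \<or> x = k - 1 \<and> u \<in> rest \<epsilon>}"
      by (auto simp: X_def D_def im_def)
    have XR: "X \<epsilon> \<subseteq> R"
      using that sR by (auto simp: X valid_def im_def rest_def)
    show "left_part R (k + 1) (s ` J) = X \<epsilon> \<union> left_part R k (im \<epsilon>)"
    proof (intro equalityI subsetI)
      fix t assume t: "t \<in> left_part R (k + 1) (s ` J)"
      obtain x u where [simp]: "t = (x, u)" by (cases t)
      have t': "(x, u) \<in> R" "x < k + 1" "x = k \<Longrightarrow> even (u - k) \<Longrightarrow> u \<in> s ` J"
        using t by (auto simp: left_part_def)
      consider "x = k" | "x = k - 1" "even (u - x)" "u \<notin> im \<epsilon>" | "x < k" "x = k - 1 \<Longrightarrow> even (u - x) \<Longrightarrow> u \<in> im \<epsilon>"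
        using t' by linarith
      then show "t \<in> X \<epsilon> \<union> left_part R k (im \<epsilon>)"
      proof cases
        case 1 then show ?thesis using t' by (auto simp: X rest_def)
      next
        case 2
        \<comment> \<open>By \<open>conv\<close> the right neighbour of this triangle is in
          \<open>R\<close>, and no particle uses it, so the two form one of the forced lozenges
          across the line.\<close>
        then have "odd (u - k)" by auto
        then show ?thesis using 2 t' conv[of u] by (auto simp: X rest_def)
      next
        case 3 then show ?thesis using t' by (auto simp: left_part_def)
      qed
    next
      fix t assume t: "t \<in> X \<epsilon> \<union> left_part R k (im \<epsilon>)"
      obtain x u where [simp]: "t = (x, u)" by (cases t)
      have "(x, u) \<in> R" "x < k + 1" using t XR by (auto simp: X left_part_def)
      moreover have "u \<in> s ` J" if "x = k" "even (u - k)"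
        using t that oddim[OF \<open>\<epsilon> \<in> E\<close>] by (auto simp: X left_part_def rest_def im_def)
      ultimately show "t \<in> left_part R (k + 1) (s ` J)"
        by (auto simp: left_part_def)
    qed
    show "X \<epsilon> \<inter> left_part R k (im \<epsilon>) = {}"
      by (auto simp: X left_part_def rest_def)
  qed
  have Dtil: "D \<epsilon> \<in> lozenge_tilings (X \<epsilon>)" if "\<epsilon> \<in> E" "valid \<epsilon>" for \<epsilon>
  proof -
    have inj: "inj_on (\<lambda>j. s j + \<epsilon> j) J" using that by (auto simp: valid_def)
    have adj: "\<exists>t t'. l = {t, t'} \<and> tri_adj t t'" if l: "l \<in> D \<epsilon>" for l
    proof -
      from l consider j where "j \<in> J" "l = {(k, s j), (k, s j + \<epsilon> j)}"
        | u where "u \<in> rest \<epsilon>" "l = {(k - 1, u), (k, u)}"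
        by (auto simp: D_def)
      then show ?thesis
      proof cases
        case 1
        then have "tri_adj (k, s j) (k, s j + \<epsilon> j)"
          using pm[OF \<open>\<epsilon> \<in> E\<close>, of j] by (auto simp: tri_adj_def)
        then show ?thesis using 1 by blast
      next
        case 2
        then have "tri_adj (k - 1, u) (k, u)" by (auto simp: tri_adj_def rest_def)
        then show ?thesis using 2 by blast
      qed
    qed
    have neq: "s i + \<epsilon> i \<noteq> s j" if "i \<in> J" "j \<in> J" for i j
      using oddim[OF \<open>\<epsilon> \<in> E\<close> that(1)] sR[OF that(2)] by metis
    have dj: "l = l'" if "l \<in> D \<epsilon>" "l' \<in> D \<epsilon>" "t \<in> l" "t \<in> l'" for l l' t
    proof -
      have a: "{(k, s i), (k, s i + \<epsilon> i)} \<inter> {(k, s j), (k, s j + \<epsilon> j)} = {}"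
        if "i \<in> J" "j \<in> J" "i \<noteq> j" for i j
        using that neq[of i j] neq[of j i] inj_onD[OF inj] inj_onD[OF s] by auto
      have b: "{(k, s i), (k, s i + \<epsilon> i)} \<inter> {(k - 1, u), (k, u)} = {}"
        if "i \<in> J" "u \<in> rest \<epsilon>" for i u
        using that sR[OF that(1)] by (auto simp: rest_def im_def)
      from that show ?thesis
        unfolding D_def
      proof (elim UnE imageE)
        fix i j assume "i \<in> J" "j \<in> J"
          "l = {(k, s i), (k, s i + \<epsilon> i)}" "l' = {(k, s j), (k, s j + \<epsilon> j)}"
        then show ?thesis using a[of i j] that(3,4) by (cases "i = j") blast+
      next
        fix i u assume "i \<in> J" "u \<in> rest \<epsilon>"
          "l = {(k, s i), (k, s i + \<epsilon> i)}" "l' = {(k - 1, u), (k, u)}"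
        then show ?thesis using b[of i u] that(3,4) by blast
      next
        fix i u assume "i \<in> J" "u \<in> rest \<epsilon>"
          "l' = {(k, s i), (k, s i + \<epsilon> i)}" "l = {(k - 1, u), (k, u)}"
        then show ?thesis using b[of i u] that(3,4) by blast
      next
        fix u v assume "l = {(k - 1, u), (k, u)}" "l' = {(k - 1, v), (k, v)}"
        then show ?thesis using that(3,4) by auto
      qed
    qed
    show ?thesis
      by (rule lozenge_tilingsI[OF adj _ dj]) (simp_all add: X_def)
  qed
  have finL: "finite (left_part R (k + 1) (s ` J))"
    by (rule finite_subset[OF _ R]) (auto simp: left_part_def)
  have finT: "finite T" unfolding T_def by (rule finite_lozenge_tilings[OF finL])
  have "T = (\<Union>\<epsilon>\<in>{\<epsilon>\<in>E. valid \<epsilon>}. {L \<in> T. D \<epsilon> \<subseteq> L})" using ex by auto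
  then have "card T = card (\<Union>\<epsilon>\<in>{\<epsilon>\<in>E. valid \<epsilon>}. {L \<in> T. D \<epsilon> \<subseteq> L})" by simp
  also have "\<dots> = (\<Sum>\<epsilon>\<in>{\<epsilon>\<in>E. valid \<epsilon>}. card {L \<in> T. D \<epsilon> \<subseteq> L})"
  proof (rule card_UN_disjoint)
    show "finite {\<epsilon>\<in>E. valid \<epsilon>}" using finE by simp
    show "\<forall>\<epsilon>\<in>{\<epsilon>\<in>E. valid \<epsilon>}. finite {L \<in> T. D \<epsilon> \<subseteq> L}" using finT by simp
    show "\<forall>\<epsilon>\<in>{\<epsilon>\<in>E. valid \<epsilon>}. \<forall>\<epsilon>'\<in>{\<epsilon>\<in>E. valid \<epsilon>}. \<epsilon> \<noteq> \<epsilon>' \<longrightarrow>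
        {L \<in> T. D \<epsilon> \<subseteq> L} \<inter> {L \<in> T. D \<epsilon>' \<subseteq> L} = {}"
      using uniq by blast
  qed
  also have "\<dots> = (\<Sum>\<epsilon>\<in>{\<epsilon>\<in>E. valid \<epsilon>}. M (left_part R k (im \<epsilon>)))"
  proof (rule sum.cong[OF refl])
    fix \<epsilon> assume "\<epsilon> \<in> {\<epsilon>\<in>E. valid \<epsilon>}"
    then show "card {L \<in> T. D \<epsilon> \<subseteq> L} = M (left_part R k (im \<epsilon>))"
      using card_lozenge_tilings_fixed[OF Dtil, of \<epsilon> "left_part R k (im \<epsilon>)"] split[of \<epsilon>]
      by (simp add: T_def M_def)
  qed
  also have "\<dots> = (\<Sum>\<epsilon>\<in>E. if valid \<epsilon> then M (left_part R k (im \<epsilon>)) else 0)"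
    by (rule sum.inter_filter[OF finE])
  finally show ?thesis unfolding M_def T_def E_def im_def .
qed

subsection \<open>Nonintersecting paths around the slit\<close>

fun free_paths :: "nat \<Rightarrow> int \<Rightarrow> real" where
  "free_paths 0 r = (if r = 0 then 1 else 0)"
| "free_paths (Suc x) r = free_paths x (r - 1) + free_paths x (r + 1)"

text \<open>Paths from \<open>u\<close> to \<open>r\<close> that avoid \<open>0\<close>, by the reflection principle. For odd \<open>p\<close> no path starts in
  the middle of the left side; in its place, a particle at \<open>u = 0\<close> rests at \<open>0\<close> until the tip of the slit
  is reached, where it becomes the path that starts there.\<close>

definition half_paths :: "int \<Rightarrow> nat \<Rightarrow> int \<Rightarrow> real" where
  "half_paths u x r = (if u * r > 0 then free_paths x (r - u) - free_paths x (r + u)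
     else if u = 0 \<and> r = 0 then 1 else 0)"

text \<open>The wall acts during the first \<open>2 * d\<close> steps only. The recursion peels off
  the last step because the induction on regions removes the rightmost strip.\<close>

fun slit_paths :: "nat \<Rightarrow> int \<Rightarrow> nat \<Rightarrow> int \<Rightarrow> real" where
  "slit_paths d u 0 r = half_paths u (2 * d) r"
| "slit_paths d u (Suc t) r = slit_paths d u t (r - 1) + slit_paths d u t (r + 1)"

lemma free_paths_uminus [simp]: "free_paths x (- r) = free_paths x r"
proof (induction x arbitrary: r)
  case (Suc x)
  have e: "- r - 1 = - (r + 1)" "- r + 1 = - (r - 1)" by simp_all
  show ?case unfolding free_paths.simps e Suc by simp
qed auto

lemma free_paths_eq_0: "\<bar>r\<bar> > int x \<Longrightarrow> free_paths x r = 0"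
  by (induction x arbitrary: r) auto

lemma half_paths_0: "half_paths u 0 r = (if r = u then 1 else 0)"
  by (auto simp: half_paths_def zero_less_mult_iff)

lemma half_paths_center: "half_paths u x 0 = (if u = 0 then 1 else 0)"
  by (simp add: half_paths_def)

lemma half_paths_zero_start: "r \<noteq> 0 \<Longrightarrow> half_paths 0 x r = 0"
  by (simp add: half_paths_def)

lemma half_paths_eq_0: "\<bar>r\<bar> > \<bar>u\<bar> + int x \<Longrightarrow> half_paths u x r = 0"
  by (auto simp: half_paths_def free_paths_eq_0)

text \<open>The reflected difference solves the free recursion and vanishes at \<open>0\<close>,
  because \<open>free_paths\<close> is even; so a step from \<open>0\<close> contributes nothing,
  and along all other steps the sign of \<open>u * r\<close> is unchanged.\<close>

lemma half_paths_Suc: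
  assumes "r \<noteq> 0"
  shows "half_paths u (Suc x) r = (\<Sum>e\<in>{e \<in> {-1, 1}. r + e \<noteq> 0}. half_paths u x (r + e))"
proof (cases "u = 0")
  case True
  then show ?thesis using assms by (auto simp: half_paths_def)
next
  case False
  have eq: "half_paths u x (r + e) = (if u * r > 0 then free_paths x (r + e - u) - free_paths x (r + e + u) else 0)"
    if "e = -1 \<or> e = 1" for e
  proof (cases "r + e = 0")
    case True
    then show ?thesis using False by (simp add: half_paths_center)
  next
    case ne: False
    have "u * (r + e) > 0 \<longleftrightarrow> u * r > 0"
      using ne that assms False by (auto simp: zero_less_mult_iff)
    then show ?thesis using ne by (simp add: half_paths_def)
  qed
  have "(\<Sum>e\<in>{e \<in> {-1, 1}. r + e \<noteq> 0}. half_paths u x (r + e)) = (\<Sum>e\<in>{-1, 1}. half_paths u x (r + e))"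
    by (rule sum.mono_neutral_left) (use False in \<open>auto simp: half_paths_center\<close>)
  also have "\<dots> = half_paths u (Suc x) r"
    using False assms by (simp add: eq, simp add: half_paths_def algebra_simps)
  finally show ?thesis ..
qed

lemma slit_paths_eq_0: "\<bar>r\<bar> > \<bar>u\<bar> + 2 * int d + int t \<Longrightarrow> slit_paths d u t r = 0"
  by (induction t arbitrary: r) (auto simp: half_paths_eq_0)

section \<open>The hexagon described by its vertical unit edges\<close>

definition edges :: "nat \<Rightarrow> nat \<Rightarrow> nat \<Rightarrow> int \<Rightarrow> int set" where
  "edges p b c x = {u. odd (u - x) \<and> 1 - x \<le> u \<and> u \<le> 2 * int p + x - 1 \<and>
     x - 2 * int c + 1 \<le> u \<and> u \<le> 2 * int p + 2 * int b - x - 1}"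

lemma hex_right:
  "odd (u - k) \<Longrightarrow> (k, u) \<in> hex p b c \<longleftrightarrow> 0 \<le> k \<and> k < int b + int c \<and> u \<in> edges p b c k"
  by (auto simp: hex_def tri_vertices_def in_hexagon_def edges_def)

lemma hex_left:
  "even (u - k) \<Longrightarrow> (k, u) \<in> hex p b c \<longleftrightarrow> 0 \<le> k \<and> k < int b + int c \<and> u \<in> edges p b c (k + 1)"
  by (auto simp: hex_def tri_vertices_def in_hexagon_def edges_def)

lemma hex_bounds:
  assumes "(k, u) \<in> hex p b c"
  shows "0 \<le> k" "k < int b + int c"
  using assms hex_right[of u k p b c] hex_left[of u k p b c] by blast+

lemma finite_hex: "finite (hex p b c)"
proof (rule finite_subset)
  show "hex p b c \<subseteq> {0..int b + int c} \<times> {- int b - int c..2 * int p + int b + int c}"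
  proof
    fix t assume t: "t \<in> hex p b c"
    obtain k u where [simp]: "t = (k, u)" by (cases t)
    show "t \<in> {0..int b + int c} \<times> {- int b - int c..2 * int p + int b + int c}"
      using t hex_right[of u k p b c] hex_left[of u k p b c]
      by (cases "odd (u - k)") (auto simp: edges_def)
  qed
qed simp

text \<open>Each strip has exactly one triangle centred on the axis, and since \<open>d\<close> is
  at most \<open>b\<close> and \<open>c\<close> the first \<open>2 * d\<close> of them lie in the
  hexagon. Hence the one in strip \<open>k\<close> has label \<open>k + 1\<close>.\<close>

lemma hexd_eq:
  assumes "d \<le> b" "d \<le> c"
  shows "hexd p b c d = {(k, u) \<in> hex p b c. \<not> (u = int p \<and> k < 2 * int d)}"
proof -
  have row: "(k, int p) \<in> hex p b c" if "0 \<le> k" "k < 2 * int d" for k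
  proof (cases "odd (int p - k)")
    case True
    then have "0 < int p + k" using that by (cases "k = 0") (auto intro: Nat.gr0I)
    then show ?thesis using that assms True by (subst hex_right) (auto simp: edges_def)
  next
    case False
    then have "k + 1 < int p + 2 * int d" using that by (cases "p = 0"; presburger)
    then show ?thesis using that assms False by (subst hex_left) (auto simp: edges_def)
  qed
  have "card {t' \<in> hex p b c. snd t' = int p \<and> fst t' < k} < 2 * d \<longleftrightarrow> k < 2 * int d"
    if k: "(k, int p) \<in> hex p b c" for k
  proof -
    define Z where "Z = {t' \<in> hex p b c. snd t' = int p \<and> fst t' < k}"
    have finZ: "finite Z" unfolding Z_def using finite_hex[of p b c] by simp
    have k0: "0 \<le> k" using hex_bounds[OF k] by simp
    have card: "card ((\<lambda>k. (k, int p)) ` {0..<m}) = nat m" for m :: int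
      by (subst card_image) (auto simp: inj_on_def)
    show ?thesis
    proof (cases "k < 2 * int d")
      case True
      have "Z \<subseteq> (\<lambda>k. (k, int p)) ` {0..<k}"
        using hex_bounds by (fastforce simp: Z_def)
      then have "card Z \<le> nat k" using card[of k] card_mono[of "(\<lambda>k. (k, int p)) ` {0..<k}" Z] by simp
      then show ?thesis using True k0 unfolding Z_def by linarith
    next
      case False
      have "(\<lambda>k. (k, int p)) ` {0..<2 * int d} \<subseteq> Z"
        using row False by (auto simp: Z_def)
      from card_mono[OF finZ this] have "2 * d \<le> card Z" by (simp add: card)
      then show ?thesis using False unfolding Z_def by simp
    qed
  qed
  note card_iff = this
  show ?thesis
  proof (rule Set.set_eqI)
    fix t :: "int \<times> int"
    show "t \<in> hexd p b c d \<longleftrightarrow> t \<in> {(k, u) \<in> hex p b c. \<not> (u = int p \<and> k < 2 * int d)}"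
      using card_iff[of "fst t"] by (cases t) (auto simp: hexd_def)
  qed
qed

text \<open>The left side has exactly \<open>p\<close> unit edges, so \<open>p\<close> particles
  fill it: equal parity forces gaps of at least 2, and counting from both ends squeezes each
  position.\<close>

lemma strict_mono_edges_0:
  assumes "strict_mono_on {0..<p} s" "\<And>j. j < p \<Longrightarrow> s j + int p \<in> edges p b c 0" "j < p"
  shows "s j = 2 * int j + 1 - int p"
proof -
  have step: "s i + 2 \<le> s (Suc i)" if "Suc i < p" for i
  proof -
    have "s i < s (Suc i)" using that assms(1) by (auto simp: strict_mono_on_def)
    moreover have "odd (s i + int p)" "odd (s (Suc i) + int p)"
      using assms(2)[of i] assms(2)[of "Suc i"] that by (auto simp: edges_def)
    ultimately show ?thesis by presburger
  qed
  have lo: "2 * int i + 1 - int p \<le> s i" if "i < p" for i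
    using that
  proof (induction i)
    case 0 then show ?case using assms(2)[of 0] by (auto simp: edges_def)
  next
    case (Suc i) then show ?case using step[of i] by auto
  qed
  have hi: "s (p - 1 - i) \<le> int p - 1 - 2 * int i" if "i < p" for i
    using that
  proof (induction i)
    case 0 then show ?case using assms(2)[of "p - 1"] by (auto simp: edges_def)
  next
    case (Suc i)
    then have "Suc (p - 1 - Suc i) = p - 1 - i" by auto
    then show ?case using step[of "p - 1 - Suc i"] Suc by auto
  qed
  have "p - 1 - (p - 1 - j) = j" using assms(3) by simp
  then show ?thesis using lo[OF assms(3)] hi[of "p - 1 - j"] assms(3) by (auto simp: of_nat_diff)
qed

lemma edges_0_covered:
  assumes "strict_mono_on {0..<p} s" "\<And>j. j < p \<Longrightarrow> s j + int p \<in> edges p b c 0" "u \<in> edges p b c 0"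
  shows "\<exists>j<p. u = s j + int p"
proof -
  have u: "odd u" "1 \<le> u" "u \<le> 2 * int p - 1" using assms(3) by (auto simp: edges_def)
  then have "u = 2 * ((u - 1) div 2) + 1" by presburger
  then have "u = 2 * int (nat ((u - 1) div 2)) + 1" "nat ((u - 1) div 2) < p"
    using u by auto
  then show ?thesis using strict_mono_edges_0[OF assms(1,2)] by (metis add.commute add_diff_cancel_right' diff_add_cancel)
qed

text \<open>Expanding every column into its two predecessors produces all ways to move the particles one line
  to the left. A collision gives two equal columns and a particle outside the hexagon a zero column,
  so exactly the admissible moves survive.\<close>

lemma M_left_part_within_slit:
  assumes d: "d \<le> b" "d \<le> c" and x: "x \<le> 2 * d"
    and s: "strict_mono_on {0..<p} s"
      "\<And>j. j < p \<Longrightarrow> s j \<noteq> 0 \<Longrightarrow> s j + int p \<in> edges p b c (int x)"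
      "0 \<in> s ` {0..<p} \<longleftrightarrow> odd p"
  shows "real (M (left_part (hexd p b c d) (int x) ((\<lambda>j. s j + int p) ` {j \<in> {0..<p}. s j \<noteq> 0})))
     = detf p (\<lambda>i j. half_paths (2 * int i + 1 - int p) x (s j))"
  using x s
proof (induction x arbitrary: s)
  case 0
  have "left_part (hexd p b c d) (int 0) S = {}" for S
    using hex_bounds by (fastforce simp: hexd_eq[OF d] left_part_def)
  then have one: "M (left_part (hexd p b c d) (int 0) ((\<lambda>j. s j + int p) ` {j \<in> {0..<p}. s j \<noteq> 0})) = 1"
    by (simp add: M_def lozenge_tilings_empty)
  have "s j + int p \<in> edges p b c 0" if "j < p" for j
  proof (cases "s j = 0")
    case True
    then have "odd p" using 0 that by auto
    then show ?thesis using True that by (auto simp: edges_def)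
  next
    case False then show ?thesis using 0(3)[OF that] by simp
  qed
  then have sj: "s j = 2 * int j + 1 - int p" if "j < p" for j
    using strict_mono_edges_0[OF 0(2)] that by blast
  have "detf p (\<lambda>i j. half_paths (2 * int i + 1 - int p) 0 (s j)) = (\<Prod>i = 0..<p. half_paths (2 * int i + 1 - int p) 0 (s i))"
    by (rule detf_upper_triangular) (auto simp: half_paths_0 sj)
  also have "\<dots> = 1" by (simp add: half_paths_0 sj)
  finally show ?case using one by simp
next
  case (Suc x)
  let ?u = "\<lambda>i::nat. 2 * int i + 1 - int p"
  note s = Suc.prems(2-4)
  define R where "R = hexd p b c d"
  define J where "J = {j \<in> {0..<p}. s j \<noteq> 0}"
  \<comment> \<open>A particle at \<open>0\<close> is the resting one and its only move is
    \<open>0\<close>. The others never step onto \<open>0\<close>, where the triangles have been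
    deleted.\<close>
  define A where "A j = (if s j = 0 then {0} else {e \<in> {-1, 1}. s j + e \<noteq> 0})" for j
  \<comment> \<open>\<open>s\<close> measures heights from the axis, \<open>\<sigma>\<close> from
    the lower end of the left side, as the coordinates of triangles do.\<close>
  define \<sigma> where "\<sigma> j = s j + int p" for j
  have R: "(k, u) \<in> R \<longleftrightarrow> (k, u) \<in> hex p b c \<and> \<not> (u = int p \<and> k < 2 * int d)" for k u
    by (simp add: R_def hexd_eq[OF d])
  have xn: "int x < int b + int c" "int x + 1 \<le> 2 * int d" using Suc.prems(1) d by auto
  have inj: "inj_on s {0..<p}" using s(1) by (rule strict_mono_on_imp_inj_on)
  have par: "even (s j + int p - int x)" if "j \<in> J" for j
    using s(2)[of j] that by (auto simp: J_def edges_def)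
  define valid where "valid = (\<lambda>\<epsilon>. inj_on (\<lambda>j. \<sigma> j + \<epsilon> j) J \<and> (\<forall>j\<in>J. (int x, \<sigma> j + \<epsilon> j) \<in> R) \<and>
        (\<forall>u. (int x, u) \<in> R \<and> odd (u - int x) \<and> u \<notin> (\<lambda>j. \<sigma> j + \<epsilon> j) ` J \<longrightarrow> (int x - 1, u) \<in> R))"
  let ?V = "\<lambda>\<epsilon>. if valid \<epsilon> then real (M (left_part R (int x) ((\<lambda>j. \<sigma> j + \<epsilon> j) ` J))) else 0"
  have rec: "M (left_part R (int x + 1) (\<sigma> ` J)) = (\<Sum>\<epsilon>\<in>PiE J (\<lambda>_. {-1, 1}).
      if valid \<epsilon> then M (left_part R (int x) ((\<lambda>j. \<sigma> j + \<epsilon> j) ` J)) else 0)"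
    unfolding valid_def
  proof (rule M_left_part_Suc)
    show "finite R" unfolding R_def hexd_def using finite_hex by simp
    show "finite J" by (simp add: J_def)
    show "inj_on \<sigma> J" using inj by (auto simp: inj_on_def \<sigma>_def J_def)
    show "(int x, \<sigma> j) \<in> R \<and> even (\<sigma> j - int x)" if "j \<in> J" for j
      using par[OF that] s(2)[of j] xn that by (auto simp: R \<sigma>_def J_def hex_left add.commute)
    show "(int x, u) \<in> R" if "(int x - 1, u) \<in> R" "odd (u - int x)" for u
    proof -
      have "even (u - (int x - 1))" using that(2) by auto
      then show ?thesis using that xn hex_left[of u "int x - 1" p b c]
        by (auto simp: R hex_right)
    qed
  qed
  have detexp: "detf p (\<lambda>i j. half_paths (?u i) (Suc x) (s j))
      = (\<Sum>\<phi>\<in>PiE {0..<p} A. detf p (\<lambda>i j. half_paths (?u i) x (s j + \<phi> j)))"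
  proof -
    have "detf p (\<lambda>i j. half_paths (?u i) (Suc x) (s j))
      = detf p (\<lambda>i j. \<Sum>e\<in>A j. half_paths (?u i) x (s j + e))"
      by (rule detf_cong) (auto simp: A_def half_paths_Suc half_paths_center)
    then show ?thesis
      by (subst (asm) detf_expand_cols[where g = "\<lambda>j e i. half_paths (?u i) x (s j + e)"])
         (auto simp: A_def)
  qed
  have key: "detf p (\<lambda>i j. half_paths (?u i) x (s j + \<phi> j))
      = ?V \<phi>"
    if \<phi>: "\<phi> \<in> PiE {0..<p} A" for \<phi>
  proof -
    have \<phi>J: "(\<phi> j = -1 \<or> \<phi> j = 1) \<and> s j + \<phi> j \<noteq> 0" if "j \<in> J" for j
      using PiE_mem[OF \<phi>, of j] that by (auto simp: A_def J_def)
    have \<phi>0: "\<phi> j = 0" if "j < p" "s j = 0" for j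
      using PiE_mem[OF \<phi>, of j] that by (auto simp: A_def)
    have Jiff: "j \<in> J \<longleftrightarrow> s j + \<phi> j \<noteq> 0" if "j < p" for j
      using \<phi>J[of j] \<phi>0[of j] that by (auto simp: J_def)
    \<comment> \<open>Two moving particles have equal parity and so differ by at least 2; opposite
      steps can make them meet but not cross. Without collisions the order therefore stays
      strict.\<close>
    have le: "s i + \<phi> i \<le> s j + \<phi> j" if "i < j" "j < p" for i j
    proof -
      have lt: "s i < s j" using s(1) that by (auto simp: strict_mono_on_def)
      show ?thesis
      proof (cases "i \<in> J \<and> j \<in> J")
        case True
        then have "s i + 2 \<le> s j" using lt par[of i] par[of j] by presburger
        then show ?thesis using \<phi>J[of i] \<phi>J[of j] True by linarith
      next
        case False
        then show ?thesis using lt that \<phi>0[of i] \<phi>0[of j] \<phi>J[of i] \<phi>J[of j]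
          by (auto simp: J_def)
      qed
    qed
    show ?thesis
    proof (cases "inj_on (\<lambda>j. s j + \<phi> j) {0..<p}")
      case False
      then obtain i j where ij: "i < p" "j < p" "i \<noteq> j" "s i + \<phi> i = s j + \<phi> j"
        by (auto simp: inj_on_def)
      have "i \<in> J \<and> j \<in> J"
      proof (rule ccontr)
        assume "\<not> (i \<in> J \<and> j \<in> J)"
        then have "s i = 0 \<and> s j = 0"
          using ij Jiff[of i] Jiff[of j] by (auto simp: J_def)
        then show False using ij inj by (auto simp: inj_on_def)
      qed
      then have "\<not> valid \<phi>" using ij by (auto simp: valid_def inj_on_def \<sigma>_def)
      moreover have "detf p (\<lambda>i j. half_paths (?u i) x (s j + \<phi> j)) = 0"
        by (rule detf_identical_cols[of i p j]) (use ij in auto)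
      ultimately show ?thesis by simp
    next
      case injs: True
      have mono: "strict_mono_on {0..<p} (\<lambda>j. s j + \<phi> j)"
      proof (rule strict_mono_onI)
        fix i j assume ij: "i \<in> {0..<p}" "j \<in> {0..<p}" "i < j"
        then have "s i + \<phi> i \<noteq> s j + \<phi> j" using inj_onD[OF injs, of i j] by auto
        then show "s i + \<phi> i < s j + \<phi> j" using le[of i j] ij by auto
      qed
      show ?thesis
      proof (cases "\<forall>j\<in>J. s j + \<phi> j + int p \<in> edges p b c (int x)")
        case True
        have IH: "real (M (left_part (hexd p b c d) (int x) ((\<lambda>j. s j + \<phi> j + int p) ` {j \<in> {0..<p}. s j + \<phi> j \<noteq> 0})))
           = detf p (\<lambda>i j. half_paths (?u i) x (s j + \<phi> j))"
        proof (rule Suc.IH[OF _ mono])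
          show "x \<le> 2 * d" using Suc.prems by simp
          show "s j + \<phi> j + int p \<in> edges p b c (int x)" if "j < p" "s j + \<phi> j \<noteq> 0" for j
            using True Jiff that by auto
          have "s j + \<phi> j = 0 \<longleftrightarrow> s j = 0" if "j < p" for j
            using Jiff[OF that] that by (auto simp: J_def)
          then have "(\<exists>j\<in>{0..<p}. 0 = s j + \<phi> j) \<longleftrightarrow> (\<exists>j\<in>{0..<p}. 0 = s j)"
            by (metis atLeastLessThan_iff)
          then have "0 \<in> (\<lambda>j. s j + \<phi> j) ` {0..<p} \<longleftrightarrow> 0 \<in> s ` {0..<p}"
            unfolding image_iff .
          then show "0 \<in> (\<lambda>j. s j + \<phi> j) ` {0..<p} \<longleftrightarrow> odd p" using s(3) by simp
        qed
        have Jeq: "{j \<in> {0..<p}. s j + \<phi> j \<noteq> 0} = J" using Jiff by (auto simp: J_def)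
        have "valid \<phi>"
          unfolding valid_def
        proof (intro conjI ballI allI impI)
          show "inj_on (\<lambda>j. \<sigma> j + \<phi> j) J"
            using injs by (auto simp: inj_on_def \<sigma>_def J_def)
          show "(int x, \<sigma> j + \<phi> j) \<in> R" if "j \<in> J" for j
          proof -
            have "odd (s j + \<phi> j + int p - int x)" using True that by (auto simp: edges_def)
            then show ?thesis
              using True that xn \<phi>J[OF that] by (auto simp: R \<sigma>_def hex_right add.commute add.left_commute)
          qed
          fix u assume u: "(int x, u) \<in> R \<and> odd (u - int x) \<and> u \<notin> (\<lambda>j. \<sigma> j + \<phi> j) ` J"
          then have u1: "u \<in> edges p b c (int x)" "u \<noteq> int p"
            using xn by (auto simp: R hex_right)
          \<comment> \<open>On the left side every edge off the axis carries a particle, so no such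
            \<open>u\<close> exists. On later lines the triangle to the left of the edge lies in the
            hexagon and is not a deleted one.\<close>
          show "(int x - 1, u) \<in> R"
          proof (cases "x = 0")
            case True0: True
            have "\<exists>j<p. u = s j + \<phi> j + int p"
            proof (rule edges_0_covered[OF mono])
              show "s j + \<phi> j + int p \<in> edges p b c 0" if "j < p" for j
              proof (cases "s j + \<phi> j = 0")
                case True
                then have "s j = 0" using Jiff that by (auto simp: J_def)
                then have "odd p" using s(3) that by (auto simp: image_iff)
                then show ?thesis using True that by (auto simp: edges_def)
              next
                case False then show ?thesis using True True0 Jiff[OF that] by auto
              qed
            qed (use u1 True0 in auto)
            then obtain j where "j < p" "u = s j + \<phi> j + int p" by blast
            then have False using u u1(2) Jiff[of j] by (auto simp: \<sigma>_def image_iff algebra_simps)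
            then show ?thesis ..
          next
            case False
            have "even (u - (int x - 1))" using u by auto
            then show ?thesis using u1 xn False by (auto simp: R hex_left)
          qed
        qed
        moreover have "(\<lambda>j. \<sigma> j + \<phi> j) ` J = (\<lambda>j. s j + \<phi> j + int p) ` J"
          by (simp add: \<sigma>_def add_ac)
        ultimately show ?thesis
          using IH[unfolded Jeq] by (simp add: R_def)
      next
        case False
        then obtain j where j: "j \<in> J" "s j + \<phi> j + int p \<notin> edges p b c (int x)" by blast
        then have jp: "j < p" and e1: "s j + int p \<in> edges p b c (int (Suc x))"
          using s(2) by (auto simp: J_def)
        have odd: "odd (s j + \<phi> j + int p - int x)" using par[OF j(1)] \<phi>J[OF j(1)] by auto
        have "(int x, s j + \<phi> j + int p) \<notin> R" using j(2) hex_right[OF odd] by (simp add: R)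
        then have "(int x, \<sigma> j + \<phi> j) \<notin> R" by (simp add: \<sigma>_def add_ac)
        then have "\<not> valid \<phi>" using j(1) unfolding valid_def by blast
        \<comment> \<open>The bounds from the two sides that end at the right relax by one when
          moving left, so only the sides starting at the left can be crossed, and then no start is
          close enough to reach this height.\<close>
        moreover have "\<bar>s j + \<phi> j\<bar> > int p - 1 + int x"
          using j(2) odd e1 \<phi>J[OF j(1)] by (auto simp: edges_def)
        then have "detf p (\<lambda>i j. half_paths (?u i) x (s j + \<phi> j)) = 0"
          by (intro detf_zero_col[of j] half_paths_eq_0 jp) auto
        ultimately show ?thesis by simp
      qed
    qed
  qed
  have "real (M (left_part R (int x + 1) (\<sigma> ` J))) = (\<Sum>\<epsilon>\<in>PiE J (\<lambda>_. {-1, 1}).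
      ?V \<epsilon>)"
    unfolding rec by (simp add: if_distrib[of real] cong: if_cong)
  also have "\<dots> = (\<Sum>\<epsilon>\<in>{\<epsilon> \<in> PiE J (\<lambda>_. {-1, 1}). \<forall>j\<in>J. s j + \<epsilon> j \<noteq> 0}.
      ?V \<epsilon>)"
  proof (rule sum.mono_neutral_right)
    show "finite (J \<rightarrow>\<^sub>E {-1, 1 :: int})" by (intro finite_PiE) (auto simp: J_def)
    show "\<forall>\<epsilon>\<in>(J \<rightarrow>\<^sub>E {-1, 1}) - {\<epsilon> \<in> PiE J (\<lambda>_. {-1, 1}). \<forall>j\<in>J. s j + \<epsilon> j \<noteq> 0}.
      ?V \<epsilon> = 0"
    proof
      fix \<epsilon> assume "\<epsilon> \<in> (J \<rightarrow>\<^sub>E {-1, 1}) - {\<epsilon> \<in> PiE J (\<lambda>_. {-1, 1}). \<forall>j\<in>J. s j + \<epsilon> j \<noteq> 0}"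
      then obtain j where j: "j \<in> J" "s j + \<epsilon> j = 0" by blast
      then have "\<sigma> j + \<epsilon> j = int p" by (simp add: \<sigma>_def)
      then have "\<not> valid \<epsilon>" using j(1) xn by (auto simp: valid_def R)
      then show "?V \<epsilon> = 0" by simp
    qed
  qed auto
  \<comment> \<open>The resting particle has a single choice, so restricting to \<open>J\<close> and
    extending by \<open>0\<close> are inverse to each other.\<close>
  also have "\<dots> = (\<Sum>\<phi>\<in>PiE {0..<p} A. ?V \<phi>)"
  proof (rule sum.reindex_bij_witness[of _ "\<lambda>\<phi>. restrict \<phi> J"
        "\<lambda>\<epsilon>. \<lambda>j\<in>{0..<p}. if j \<in> J then \<epsilon> j else 0"])
    fix \<epsilon> assume \<epsilon>: "\<epsilon> \<in> {\<epsilon> \<in> PiE J (\<lambda>_. {-1, 1}). \<forall>j\<in>J. s j + \<epsilon> j \<noteq> 0}"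
    let ?e = "\<lambda>j\<in>{0..<p}. if j \<in> J then \<epsilon> j else 0"
    have \<epsilon>E: "\<epsilon> \<in> PiE J (\<lambda>_. {-1, 1})" using \<epsilon> by simp
    show "restrict ?e J = \<epsilon>"
    proof (rule extensionalityI[of _ J])
      show "restrict ?e J j = \<epsilon> j" if "j \<in> J" for j
        using that by (simp add: J_def)
    qed (use \<epsilon>E in \<open>auto simp: PiE_def\<close>)
    show "?e \<in> PiE {0..<p} A"
      using \<epsilon> PiE_mem[OF \<epsilon>E] by (auto simp: A_def J_def)
    have eq: "?e j = \<epsilon> j" if "j \<in> J" for j
      using that by (auto simp: J_def)
    have im: "(\<lambda>j. \<sigma> j + ?e j) ` J = (\<lambda>j. \<sigma> j + \<epsilon> j) ` J"
      by (rule image_cong[OF refl]) (simp only: eq)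
    have "inj_on (\<lambda>j. \<sigma> j + ?e j) J = inj_on (\<lambda>j. \<sigma> j + \<epsilon> j) J"
      by (rule inj_on_cong) (simp only: eq)
    moreover have "(\<forall>j\<in>J. (int x, \<sigma> j + ?e j) \<in> R)
        = (\<forall>j\<in>J. (int x, \<sigma> j + \<epsilon> j) \<in> R)"
      by (rule ball_cong[OF refl]) (simp only: eq)
    ultimately have "valid ?e = valid \<epsilon>"
      unfolding valid_def im by (simp only:)
    then show "(if valid ?e
        then real (M (left_part R (int x) ((\<lambda>j. \<sigma> j + ?e j) ` J))) else 0)
      = ?V \<epsilon>"
      by (simp only: im)
  next
    fix \<phi> assume \<phi>: "\<phi> \<in> PiE {0..<p} A"
    have \<phi>A: "\<phi> j \<in> A j" if "j < p" for j using PiE_mem[OF \<phi>] that by auto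
    show "(\<lambda>j\<in>{0..<p}. if j \<in> J then (restrict \<phi> J) j else 0) = \<phi>"
    proof (rule extensionalityI[of _ "{0..<p}"])
      fix j assume "j \<in> {0..<p}"
      then show "(\<lambda>j\<in>{0..<p}. if j \<in> J then (restrict \<phi> J) j else 0) j = \<phi> j"
        using \<phi>A[of j] by (auto simp: A_def J_def split: if_splits)
    qed (use \<phi> in \<open>auto simp: PiE_def\<close>)
    show "restrict \<phi> J \<in> {\<epsilon> \<in> PiE J (\<lambda>_. {-1, 1}). \<forall>j\<in>J. s j + \<epsilon> j \<noteq> 0}"
      using \<phi>A by (fastforce simp: A_def J_def)
  qed
  also have "\<dots> = detf p (\<lambda>i j. half_paths (?u i) (Suc x) (s j))"
    unfolding detexp by (rule sum.cong) (simp_all add: key)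
  finally show ?case by (simp add: R_def J_def \<sigma>_def add.commute)
qed


text \<open>The same expansion past the tip, where all particles move freely. The last premise
  concerns the line through the tip: for odd \<open>p\<close> the edge on the axis has its left
  triangle deleted, so no lozenge can straddle it and a particle must sit there. It is the one that
  has been resting at \<open>0\<close>.\<close>

lemma M_left_part_beyond_slit:
  assumes d: "d \<le> b" "d \<le> c" and t: "2 * d + t \<le> b + c"
    and s: "strict_mono_on {0..<p} s"
      "\<And>j. j < p \<Longrightarrow> s j + int p \<in> edges p b c (int (2 * d + t))"
      "t = 0 \<Longrightarrow> odd p \<Longrightarrow> 0 \<in> s ` {0..<p}"
  shows "real (M (left_part (hexd p b c d) (int (2 * d + t)) ((\<lambda>j. s j + int p) ` {0..<p})))
     = detf p (\<lambda>i j. slit_paths d (2 * int i + 1 - int p) t (s j))"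
  using t s
proof (induction t arbitrary: s)
  case 0
  have ev: "s j \<noteq> 0" if "j < p" "even p" for j
    using 0(3)[OF that(1)] that(2) by (auto simp: edges_def)
  then have iff: "0 \<in> s ` {0..<p} \<longleftrightarrow> odd p" using 0(4) by force
  \<comment> \<open>Left of the tip the triangles on the axis are deleted, so it does not matter
    whether their height is listed as kept.\<close>
  have "left_part (hexd p b c d) (int (2 * d)) ((\<lambda>j. s j + int p) ` {0..<p})
      = left_part (hexd p b c d) (int (2 * d)) ((\<lambda>j. s j + int p) ` {j \<in> {0..<p}. s j \<noteq> 0})"
    unfolding left_part_def hexd_eq[OF d] by (rule Collect_cong) (auto simp: image_iff)
  then show ?case
    using M_left_part_within_slit[OF d order_refl 0(2) _ iff] 0(3) by simp
next
  case (Suc t)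
  let ?u = "\<lambda>i::nat. 2 * int i + 1 - int p"
  note s = Suc.prems(2-3)
  define R where "R = hexd p b c d"
  define x where "x = 2 * d + t"
  define \<sigma> where "\<sigma> j = s j + int p" for j
  have R: "(k, u) \<in> R \<longleftrightarrow> (k, u) \<in> hex p b c \<and> \<not> (u = int p \<and> k < 2 * int d)" for k u
    by (simp add: R_def hexd_eq[OF d])
  have xn: "int x < int b + int c" "2 * int d \<le> int x" "int (2 * d + Suc t) = int x + 1"
    using Suc.prems(1) by (auto simp: x_def)
  have inj: "inj_on s {0..<p}" using s(1) by (rule strict_mono_on_imp_inj_on)
  have e1: "s j + int p \<in> edges p b c (int x + 1)" if "j < p" for j
    using s(2)[OF that] unfolding xn(3) .
  have par: "even (s j + int p - int x)" if "j < p" for j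
    using e1[OF that] by (auto simp: edges_def)
  define valid where "valid = (\<lambda>\<epsilon>. inj_on (\<lambda>j. \<sigma> j + \<epsilon> j) {0..<p} \<and> (\<forall>j\<in>{0..<p}. (int x, \<sigma> j + \<epsilon> j) \<in> R) \<and>
        (\<forall>u. (int x, u) \<in> R \<and> odd (u - int x) \<and> u \<notin> (\<lambda>j. \<sigma> j + \<epsilon> j) ` {0..<p} \<longrightarrow> (int x - 1, u) \<in> R))"
  let ?V = "\<lambda>\<epsilon>. if valid \<epsilon> then real (M (left_part R (int x) ((\<lambda>j. \<sigma> j + \<epsilon> j) ` {0..<p}))) else 0"
  have rec: "M (left_part R (int x + 1) (\<sigma> ` {0..<p})) = (\<Sum>\<epsilon>\<in>PiE {0..<p} (\<lambda>_. {-1, 1}).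
      if valid \<epsilon> then M (left_part R (int x) ((\<lambda>j. \<sigma> j + \<epsilon> j) ` {0..<p})) else 0)"
    unfolding valid_def
  proof (rule M_left_part_Suc)
    show "finite R" unfolding R_def hexd_def using finite_hex by simp
    show "finite {0..<p}" by simp
    show "inj_on \<sigma> {0..<p}" using inj by (auto simp: inj_on_def \<sigma>_def)
    show "(int x, \<sigma> j) \<in> R \<and> even (\<sigma> j - int x)" if "j \<in> {0..<p}" for j
      using par[of j] e1[of j] xn that by (auto simp: R \<sigma>_def hex_left)
    show "(int x, u) \<in> R" if "(int x - 1, u) \<in> R" "odd (u - int x)" for u
    proof -
      have "even (u - (int x - 1))" using that(2) by auto
      then show ?thesis using that xn hex_left[of u "int x - 1" p b c]
        by (auto simp: R hex_right)
    qed
  qed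
  have detexp: "detf p (\<lambda>i j. slit_paths d (?u i) (Suc t) (s j))
      = (\<Sum>\<phi>\<in>PiE {0..<p} (\<lambda>_. {-1, 1}). detf p (\<lambda>i j. slit_paths d (?u i) t (s j + \<phi> j)))"
  proof -
    have "detf p (\<lambda>i j. slit_paths d (?u i) (Suc t) (s j))
      = detf p (\<lambda>i j. \<Sum>e\<in>{-1, 1}. slit_paths d (?u i) t (s j + e))"
      by (rule detf_cong) auto
    then show ?thesis
      by (subst (asm) detf_expand_cols[where g = "\<lambda>j e i. slit_paths d (?u i) t (s j + e)"])
         auto
  qed
  have key: "detf p (\<lambda>i j. slit_paths d (?u i) t (s j + \<phi> j))
      = ?V \<phi>"
    if \<phi>: "\<phi> \<in> PiE {0..<p} (\<lambda>_. {-1, 1})" for \<phi>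
  proof -
    have pm: "\<phi> j = -1 \<or> \<phi> j = 1" if "j < p" for j
      using PiE_mem[OF \<phi>, of j] that by auto
    have odd: "odd (s j + \<phi> j + int p - int x)" if "j < p" for j
      using par[OF that] pm[OF that] by auto
    have le: "s i + \<phi> i \<le> s j + \<phi> j" if "i < j" "j < p" for i j
    proof -
      have lt: "s i < s j" using s(1) that by (auto simp: strict_mono_on_def)
      then have "s i + 2 \<le> s j" using that par[of i] par[of j] by presburger
      then show ?thesis using pm[of i] pm[of j] that by auto
    qed
    show ?thesis
    proof (cases "inj_on (\<lambda>j. s j + \<phi> j) {0..<p}")
      case False
      then obtain i j where ij: "i < p" "j < p" "i \<noteq> j" "s i + \<phi> i = s j + \<phi> j"
        by (auto simp: inj_on_def)
      then have "\<not> valid \<phi>" by (auto simp: valid_def inj_on_def \<sigma>_def)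
      moreover have "detf p (\<lambda>i j. slit_paths d (?u i) t (s j + \<phi> j)) = 0"
        by (rule detf_identical_cols[of i p j]) (use ij in auto)
      ultimately show ?thesis by simp
    next
      case injs: True
      have mono: "strict_mono_on {0..<p} (\<lambda>j. s j + \<phi> j)"
      proof (rule strict_mono_onI)
        fix i j assume ij: "i \<in> {0..<p}" "j \<in> {0..<p}" "i < j"
        then have "s i + \<phi> i \<noteq> s j + \<phi> j" using inj_onD[OF injs, of i j] by auto
        then show "s i + \<phi> i < s j + \<phi> j" using le[of i j] ij by auto
      qed
      consider (out) "\<exists>j<p. s j + \<phi> j + int p \<notin> edges p b c (int x)"
        | (center) "t = 0" "odd p" "0 \<notin> (\<lambda>j. s j + \<phi> j) ` {0..<p}"
        | (ok) "\<And>j. j < p \<Longrightarrow> s j + \<phi> j + int p \<in> edges p b c (int x)"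
            "t = 0 \<Longrightarrow> odd p \<Longrightarrow> 0 \<in> (\<lambda>j. s j + \<phi> j) ` {0..<p}"
        by blast
      then show ?thesis
      proof cases
        case out
        then obtain j where j: "j < p" "s j + \<phi> j + int p \<notin> edges p b c (int x)" by blast
        have "(int x, s j + \<phi> j + int p) \<notin> R" using j(2) hex_right[OF odd[OF j(1)]] by (simp add: R)
        then have "(int x, \<sigma> j + \<phi> j) \<notin> R" by (simp add: \<sigma>_def add_ac)
        then have "\<not> valid \<phi>" using j(1) unfolding valid_def by (meson atLeastLessThan_iff le0)
        moreover have "\<bar>s j + \<phi> j\<bar> > int p - 1 + int x"
          using j(2) odd[OF j(1)] e1[OF j(1)] pm[OF j(1)] by (auto simp: edges_def)
        then have "detf p (\<lambda>i j. slit_paths d (?u i) t (s j + \<phi> j)) = 0"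
          by (intro detf_zero_col[of j] slit_paths_eq_0 j) (auto simp: x_def)
        ultimately show ?thesis by simp
      next
        case center
        have "0 < p" using center(2) by (auto intro: Nat.gr0I)
        then have "int p \<in> edges p b c (int x)"
          using center d by (auto simp: edges_def x_def)
        then have "(int x, int p) \<in> R" "odd (int p - int x)"
          using xn center by (auto simp: R hex_right x_def)
        moreover have "(int x - 1, int p) \<notin> R" using center by (auto simp: R x_def)
        moreover have "int p \<notin> (\<lambda>j. \<sigma> j + \<phi> j) ` {0..<p}"
          using center(3) by (auto simp: \<sigma>_def image_iff)
        ultimately have "\<not> valid \<phi>" by (auto simp: valid_def)
        \<comment> \<open>The path starting at the tip is the middle row, and this row vanishes when
          no particle is at \<open>0\<close>.\<close>
        moreover have "detf p (\<lambda>i j. slit_paths d (?u i) t (s j + \<phi> j)) = 0"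
        proof (rule detf_zero_row[of "p div 2"])
          show "p div 2 < p" using \<open>0 < p\<close> by simp
          have "2 * int (p div 2) + 1 - int p = 0" using center(2) by presburger
          then show "slit_paths d (2 * int (p div 2) + 1 - int p) t (s j + \<phi> j) = 0" if "j < p" for j
            using center that by (auto simp: half_paths_zero_start image_iff)
        qed
        ultimately show ?thesis by simp
      next
        case ok
        have IH: "real (M (left_part (hexd p b c d) (int (2 * d + t)) ((\<lambda>j. s j + \<phi> j + int p) ` {0..<p})))
           = detf p (\<lambda>i j. slit_paths d (?u i) t (s j + \<phi> j))"
          by (rule Suc.IH[OF _ mono]) (use Suc.prems ok in \<open>auto simp: x_def\<close>)
        have "valid \<phi>"
          unfolding valid_def
        proof (intro conjI ballI allI impI)
          show "inj_on (\<lambda>j. \<sigma> j + \<phi> j) {0..<p}"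
            using injs by (auto simp: inj_on_def \<sigma>_def)
          show "(int x, \<sigma> j + \<phi> j) \<in> R" if "j \<in> {0..<p}" for j
            using ok(1)[of j] that xn odd[of j] by (auto simp: R \<sigma>_def hex_right algebra_simps)
          fix u assume u: "(int x, u) \<in> R \<and> odd (u - int x) \<and> u \<notin> (\<lambda>j. \<sigma> j + \<phi> j) ` {0..<p}"
          then have u1: "u \<in> edges p b c (int x)"
            using xn by (auto simp: R hex_right)
          show "(int x - 1, u) \<in> R"
          proof (cases "x = 0")
            case True
            then have "\<exists>j<p. u = s j + \<phi> j + int p"
              using ok(1) u1 by (intro edges_0_covered[OF mono]) auto
            then have False using u by (auto simp: \<sigma>_def image_iff algebra_simps)
            then show ?thesis ..
          next
            case False
            have ev: "even (u - (int x - 1))" using u by auto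
            have "\<not> (u = int p \<and> int x - 1 < 2 * int d)"
            proof
              assume up: "u = int p \<and> int x - 1 < 2 * int d"
              then have "t = 0" "odd p" using u by (auto simp: x_def)
              then obtain j where "j < p" "s j + \<phi> j = 0" using ok(2) by force
              then show False using u up by (auto simp: \<sigma>_def image_iff algebra_simps)
            qed
            then show ?thesis using u1 xn False ev by (auto simp: R hex_left)
          qed
        qed
        then show ?thesis
          using IH by (simp add: R_def \<sigma>_def x_def algebra_simps)
      qed
    qed
  qed
  have "real (M (left_part R (int x + 1) (\<sigma> ` {0..<p}))) = (\<Sum>\<epsilon>\<in>PiE {0..<p} (\<lambda>_. {-1, 1}).
      ?V \<epsilon>)"
    unfolding rec by (simp add: if_distrib[of real] cong: if_cong)
  also have "\<dots> = detf p (\<lambda>i j. slit_paths d (?u i) (Suc t) (s j))"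
    unfolding detexp by (rule sum.cong) (simp_all add: key)
  finally show ?case unfolding xn(3) R_def \<sigma>_def .
qed

text \<open>On the right side all \<open>p\<close> edges carry particles, so the left part cut off
  by the last line is the whole region.\<close>

lemma M_hexd_eq_detf:
  assumes d: "d \<le> b" "d \<le> c" "2 * d < b + c"
  shows "real (M (hexd p b c d)) = detf p (\<lambda>i j. slit_paths d (2 * int i + 1 - int p) (b + c - 2 * d)
           (int b - int c + 2 * int j + 1 - int p))"
proof -
  define s where "s j = int b - int c + 2 * int j + 1 - int p" for j
  define n where "n = b + c"
  have eq: "2 * d + (b + c - 2 * d) = n" using d by (simp add: n_def)
  have "real (M (left_part (hexd p b c d) (int n) ((\<lambda>j. s j + int p) ` {0..<p})))
     = detf p (\<lambda>i j. slit_paths d (2 * int i + 1 - int p) (b + c - 2 * d) (s j))"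
    unfolding eq[symmetric]
  proof (rule M_left_part_beyond_slit[OF d(1,2)])
    show "strict_mono_on {0..<p} s" by (auto simp: strict_mono_on_def s_def)
    show "s j + int p \<in> edges p b c (int (2 * d + (b + c - 2 * d)))" if "j < p" for j
      unfolding eq using that by (auto simp: edges_def s_def n_def)
  qed (use d in auto)
  also have "left_part (hexd p b c d) (int n) ((\<lambda>j. s j + int p) ` {0..<p}) = hexd p b c d"
  proof -
    have "u \<in> (\<lambda>j. s j + int p) ` {0..<p}" if "(int n - 1, u) \<in> hex p b c" "even (u - (int n - 1))" for u
    proof -
      have u: "odd (u - int n)" "int b - int c + 1 \<le> u" "u \<le> 2 * int p + int b - int c - 1"
        using that by (auto simp: hex_left edges_def n_def)
      define j where "j = nat ((u - (int b - int c + 1)) div 2)"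
      have "even (u - (int b - int c + 1))" using u(1) by (auto simp: n_def)
      then have "u = s j + int p" "j < p"
        using u unfolding j_def s_def by auto
      then show ?thesis by auto
    qed
    then have "(x, u) \<in> left_part (hexd p b c d) (int n) ((\<lambda>j. s j + int p) ` {0..<p}) \<longleftrightarrow> (x, u) \<in> hexd p b c d" for x u
      using hex_bounds(2)[of x u p b c] by (auto simp: left_part_def hexd_eq[OF d(1,2)] n_def)
    then show ?thesis by (simp add: set_eq_iff split_paired_All)
  qed
  finally show ?thesis unfolding s_def .
qed

subsection \<open>Falling factorials and degree bounds\<close>

definition ffact :: "'a :: comm_ring_1 \<Rightarrow> nat \<Rightarrow> 'a" where
  "ffact x k = (\<Prod>i = 0..<k. x - of_nat i)"

lemma ffact_eq_pochhammer: "ffact x k = (- 1) ^ k * pochhammer (- x) k"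
proof -
  have "ffact x k = (\<Prod>i = 0..<k. (- 1) * (- x + of_nat i))"
    unfolding ffact_def by (rule prod.cong) (auto simp: algebra_simps)
  also have "\<dots> = (- 1) ^ k * pochhammer (- x) k"
    by (simp only: prod.distrib pochhammer_prod) simp
  finally show ?thesis .
qed

lemma ffact_add: "ffact x (k + l) = ffact x k * ffact (x - of_nat k) l"
proof (induction l)
  case (Suc l)
  then show ?case by (simp add: ffact_def algebra_simps)
qed (simp add: ffact_def)

text \<open>The Chu-Vandermonde identity, obtained from its form for rising factorials by changing
  the sign of both arguments.\<close>

lemma ffact_vandermonde:
  fixes x z :: "'a :: comm_ring_1"
  shows "(\<Sum>l\<le>N. of_nat (N choose l) * (ffact x l * ffact z (N - l))) = ffact (x + z) N"
proof -
  have "(\<Sum>l\<le>N. of_nat (N choose l) * (ffact x l * ffact z (N - l)))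
      = (\<Sum>l\<le>N. (- 1) ^ N * (of_nat (N choose l) * pochhammer (- x) l * pochhammer (- z) (N - l)))"
  proof (rule sum.cong)
    fix l assume "l \<in> {..N}"
    then have "(- 1 :: 'a) ^ N = (- 1) ^ l * (- 1) ^ (N - l)"
      by (simp flip: power_add)
    then show "of_nat (N choose l) * (ffact x l * ffact z (N - l))
        = (- 1) ^ N * (of_nat (N choose l) * pochhammer (- x) l * pochhammer (- z) (N - l))"
      by (simp add: ffact_eq_pochhammer mult_ac)
  qed simp
  also have "\<dots> = (- 1) ^ N * pochhammer (- x + - z) N"
    by (simp only: sum_distrib_left[symmetric] pochhammer_binomial_sum)
  finally show ?thesis by (simp add: ffact_eq_pochhammer algebra_simps)
qed

lemma ffact_of_nat_eq_0: "y < k \<Longrightarrow> ffact (of_nat y) k = 0"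
  unfolding ffact_def by (rule prod_zero) auto

lemma ffact_of_nat: "k \<le> y \<Longrightarrow> ffact (real y) k = fact y / fact (y - k)"
proof (induction k)
  case (Suc k)
  then have *: "fact (y - k) = real (y - k) * fact (y - Suc k)"
    by (metis Suc_diff_Suc Suc_le_lessD fact_Suc of_nat_fact of_nat_mult)
  have "ffact (real y) (Suc k) = ffact (real y) k * (real y - real k)" by (simp add: ffact_def)
  also have "\<dots> = fact y / fact (y - k) * real (y - k)" using Suc by (simp add: of_nat_diff)
  also have "\<dots> = fact y / fact (y - Suc k)" using Suc.prems by (simp add: *)
  finally show ?case .
qed (simp add: ffact_def)

lemma poly_ffact: "poly (ffact P k) x = ffact (poly P x) k"
  by (simp add: ffact_def poly_prod of_nat_poly)

lemma degree_ffact_le: "degree P \<le> 1 \<Longrightarrow> degree (ffact P k :: real poly) \<le> k"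
proof (induction k)
  case (Suc k)
  have "degree (P - of_nat k) \<le> 1"
    using Suc by (intro order.trans[OF degree_diff_le]) auto
  then show ?case
    using Suc degree_mult_le[of "ffact P k" "P - of_nat k"] by (simp add: ffact_def)
qed (simp add: ffact_def)

lemma sum_lessThan_card_le: "finite (S :: nat set) \<Longrightarrow> (\<Sum>i<card S. i) \<le> \<Sum>S"
proof (induction "card S" arbitrary: S)
  case (Suc k)
  define m where "m = Max S"
  have S: "S \<noteq> {}" using Suc by auto
  then have "m \<in> S" using Suc Max_in by (auto simp: m_def)
  note S = S this
  have "S \<subseteq> {..m}" using Suc by (auto simp: m_def)
  then have "card S \<le> card {..m}" by (intro card_mono) auto
  then have "k \<le> m" using Suc(2) by simp
  moreover have "(\<Sum>i<card (S - {m}). i) \<le> \<Sum>(S - {m})"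
    using Suc S by (intro Suc.hyps(1)) auto
  moreover have "\<Sum>S = m + \<Sum>(S - {m})" using Suc S by (intro sum.remove) auto
  moreover have "card (S - {m}) = k" using Suc S by simp
  moreover have "(\<Sum>i<card S. i) = (\<Sum>i<k. i) + k" by (simp add: Suc(2)[symmetric])
  ultimately show ?case by simp
qed auto

lemma sum_inj_ge:
  fixes f :: "nat \<Rightarrow> nat"
  assumes "inj_on f I" "finite I"
  shows "(\<Sum>i<card I. i) \<le> sum f I"
  using sum_lessThan_card_le[of "f ` I"] assms by (simp add: card_image sum.reindex)

text \<open>The lower bound for sums of distinct naturals, applied to the reflected values
  \<open>K - 1 - f i\<close>.\<close>

lemma sum_inj_le:
  fixes f :: "nat \<Rightarrow> nat"
  assumes "inj_on f I" "finite I" "\<And>i. i \<in> I \<Longrightarrow> f i < K"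
  shows "sum f I + (\<Sum>i<card I. i) \<le> card I * (K - 1)"
proof -
  have "inj_on (\<lambda>i. K - 1 - f i) I"
  proof (rule inj_onI)
    fix i j assume ij: "i \<in> I" "j \<in> I" "K - 1 - f i = K - 1 - f j"
    then have "f i = f j" using assms(3)[of i] assms(3)[of j] by linarith
    then show "i = j" using ij assms(1) by (auto dest: inj_onD)
  qed
  then have "(\<Sum>i<card I. i) \<le> (\<Sum>i\<in>I. K - 1 - f i)"
    using assms by (intro sum_inj_ge) auto
  moreover have "sum f I + (\<Sum>i\<in>I. K - 1 - f i) = (\<Sum>i\<in>I. K - 1)"
    unfolding sum.distrib[symmetric] using assms(3) by (intro sum.cong) fastforce+
  ultimately show ?thesis by simp
qed

text \<open>Expand every row in powers of the variable. Choosing the exponents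
  \<open>\<psi> i \<le> \<phi> i\<close> of \<open>z j\<close> gives \<open>0\<close> unless they
  are distinct, and then they sum to at least \<open>0 + 1 + ... + (p - 1)\<close>. Only the rest of
  the exponent sum remains for the variable.\<close>

lemma degree_detf_powers:
  fixes z :: "nat \<Rightarrow> real"
  assumes "(\<Sum>i = 0..<p. \<phi> i) \<le> B + (\<Sum>i<p. i)"
  shows "degree (detf p (\<lambda>i j. [:z j, 1:] ^ \<phi> i)) \<le> B"
proof -
  have pw: "[:z, 1:] ^ e = (\<Sum>l\<le>e. monom (of_nat (e choose l)) (e - l) * [:z ^ l:])" for z :: real and e
  proof -
    have "[:z, 1:] = [:z:] + monom 1 1" by (simp add: monom_altdef)
    then have "[:z, 1:] ^ e = (\<Sum>l\<le>e. of_nat (e choose l) * [:z:] ^ l * monom 1 1 ^ (e - l))"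
      by (simp only: binomial_ring)
    also have "\<dots> = (\<Sum>l\<le>e. monom (of_nat (e choose l)) (e - l) * [:z ^ l:])"
    proof (rule sum.cong)
      fix l show "of_nat (e choose l) * [:z:] ^ l * monom 1 1 ^ (e - l) = monom (of_nat (e choose l)) (e - l) * [:z ^ l:]"
        by (simp add: poly_const_pow of_nat_poly monom_altdef mult_ac)
    qed simp
    finally show ?thesis .
  qed
  have "degree (detf p (\<lambda>i j. \<Sum>l\<in>{..\<phi> i}. monom (of_nat (\<phi> i choose l)) (\<phi> i - l) * [:z j ^ l:])) \<le> B"
  proof (subst detf_expand_rows, simp, rule degree_sum_le)
    show "finite (PiE {0..<p} (\<lambda>i. {..\<phi> i}))" by (intro finite_PiE) auto
    fix \<psi> assume \<psi>: "\<psi> \<in> PiE {0..<p} (\<lambda>i. {..\<phi> i})"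
    then have le: "\<psi> i \<le> \<phi> i" if "i < p" for i using PiE_mem[OF \<psi>, of i] that by auto
    show "degree (detf p (\<lambda>i j. monom (real (\<phi> i choose \<psi> i)) (\<phi> i - \<psi> i) * [:z j ^ \<psi> i:])) \<le> B"
    proof (cases "inj_on \<psi> {0..<p}")
      case False
      then obtain i j where "i < p" "j < p" "i \<noteq> j" "\<psi> i = \<psi> j" by (auto simp: inj_on_def)
      then have "detf p (\<lambda>i j. [:z j ^ \<psi> i:]) = 0" by (intro detf_identical_rows[of i p j]) auto
      then show ?thesis by (subst detf_mult_rows) simp
    next
      case True
      have "degree (detf p (\<lambda>i j. [:z j ^ \<psi> i:])) \<le> 0"
      proof -
        have "detf p (\<lambda>i j. [:z j ^ \<psi> i:]) = [:detf p (\<lambda>i j. z j ^ \<psi> i):]"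
          by (simp add: poly_eq_poly_eq_iff[symmetric] fun_eq_iff poly_detf)
        then show ?thesis by simp
      qed
      moreover have "degree (\<Prod>i = 0..<p. monom (real (\<phi> i choose \<psi> i)) (\<phi> i - \<psi> i)) \<le> (\<Sum>i = 0..<p. \<phi> i - \<psi> i)"
        by (intro order.trans[OF degree_prod_sum_le] sum_mono) (auto simp: degree_monom_le)
      moreover have "(\<Sum>i = 0..<p. \<phi> i - \<psi> i) + (\<Sum>i = 0..<p. \<psi> i) = (\<Sum>i = 0..<p. \<phi> i)"
        unfolding sum.distrib[symmetric] using le by (intro sum.cong) auto
      moreover have "(\<Sum>i<p. i) \<le> (\<Sum>i = 0..<p. \<psi> i)"
        using sum_inj_ge[OF True] by simp
      ultimately show ?thesis
        using assms unfolding detf_mult_rows by (intro order.trans[OF degree_mult_le]) linarith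
    qed
  qed
  then show ?thesis by (simp only: pw)
qed

text \<open>All rows in \<open>K\<close> may change simultaneously because their sources lie outside
  \<open>K\<close>: every other term of the expansion has a row proportional to its unchanged
  source.\<close>

lemma detf_row_operation:
  assumes "\<And>i. i \<in> K \<Longrightarrow> i < p \<and> \<tau> i < p \<and> \<tau> i \<notin> K"
    and f': "\<And>i j. i < p \<Longrightarrow> j < p \<Longrightarrow> f' i j = (if i \<in> K then f i j + c i * f (\<tau> i) j else f i j)"
  shows "detf p f' = detf p f"
proof -
  define A where "A i = (if i \<in> K then {0, 1 :: nat} else {0})" for i
  define g where "g i m j = (if m = (0 :: nat) then f i j else c i * f (\<tau> i) j)" for i m j
  define \<phi>0 where "\<phi>0 = restrict (\<lambda>_. 0 :: nat) {0..<p}"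
  have "detf p f' = detf p (\<lambda>i j. \<Sum>m\<in>A i. g i m j)"
    by (rule detf_cong) (auto simp: f' A_def g_def)
  also have "\<dots> = (\<Sum>\<phi>\<in>PiE {0..<p} A. detf p (\<lambda>i j. g i (\<phi> i) j))"
    by (rule detf_expand_rows) (auto simp: A_def)
  also have "\<dots> = (\<Sum>\<phi>\<in>{\<phi>0}. detf p (\<lambda>i j. g i (\<phi> i) j))"
  proof (rule sum.mono_neutral_right)
    show "finite (PiE {0..<p} A)" by (intro finite_PiE) (auto simp: A_def)
    show "{\<phi>0} \<subseteq> PiE {0..<p} A" by (auto simp: \<phi>0_def A_def)
    show "\<forall>\<phi>\<in>PiE {0..<p} A - {\<phi>0}. detf p (\<lambda>i j. g i (\<phi> i) j) = 0"
    proof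
      fix \<phi> assume \<phi>: "\<phi> \<in> PiE {0..<p} A - {\<phi>0}"
      have "\<exists>i<p. \<phi> i \<noteq> 0"
      proof (rule ccontr)
        assume "\<not> (\<exists>i<p. \<phi> i \<noteq> 0)"
        then have "\<phi> = \<phi>0"
          using \<phi> by (intro extensionalityI[of _ "{0..<p}"]) (auto simp: \<phi>0_def PiE_def)
        then show False using \<phi> by simp
      qed
      then obtain i where i: "i < p" "\<phi> i \<noteq> 0" by blast
      have mem: "\<phi> k \<in> A k" if "k < p" for k using \<phi> that by auto
      have iK: "i \<in> K" using mem[OF i(1)] i(2) by (auto simp: A_def split: if_splits)
      then have t: "\<tau> i < p" "\<tau> i \<notin> K" "\<tau> i \<noteq> i" using assms(1)[of i] by auto
      then have "\<phi> (\<tau> i) = 0" using mem[of "\<tau> i"] by (auto simp: A_def)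
      then show "detf p (\<lambda>i j. g i (\<phi> i) j) = 0"
        using i t by (intro detf_proportional_rows[of i p "\<tau> i" _ "c i"]) (auto simp: g_def)
    qed
  qed
  also have "\<dots> = detf p f"
    by (simp, rule detf_cong) (simp add: g_def \<phi>0_def)
  finally show ?thesis .
qed

text \<open>The increasing enumeration \<open>e\<close> of \<open>J\<close> satisfies
  \<open>i \<le> e i \<le> i + a\<close>, as only \<open>a\<close> indices are missing. So the
  window of length \<open>d\<close> ending at \<open>i\<close> lies inside the window of length
  \<open>a + d\<close> ending at \<open>e i\<close>.\<close>

lemma prod_consecutive_dvd:
  fixes w :: "int \<Rightarrow> 'a :: comm_ring_1"
  assumes J: "J \<subseteq> {0..<p}" "card J = p - a" "a \<le> p"
  shows "(\<Prod>i = 0..<p - a. \<Prod>k = 0..<d. w (int i - int k)) dvd (\<Prod>j\<in>J. \<Prod>l = 0..<a + d. w (int j - int l))"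
proof -
  have fin: "finite J" using J finite_subset by blast
  obtain e where e: "bij_betw e {..<card J} J" "strict_mono_on {..<card J} e"
    using ex_bij_betw_strict_mono_card[OF fin] by blast
  define s where "s = p - a"
  have e': "bij_betw e {0..<s} J" using e J by (simp add: s_def lessThan_atLeast0)
  have step: "e i + 1 \<le> e (Suc i)" if "Suc i < s" for i
    using e(2) that J by (auto simp: strict_mono_on_def s_def Suc_le_eq)
  have lo: "i \<le> e i" if "i < s" for i
    using that
  proof (induction i)
    case (Suc i) then show ?case using step[of i] by auto
  qed auto
  have hi: "e (s - 1 - i) \<le> p - 1 - i" if "i < s" for i
    using that
  proof (induction i)
    case 0
    then have "e (s - 1) \<in> J" using e' by (auto simp: bij_betw_def)
    then show ?case using J by auto
  next
    case (Suc i)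
    then have "Suc (s - 1 - Suc i) = s - 1 - i" by auto
    then show ?case using step[of "s - 1 - Suc i"] Suc by auto
  qed
  have hi': "e i \<le> i + a" if "i < s" for i
  proof -
    have "s - 1 - (s - 1 - i) = i" "s - 1 - i < s" "p - 1 - (s - 1 - i) = i + a"
      using that J(3) by (auto simp: s_def)
    then show ?thesis using hi[of "s - 1 - i"] by simp
  qed
  have reidx: "(\<Prod>k = 0..<m. w (int j - int k)) = prod w {int j - int m + 1..int j}" for j m
    by (rule prod.reindex_bij_witness[of _ "\<lambda>z. nat (int j - z)" "\<lambda>k. int j - int k"]) auto
  have "(\<Prod>k = 0..<d. w (int i - int k)) dvd (\<Prod>l = 0..<a + d. w (int (e i) - int l))" if "i < s" for i
    unfolding reidx using lo[OF that] hi'[OF that] by (intro prod_dvd_prod_subset) auto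
  then have "(\<Prod>i = 0..<s. \<Prod>k = 0..<d. w (int i - int k)) dvd (\<Prod>i = 0..<s. \<Prod>l = 0..<a + d. w (int (e i) - int l))"
    by (intro prod_dvd_prod) auto
  also have "\<dots> = (\<Prod>j\<in>J. \<Prod>l = 0..<a + d. w (int j - int l))"
    by (rule prod.reindex_bij_betw[OF e'])
  finally show ?thesis by (simp add: s_def)
qed

subsection \<open>The determinant as a polynomial\<close>

lemma half_paths_uminus: "half_paths (- u) x (- v) = half_paths u x v"
proof -
  have "free_paths x (- v - - u) = free_paths x (v - u)" "free_paths x (- v + - u) = free_paths x (v + u)"
    using free_paths_uminus[of x "v - u"] free_paths_uminus[of x "v + u"] by (simp_all add: algebra_simps)
  then show ?thesis by (simp add: half_paths_def)
qed

lemma half_paths_diff: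
  "half_paths u x v - half_paths (- u) x v = free_paths x (v - u) - free_paths x (v + u)"
proof -
  have "free_paths x (- u) = free_paths x u" by simp
  then show ?thesis
    by (cases "u = 0"; cases "v = 0"; cases "u * v > 0")
       (auto simp: half_paths_def zero_less_mult_iff mult_less_0_iff)
qed

lemma free_paths_choose: "free_paths x (2 * int k - int x) = real (x choose k)"
proof (induction x arbitrary: k)
  case 0
  then show ?case by (cases k) auto
next
  case (Suc x)
  have e: "2 * int k - int (Suc x) + 1 = 2 * int k - int x"
    "2 * int k - int (Suc x) - 1 = 2 * (int k - 1) - int x" by simp_all
  show ?case
  proof (cases k)
    case 0
    then show ?thesis using Suc[of 0] by (simp add: free_paths_eq_0)
  next
    case (Suc k')
    then have "2 * (int k - 1) - int x = 2 * int k' - int x" by simp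
    then show ?thesis
      unfolding free_paths.simps e using Suc.IH[of k] Suc.IH[of k'] Suc by simp
  qed
qed

text \<open>The source of polynomiality: in the binomial coefficient \<open>m choose (y - k)\<close>
  the factorials of \<open>y\<close> and \<open>Y\<close>, which do not depend on \<open>k\<close>,
  are pulled out, and falling factorials are left. These also give the right value \<open>0\<close>
  out of range.\<close>

lemma free_paths_ffact:
  assumes "y + Y = m + q" "k \<le> q"
  shows "free_paths m (2 * (int y - int k) - int m)
    = fact m / (fact y * fact Y) * (ffact (real y) k * ffact (real Y) (q - k))"
proof (cases "k \<le> y")
  case False
  then show ?thesis by (simp add: free_paths_eq_0 ffact_of_nat_eq_0)
next
  case ky: True
  have *: "free_paths m (2 * (int y - int k) - int m) = real (m choose (y - k))"
    using free_paths_choose[of m "y - k"] ky by (simp add: of_nat_diff)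
  show ?thesis
  proof (cases "q - k \<le> Y")
    case False
    then have "m < y - k" using assms by linarith
    then show ?thesis using False * by (simp add: ffact_of_nat_eq_0)
  next
    case True
    then have "y - k \<le> m" "Y - (q - k) = m - (y - k)" using assms ky by linarith+
    then show ?thesis unfolding * using True ky
      by (simp add: ffact_of_nat binomial_fact)
  qed
qed

text \<open>\<open>k\<close> numbers the \<open>2 * d + p\<close> heights on the line through the
  tip, from the lowest to the highest one that can be reached; reflection in the axis is
  \<open>k \<mapsto> 2 * d + p - 1 - k\<close>.\<close>

definition slit_coeff :: "nat \<Rightarrow> nat \<Rightarrow> nat \<Rightarrow> nat \<Rightarrow> real" where
  "slit_coeff p d i k = half_paths (2 * int i + 1 - int p) (2 * d) (2 * int k - int (2 * d + p - 1))"

lemma half_paths_parity: "odd (u + v + int x) \<Longrightarrow> \<not> (u = 0 \<and> v = 0) \<Longrightarrow> half_paths u x v = 0"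
proof -
  have "free_paths x r = 0" if "odd (r + int x)" for r
    using that
  proof (induction x arbitrary: r)
    case (Suc x)
    then show ?case using Suc.IH[of "r - 1"] Suc.IH[of "r + 1"] by auto
  qed auto
  note free = this
  assume uv: "odd (u + v + int x)" "\<not> (u = 0 \<and> v = 0)"
  then have "odd (v - u + int x)" "odd (v + u + int x)" by presburger+
  then show "half_paths u x v = 0" using uv(2) free by (simp add: half_paths_def)
qed

text \<open>Paths are cut at the line through the tip. The parts along the slit do not involve
  \<open>b\<close>, \<open>c\<close> or the column, so all dependence on these sits in free path
  counts.\<close>

lemma slit_paths_eq_sum:
  assumes "i < p"
  shows "slit_paths d (2 * int i + 1 - int p) t r
    = (\<Sum>k\<le>2 * d + p - 1. slit_coeff p d i k * free_paths t (r - (2 * int k - int (2 * d + p - 1))))"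
proof (induction t arbitrary: r)
  case 0
  define q where "q = 2 * d + p - 1"
  have q: "int q = 2 * int d + int p - 1" using assms by (auto simp: q_def of_nat_diff)
  show ?case
  proof (cases "\<exists>k\<le>q. r = 2 * int k - int q")
    case True
    then obtain k where k: "k \<le> q" "r = 2 * int k - int q" by blast
    have "(\<Sum>k'\<le>q. slit_coeff p d i k' * free_paths 0 (r - (2 * int k' - int q)))
      = (\<Sum>k'\<in>{k}. slit_coeff p d i k' * free_paths 0 (r - (2 * int k' - int q)))"
      by (rule sum.mono_neutral_right) (use k in auto)
    then show ?thesis using k by (simp add: slit_coeff_def q_def)
  next
    case False
    have "half_paths (2 * int i + 1 - int p) (2 * d) r = 0"
    proof (cases "\<bar>r\<bar> \<le> int q")
      case True
      have "odd (r + int q)"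
      proof
        assume "even (r + int q)"
        then have "r = 2 * int (nat ((r + int q) div 2)) - int q" "nat ((r + int q) div 2) \<le> q"
          using True by auto
        then show False using False by blast
      qed
      then have *: "odd (2 * int i + 1 - int p + r + int (2 * d))" unfolding q by auto
      show ?thesis
      proof (rule half_paths_parity[OF *], rule notI)
        assume "2 * int i + 1 - int p = 0 \<and> r = 0"
        then show False using * by simp
      qed
    next
      case False
      then show ?thesis using assms q by (intro half_paths_eq_0) auto
    qed
    moreover have "(\<Sum>k'\<le>q. slit_coeff p d i k' * free_paths 0 (r - (2 * int k' - int q))) = 0"
      by (rule sum.neutral) (use False in auto)
    ultimately show ?thesis by (simp add: q_def)
  qed
next
  case (Suc t)
  have "r - 1 - v = r - v - 1" "r + 1 - v = r - v + 1" for v :: int by simp_all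
  then show ?case by (simp only: slit_paths.simps free_paths.simps Suc distrib_left sum.distrib)
qed

lemma slit_coeff_mirror:
  assumes "i < p" "k \<le> 2 * d + p - 1"
  shows "slit_coeff p d (p - 1 - i) k = slit_coeff p d i (2 * d + p - 1 - k)"
proof -
  have "2 * int (p - 1 - i) + 1 - int p = - (2 * int i + 1 - int p)"
    "2 * int k - int (2 * d + p - 1) = - (2 * int (2 * d + p - 1 - k) - int (2 * d + p - 1))"
    using assms by (auto simp: of_nat_diff)
  then show ?thesis unfolding slit_coeff_def by (simp only: half_paths_uminus)
qed

text \<open>The bound on \<open>k\<close> says that the endpoint is below the axis, where paths
  starting on or above it cannot arrive. The middle row of odd \<open>p\<close> satisfies this and
  the mirrored statement.\<close>

lemma slit_coeff_eq_0:
  assumes "p div 2 \<le> i" "k < p div 2 + d" "0 < p"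
  shows "slit_coeff p d i k = 0"
proof -
  have "0 \<le> 2 * int i + 1 - int p" using assms by linarith
  moreover have "2 * int k - int (2 * d + p - 1) < 0" using assms by (simp add: of_nat_diff)
  ultimately show ?thesis unfolding slit_coeff_def half_paths_def by (auto simp: zero_less_mult_iff)
qed

lemma slit_coeff_eq_0':
  assumes "i < p - p div 2" "2 * d + p - 1 - k < p div 2 + d" "k \<le> 2 * d + p - 1"
  shows "slit_coeff p d i k = 0"
proof -
  have "slit_coeff p d (p - 1 - i) (2 * d + p - 1 - k) = 0"
    by (rule slit_coeff_eq_0) (use assms in auto)
  then show ?thesis
    using slit_coeff_mirror[of i p "2 * d + p - 1 - k" d] assms by auto
qed

text \<open>Column \<open>j\<close> has \<open>y = b + j\<close> and
  \<open>Y = c + (p - 1 - j)\<close>. Their sum is the same for all columns, and reflection in the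
  axis exchanges them.\<close>

definition slit_fun :: "nat \<Rightarrow> nat \<Rightarrow> nat \<Rightarrow> real \<Rightarrow> real \<Rightarrow> real" where
  "slit_fun p d i y Y = (\<Sum>k\<le>2 * d + p - 1. slit_coeff p d i k * (ffact y k * ffact Y (2 * d + p - 1 - k)))"

lemma slit_fun_mirror: "i < p \<Longrightarrow> slit_fun p d (p - 1 - i) y Y = slit_fun p d i Y y"
  unfolding slit_fun_def
proof (rule sum.reindex_bij_witness[of _ "\<lambda>k. 2 * d + p - 1 - k" "\<lambda>k. 2 * d + p - 1 - k"])
  fix k assume "i < p" "k \<in> {..2 * d + p - 1}"
  then show "slit_coeff p d i (2 * d + p - 1 - k) *
      (ffact Y (2 * d + p - 1 - k) * ffact y (2 * d + p - 1 - (2 * d + p - 1 - k)))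
    = slit_coeff p d (p - 1 - i) k * (ffact y k * ffact Y (2 * d + p - 1 - k))"
    using slit_coeff_mirror[of i p k d] by simp
qed auto

text \<open>All terms share the factors \<open>ffact y i\<close> and
  \<open>ffact Y (p - 1 - i)\<close>; what is left is a Chu-Vandermonde sum of order
  \<open>2 * d\<close>. Its value depends on \<open>y + Y\<close> alone, so \<open>d\<close> does
  not contribute to the degree.\<close>

lemma sum_free_paths_ffact:
  fixes y Y :: real
  assumes "i < p"
  shows "(\<Sum>k\<le>2 * d + p - 1. free_paths (2 * d) (2 * (int k - int i) - 2 * int d) * (ffact y k * ffact Y (2 * d + p - 1 - k)))
    = ffact y i * ffact Y (p - 1 - i) * ffact (y + Y - (real p - 1)) (2 * d)"
proof -
  define q where "q = 2 * d + p - 1"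
  define f where "f k = free_paths (2 * d) (2 * (int k - int i) - 2 * int d) * (ffact y k * ffact Y (q - k))" for k
  have "(\<Sum>k\<le>q. f k) = (\<Sum>k\<in>{i..i + 2 * d}. f k)"
    by (rule sum.mono_neutral_right) (use assms in \<open>auto simp: f_def q_def free_paths_eq_0\<close>)
  also have "\<dots> = (\<Sum>l\<le>2 * d. f (i + l))"
    by (rule sum.reindex_bij_witness[of _ "\<lambda>l. i + l" "\<lambda>k. k - i"]) auto
  also have "\<dots> = (\<Sum>l\<le>2 * d. ffact y i * ffact Y (p - 1 - i) *
      (real (2 * d choose l) * (ffact (y - real i) l * ffact (Y - real (p - 1 - i)) (2 * d - l))))"
  proof (rule sum.cong)
    fix l assume l: "l \<in> {..2 * d}"
    have "free_paths (2 * d) (2 * (int (i + l) - int i) - 2 * int d) = real (2 * d choose l)"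
      using free_paths_choose[of "2 * d" l] by simp
    moreover have "q - (i + l) = (p - 1 - i) + (2 * d - l)" using l assms by (auto simp: q_def)
    ultimately show "f (i + l) = ffact y i * ffact Y (p - 1 - i) *
      (real (2 * d choose l) * (ffact (y - real i) l * ffact (Y - real (p - 1 - i)) (2 * d - l)))"
      unfolding f_def by (simp only: ffact_add) simp
  qed simp
  also have "\<dots> = ffact y i * ffact Y (p - 1 - i) * ffact (y - real i + (Y - real (p - 1 - i))) (2 * d)"
    by (simp only: sum_distrib_left[symmetric] ffact_vandermonde)
  also have "y - real i + (Y - real (p - 1 - i)) = y + Y - (real p - 1)"
    using assms by (simp add: of_nat_diff)
  finally show ?thesis by (simp add: f_def q_def)
qed

text \<open>Paths above the slit minus their mirror images are, by the reflection principle, differences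
  of unrestricted paths; this is what bounds the degree of the antisymmetric part.\<close>

lemma slit_fun_diff:
  assumes "i < p"
  shows "slit_fun p d i y Y - slit_fun p d (p - 1 - i) y Y
    = ffact (y + Y - (real p - 1)) (2 * d) * (ffact y i * ffact Y (p - 1 - i) - ffact y (p - 1 - i) * ffact Y i)"
proof -
  define i' where "i' = p - 1 - i"
  have i': "i' < p" "p - 1 - i' = i" "int i' = int p - 1 - int i" using assms by (auto simp: i'_def)
  have "slit_coeff p d i k - slit_coeff p d i' k = free_paths (2 * d) (2 * (int k - int i) - 2 * int d)
      - free_paths (2 * d) (2 * (int k - int i') - 2 * int d)" for k
  proof -
    have u: "2 * int i' + 1 - int p = - (2 * int i + 1 - int p)" using i' by simp
    have v: "int (2 * d + p - 1) = 2 * int d + int p - 1" using assms by auto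
    have "slit_coeff p d i k - slit_coeff p d i' k
      = free_paths (2 * d) (2 * int k - int (2 * d + p - 1) - (2 * int i + 1 - int p))
      - free_paths (2 * d) (2 * int k - int (2 * d + p - 1) + (2 * int i + 1 - int p))"
      unfolding slit_coeff_def u by (rule half_paths_diff)
    then show ?thesis unfolding v i'(3) by (simp add: algebra_simps)
  qed
  then have "slit_fun p d i y Y - slit_fun p d i' y Y
    = (\<Sum>k\<le>2 * d + p - 1. free_paths (2 * d) (2 * (int k - int i) - 2 * int d) * (ffact y k * ffact Y (2 * d + p - 1 - k)))
    - (\<Sum>k\<le>2 * d + p - 1. free_paths (2 * d) (2 * (int k - int i') - 2 * int d) * (ffact y k * ffact Y (2 * d + p - 1 - k)))"
    unfolding slit_fun_def sum_subtractf[symmetric] left_diff_distrib[symmetric] by simp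
  then show ?thesis
    unfolding sum_free_paths_ffact[OF assms] sum_free_paths_ffact[OF i'(1)] i'(2)
    by (simp add: i'_def algebra_simps)
qed

section \<open>Degree and divisor of the determinant as a polynomial\<close>

lemma poly_parity_expansion:
  fixes g :: "real poly"
  assumes "\<And>t. poly g (- t) = (- 1) ^ e * poly g t" "e < 2" "degree g < 2 * N + e"
  shows "poly g t = (\<Sum>l\<in>(\<lambda>m. 2 * m + e) ` {..<N}. coeff g l * t ^ l)"
proof -
  have "g \<circ>\<^sub>p monom (- 1) (Suc 0) = smult ((- 1) ^ e) g"
    unfolding poly_eq_poly_eq_iff[symmetric] using assms(1) by (auto simp: fun_eq_iff poly_pcompose poly_monom)
  then have "coeff (g \<circ>\<^sub>p monom (- 1) (Suc 0)) l = (- 1) ^ e * coeff g l" for l by simp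
  then have c: "(- 1) ^ l * coeff g l = (- 1) ^ e * coeff g l" for l by simp
  have z: "coeff g l = 0" if "odd (l + e)" for l
    using c[of l] that by (cases "even l"; cases "even e") auto
  have "poly g t = (\<Sum>l\<le>degree g. coeff g l * t ^ l)" by (rule poly_altdef)
  also have "\<dots> = (\<Sum>l\<in>{..<2 * N + e}. coeff g l * t ^ l)"
    by (rule sum.mono_neutral_left) (use assms(3) in \<open>auto simp: coeff_eq_0\<close>)
  also have "\<dots> = (\<Sum>l\<in>(\<lambda>m. 2 * m + e) ` {..<N}. coeff g l * t ^ l)"
  proof (rule sum.mono_neutral_right)
    show "\<forall>l\<in>{..<2 * N + e} - (\<lambda>m. 2 * m + e) ` {..<N}. coeff g l * t ^ l = 0"
    proof
      fix l assume l: "l \<in> {..<2 * N + e} - (\<lambda>m. 2 * m + e) ` {..<N}"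
      have "odd (l + e)"
      proof
        assume "even (l + e)"
        then have "l = 2 * (l div 2) + e" using assms(2) by presburger
        moreover from this have "l div 2 < N" using l by auto
        ultimately show False using l by blast
      qed
      then show "coeff g l * t ^ l = 0" by (simp add: z)
    qed
  qed auto
  finally show ?thesis .
qed


text \<open>The variable stands for \<open>b\<close>, and \<open>c\<close> has become
  \<open>n\<close> minus the variable.\<close>

definition slit_poly :: "nat \<Rightarrow> nat \<Rightarrow> nat \<Rightarrow> nat \<Rightarrow> nat \<Rightarrow> real poly" where
  "slit_poly p d n i j = (\<Sum>k\<le>2 * d + p - 1. smult (slit_coeff p d i k)
     (ffact [:real j, 1:] k * ffact [:real n + real p - 1 - real j, - 1:] (2 * d + p - 1 - k)))"

lemma poly_slit_poly:
  "poly (slit_poly p d n i j) x = slit_fun p d i (x + real j) (real n + real p - 1 - (x + real j))"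
  by (simp add: slit_poly_def slit_fun_def poly_sum poly_ffact algebra_simps)

text \<open>With \<open>y = \<kappa> + t\<close> and \<open>Y = \<kappa> - t\<close> the mirror
  image is \<open>t \<mapsto> - t\<close>, so the mean of a row and its mirror image is even in
  \<open>t\<close>. Degree at most \<open>2 * d + p - 1\<close> leaves
  \<open>p - p div 2 + d\<close> even exponents.\<close>

lemma slit_fun_even_expansion:
  fixes \<kappa> :: real
  assumes "i < p"
  obtains \<gamma> where "\<And>t. (slit_fun p d i (\<kappa> + t) (\<kappa> - t) + slit_fun p d (p - 1 - i) (\<kappa> + t) (\<kappa> - t)) / 2
    = (\<Sum>l\<in>(\<lambda>m. 2 * m) ` {..<p - p div 2 + d}. \<gamma> l * t ^ l)"
proof -
  define q where "q = 2 * d + p - 1"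
  define S where "S k = smult ((slit_coeff p d i k + slit_coeff p d (p - 1 - i) k) / 2)
    (ffact [:\<kappa>, 1:] k * ffact [:\<kappa>, - 1:] (q - k))" for k
  define g where "g = (\<Sum>k\<le>q. S k)"
  have g: "poly g t = (slit_fun p d i (\<kappa> + t) (\<kappa> - t) + slit_fun p d (p - 1 - i) (\<kappa> + t) (\<kappa> - t)) / 2" for t
    unfolding g_def S_def slit_fun_def q_def[symmetric]
    by (simp add: poly_sum poly_ffact sum.distrib[symmetric] sum_divide_distrib field_simps)
  have "degree (S k) \<le> q" if "k \<le> q" for k
  proof -
    have "degree (ffact [:\<kappa>, 1:] k * ffact [:\<kappa>, - 1:] (q - k)) \<le> k + (q - k)"
      by (intro order.trans[OF degree_mult_le] add_mono degree_ffact_le) auto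
    then show ?thesis using that unfolding S_def by (intro order.trans[OF degree_smult_le]) simp
  qed
  then have "degree g \<le> q" unfolding g_def by (intro degree_sum_le) auto
  moreover have "q < 2 * (p - p div 2 + d) + 0" using assms by (simp add: q_def)
  moreover have "poly g (- t) = (- 1) ^ 0 * poly g t" for t
    using slit_fun_mirror[OF assms, of d "\<kappa> + t" "\<kappa> - t"] slit_fun_mirror[OF assms, of d "\<kappa> - t" "\<kappa> + t"]
    by (simp add: g)
  ultimately have "poly g t = (\<Sum>l\<in>(\<lambda>m. 2 * m + 0) ` {..<p - p div 2 + d}. coeff g l * t ^ l)" for t
    by (intro poly_parity_expansion) auto
  then show ?thesis by (intro that[of "coeff g"]) (simp add: g)
qed

lemma slit_fun_odd_expansion:
  fixes \<kappa> :: real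
  assumes "i < p"
  obtains \<gamma> where "\<And>t. slit_fun p d i (\<kappa> + t) (\<kappa> - t) - slit_fun p d (p - 1 - i) (\<kappa> + t) (\<kappa> - t)
    = (\<Sum>l\<in>(\<lambda>m. 2 * m + 1) ` {..<p div 2}. \<gamma> l * t ^ l)"
proof -
  define C where "C = ffact (2 * \<kappa> - (real p - 1)) (2 * d)"
  define g where "g = smult C (ffact [:\<kappa>, 1:] i * ffact [:\<kappa>, - 1:] (p - 1 - i)
    - ffact [:\<kappa>, 1:] (p - 1 - i) * ffact [:\<kappa>, - 1:] i)"
  have g: "poly g t = slit_fun p d i (\<kappa> + t) (\<kappa> - t) - slit_fun p d (p - 1 - i) (\<kappa> + t) (\<kappa> - t)" for t
    unfolding slit_fun_diff[OF assms] g_def C_def by (simp add: poly_ffact algebra_simps)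
  have "degree (ffact [:\<kappa>, 1:] i * ffact [:\<kappa>, - 1:] (p - 1 - i)) \<le> i + (p - 1 - i)"
    "degree (ffact [:\<kappa>, 1:] (p - 1 - i) * ffact [:\<kappa>, - 1:] i) \<le> (p - 1 - i) + i"
    by (intro order.trans[OF degree_mult_le] add_mono degree_ffact_le; simp)+
  then have "degree g \<le> p - 1" unfolding g_def using assms
    by (intro order.trans[OF degree_smult_le] degree_diff_le) auto
  moreover have "p - 1 < 2 * (p div 2) + 1" using assms by simp
  moreover have "poly g (- t) = (- 1) ^ 1 * poly g t" for t
    using slit_fun_mirror[OF assms, of d "\<kappa> + t" "\<kappa> - t"] slit_fun_mirror[OF assms, of d "\<kappa> - t" "\<kappa> + t"]
    by (simp add: g)
  ultimately have "poly g t = (\<Sum>l\<in>(\<lambda>m. 2 * m + 1) ` {..<p div 2}. coeff g l * t ^ l)" for t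
    by (intro poly_parity_expansion) auto
  then show ?thesis by (intro that[of "coeff g"]) (simp add: g)
qed

text \<open>After the row operations \<open>a\<close> rows offer the odd exponents below
  \<open>2 * a\<close> and the other \<open>s\<close> rows the even ones below
  \<open>2 * (s + d)\<close>. Distinct choices sum to at most
  \<open>a^2 + s^2 - s + 2 * s * d\<close>. Of this \<open>degree_detf_powers\<close> removes
  \<open>p * (p - 1) / 2\<close>, which equals \<open>a^2 + s^2 - s\<close> because \<open>s\<close>
  is \<open>a\<close> or \<open>a + 1\<close>.\<close>

lemma degree_slit_det_le:
  assumes "0 < p"
  shows "degree (detf p (slit_poly p d n)) \<le> 2 * d * (p - p div 2)"
proof -
  define a where "a = p div 2"
  define s where "s = p - a"
  define \<kappa> where "\<kappa> = (real n + real p - 1) / 2"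
  define S where "S = slit_poly p d n"
  define f1 where "f1 i j = (if i < a then S i j - S (p - 1 - i) j else S i j)" for i j
  define f2 where "f2 i j = (if i < a then S i j - S (p - 1 - i) j else smult (1/2) (S i j + S (p - 1 - i) j))" for i j
  have as: "a + s = p" "a \<le> s" "s \<le> a + 1" "0 < s" using assms by (auto simp: a_def s_def)
  have "detf p f1 = detf p S"
    by (rule detf_row_operation[where K = "{..<a}" and \<tau> = "\<lambda>i. p - 1 - i" and c = "\<lambda>_. - 1"])
       (use as in \<open>auto simp: f1_def\<close>)
  \<comment> \<open>Adding half of a difference formed before turns a row into the mean of itself
    and its mirror image; the middle row of odd \<open>p\<close> already is that mean.\<close>
  moreover have "detf p f2 = detf p f1"
  proof (rule detf_row_operation[where K = "{s..<p}" and \<tau> = "\<lambda>i. p - 1 - i" and c = "\<lambda>_. [:1/2:]"])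
    fix i j assume ij: "i < p" "j < p"
    consider "i < a" | "a \<le> i" "i < s" | "s \<le> i" by linarith
    then show "f2 i j = (if i \<in> {s..<p} then f1 i j + [:1/2:] * f1 (p - 1 - i) j else f1 i j)"
    proof cases
      case 1 then show ?thesis using as by (simp add: f1_def f2_def)
    next
      case 2
      then have "p - 1 - i = i" using as by auto
      then have "f2 i j = smult (1/2) (S i j + S i j)" using 2 unfolding f2_def by simp
      also have "\<dots> = S i j" unfolding smult_add_right smult_add_left[symmetric] by simp
      finally show ?thesis using 2 by (simp add: f1_def)
    next
      case 3
      then have "\<not> i < a" "p - 1 - i < a" "p - 1 - (p - 1 - i) = i" using as ij by auto
      then show ?thesis using 3 ij
        by (simp add: f1_def f2_def smult_add_right smult_diff_right poly_eq_iff)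
    qed
  qed (use as in auto)
  moreover have "degree (detf p f2) \<le> 2 * d * s"
  proof -
    define O' where "O' i = (if i < a then (\<lambda>m. 2 * m + 1) ` {..<a} else (\<lambda>m. 2 * m) ` {..<s + d})" for i
    let ?X = "\<lambda>i j \<gamma>. \<Sum>l\<in>O' i. [:\<gamma> l:] * [:real j - \<kappa>, 1:] ^ l"
    have "\<exists>\<gamma>. \<forall>j. f2 i j = ?X i j \<gamma>" if i: "i < p" for i
    proof -
      have arg: "\<kappa> + (x + real j - \<kappa>) = x + real j" "\<kappa> - (x + real j - \<kappa>) = real n + real p - 1 - (x + real j)" for x j
        by (simp_all add: \<kappa>_def field_simps)
      show ?thesis
      proof (cases "i < a")
        case True
        obtain \<gamma> where \<gamma>: "\<And>t. slit_fun p d i (\<kappa> + t) (\<kappa> - t) - slit_fun p d (p - 1 - i) (\<kappa> + t) (\<kappa> - t)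
          = (\<Sum>l\<in>(\<lambda>m. 2 * m + 1) ` {..<p div 2}. \<gamma> l * t ^ l)"
          using slit_fun_odd_expansion[OF i] by blast
        have "f2 i j = ?X i j \<gamma>" for j
        proof (rule poly_eq_poly_eq_iff[THEN iffD1], rule ext)
          fix x
          have "poly (f2 i j) x = slit_fun p d i (x + real j) (real n + real p - 1 - (x + real j))
              - slit_fun p d (p - 1 - i) (x + real j) (real n + real p - 1 - (x + real j))"
            using True by (simp add: f2_def S_def poly_slit_poly)
          also have "\<dots> = (\<Sum>l\<in>O' i. \<gamma> l * (x + real j - \<kappa>) ^ l)"
            using \<gamma>[of "x + real j - \<kappa>"] True unfolding arg O'_def a_def by simp
          also have "\<dots> = poly (?X i j \<gamma>) x"
            unfolding poly_sum poly_mult poly_power by (rule sum.cong) (simp_all add: algebra_simps)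
          finally show "poly (f2 i j) x = poly (?X i j \<gamma>) x" .
        qed
        then show ?thesis by blast
      next
        case False
        obtain \<gamma> where \<gamma>: "\<And>t. (slit_fun p d i (\<kappa> + t) (\<kappa> - t) + slit_fun p d (p - 1 - i) (\<kappa> + t) (\<kappa> - t)) / 2
          = (\<Sum>l\<in>(\<lambda>m. 2 * m) ` {..<p - p div 2 + d}. \<gamma> l * t ^ l)"
          using slit_fun_even_expansion[OF i] by blast
        have "f2 i j = ?X i j \<gamma>" for j
        proof (rule poly_eq_poly_eq_iff[THEN iffD1], rule ext)
          fix x
          have "poly (f2 i j) x = (slit_fun p d i (x + real j) (real n + real p - 1 - (x + real j))
              + slit_fun p d (p - 1 - i) (x + real j) (real n + real p - 1 - (x + real j))) / 2"
            using False by (simp add: f2_def S_def poly_slit_poly)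
          also have "\<dots> = (\<Sum>l\<in>O' i. \<gamma> l * (x + real j - \<kappa>) ^ l)"
            using \<gamma>[of "x + real j - \<kappa>"] False unfolding arg O'_def s_def a_def by simp
          also have "\<dots> = poly (?X i j \<gamma>) x"
            unfolding poly_sum poly_mult poly_power by (rule sum.cong) (simp_all add: algebra_simps)
          finally show "poly (f2 i j) x = poly (?X i j \<gamma>) x" .
        qed
        then show ?thesis by blast
      qed
    qed
    then obtain \<gamma> where \<gamma>: "\<And>i j. i < p \<Longrightarrow> f2 i j = (\<Sum>l\<in>O' i. [:\<gamma> i l:] * [:real j - \<kappa>, 1:] ^ l)" by metis
    have "detf p f2 = detf p (\<lambda>i j. \<Sum>l\<in>O' i. [:\<gamma> i l:] * [:real j - \<kappa>, 1:] ^ l)"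
      by (rule detf_cong) (simp add: \<gamma>)
    also have "\<dots> = (\<Sum>\<phi>\<in>PiE {0..<p} O'. detf p (\<lambda>i j. [:\<gamma> i (\<phi> i):] * [:real j - \<kappa>, 1:] ^ \<phi> i))"
      by (rule detf_expand_rows) (auto simp: O'_def)
    also have "degree \<dots> \<le> 2 * d * s"
    proof (rule degree_sum_le)
      show "finite (PiE {0..<p} O')" by (intro finite_PiE) (auto simp: O'_def)
      fix \<phi> assume \<phi>: "\<phi> \<in> PiE {0..<p} O'"
      have \<phi>O: "\<phi> i \<in> O' i" if "i < p" for i using PiE_mem[OF \<phi>] that by auto
      have "degree (detf p (\<lambda>i j. [:real j - \<kappa>, 1:] ^ \<phi> i)) \<le> 2 * d * s"
      proof (cases "inj_on \<phi> {0..<p}")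
        case False
        then obtain i j where "i < p" "j < p" "i \<noteq> j" "\<phi> i = \<phi> j" by (auto simp: inj_on_def)
        then have "detf p (\<lambda>i j. [:real j - \<kappa>, 1:] ^ \<phi> i) = 0" by (intro detf_identical_rows[of i p j]) auto
        then show ?thesis by simp
      next
        case inj: True
        define m where "m i = \<phi> i div 2" for i
        have m1: "\<phi> i = 2 * m i + 1" "m i < a" if "i < a" for i
          using \<phi>O[of i] that as by (auto simp: O'_def m_def)
        have m2: "\<phi> i = 2 * m i" "m i < s + d" if "a \<le> i" "i < p" for i
          using \<phi>O[of i] that by (auto simp: O'_def m_def)
        have "inj_on m {0..<a}"
          using inj m1 as by (auto simp: inj_on_def)
        from sum_inj_le[OF this, of a] have A1: "(\<Sum>i = 0..<a. m i) + (\<Sum>i<a. i) \<le> a * (a - 1)"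
          using m1 by simp
        have "inj_on m {a..<p}"
          using inj m2 by (auto simp: inj_on_def)
        from sum_inj_le[OF this, of "s + d"] have A2: "(\<Sum>i = a..<p. m i) + (\<Sum>i<s. i) \<le> s * (s + d - 1)"
          using m2 by (simp add: s_def)
        have S1: "(\<Sum>i = 0..<a. \<phi> i) = 2 * (\<Sum>i = 0..<a. m i) + a"
        proof -
          have "(\<Sum>i = 0..<a. \<phi> i) = (\<Sum>i = 0..<a. 2 * m i + 1)" by (rule sum.cong) (use m1 in auto)
          then show ?thesis unfolding sum.distrib sum_distrib_left by simp
        qed
        have S2: "(\<Sum>i = a..<p. \<phi> i) = 2 * (\<Sum>i = a..<p. m i)"
          using m2 by (simp add: sum_distrib_left)
        have S3: "(\<Sum>i = 0..<p. \<phi> i) = (\<Sum>i = 0..<a. \<phi> i) + (\<Sum>i = a..<p. \<phi> i)"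
          using as by (intro sum.atLeastLessThan_concat[symmetric]) auto
        have tri: "2 * int (\<Sum>i<k. i) = int k * (int k - 1)" for k
          by (induction k) (auto simp: algebra_simps)
        have i1: "int (a * (a - 1)) = int a * (int a - 1)" by (cases a) (auto simp: algebra_simps)
        have i2: "int (s * (s + d - 1)) = int s * (int s + int d - 1)" using as(4) by (simp add: of_nat_diff)
        have "int (\<Sum>i = 0..<p. \<phi> i) \<le> int a * int a + int s * int s - int s + 2 * int s * int d"
          using S1 S2 S3 A1[folded of_nat_le_iff[where 'a = int], unfolded i1]
            A2[folded of_nat_le_iff[where 'a = int], unfolded i2] tri[of a] tri[of s]
          by (simp add: algebra_simps)
        also have "\<dots> = 2 * int d * int s + int (\<Sum>i<p. i)"
        proof -
          have "s = a \<or> s = a + 1" using as by linarith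
          then have "2 * (int a * int a + int s * int s - int s) = int p * (int p - 1)"
            using as(1) by (auto simp: algebra_simps)
          then show ?thesis using tri[of p] by (simp add: algebra_simps)
        qed
        finally have "(\<Sum>i = 0..<p. \<phi> i) \<le> 2 * d * s + (\<Sum>i<p. i)"
          unfolding of_nat_le_iff[where 'a = int, symmetric] by simp
        then show ?thesis by (rule degree_detf_powers)
      qed
      moreover have "degree (\<Prod>i = 0..<p. [:\<gamma> i (\<phi> i):]) = 0"
        using degree_prod_sum_le[of "{0..<p}" "\<lambda>i. [:\<gamma> i (\<phi> i):]"] by simp
      ultimately show "degree (detf p (\<lambda>i j. [:\<gamma> i (\<phi> i):] * [:real j - \<kappa>, 1:] ^ \<phi> i)) \<le> 2 * d * s"
        unfolding detf_mult_rows by (intro order.trans[OF degree_mult_le]) simp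
    qed
    finally show ?thesis .
  qed
  ultimately show ?thesis by (simp add: S_def s_def a_def)
qed

lemma slit_det_dvd:
  assumes "0 < p"
  shows "(\<Prod>i = 0..<p - p div 2. \<Prod>k = 0..<d. [:real i - real k, 1:]) *
    (\<Prod>i = 0..<p - p div 2. \<Prod>k = 0..<d. [:real n + (real i - real k), - 1:]) dvd detf p (slit_poly p d n)"
proof -
  define a where "a = p div 2"
  define w1 where "w1 z = [:real_of_int z, 1:]" for z
  define w2 where "w2 z = [:real n + real_of_int z, - 1:]" for z
  let ?P1 = "\<Prod>i = 0..<p - a. \<Prod>k = 0..<d. w1 (int i - int k)"
  let ?P2 = "\<Prod>i = 0..<p - a. \<Prod>k = 0..<d. w2 (int i - int k)"
  define E1 where "E1 j = (\<Prod>l = 0..<a + d. w1 (int j - int l))" for j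
  define E2 where "E2 j = (\<Prod>l = 0..<a + d. w2 (int j - int l))" for j
  have E1: "ffact [:real j, 1:] (a + d) = E1 j" for j
    unfolding E1_def ffact_def w1_def by (rule prod.cong) (auto simp: of_nat_poly)
  have E2: "ffact [:real n + real p - 1 - real j, - 1:] (a + d) = E2 (p - 1 - j)" if "j < p" for j
    unfolding E2_def ffact_def w2_def
    by (rule prod.cong) (use that in \<open>auto simp: of_nat_poly of_nat_diff\<close>)
  \<comment> \<open>\<open>E1\<close> belongs to rows that cannot reach below the axis,
    \<open>E2\<close> to rows that cannot reach above it. For odd \<open>p\<close> the middle row
    carries both, so each kind occurs \<open>p - a\<close> times.\<close>
  define E where "E i j = (if a \<le> i then E1 j else 1) * (if i < p - a then E2 (p - 1 - j) else 1)" for i j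
  have dvd: "E i j dvd slit_poly p d n i j" if "i < p" "j < p" for i j
    unfolding slit_poly_def
  proof (rule dvd_sum)
    fix k assume k: "k \<in> {..2 * d + p - 1}"
    have ff: "ffact X h dvd ffact X k" if "h \<le> k" for X :: "real poly" and h k
      using ffact_add[of X h "k - h"] that by simp
    show "E i j dvd smult (slit_coeff p d i k) (ffact [:real j, 1:] k *
      ffact [:real n + real p - 1 - real j, - 1:] (2 * d + p - 1 - k))"
    proof (cases "slit_coeff p d i k = 0")
      case False
      then have "a \<le> i \<Longrightarrow> a + d \<le> k" "i < p - a \<Longrightarrow> a + d \<le> 2 * d + p - 1 - k"
        using slit_coeff_eq_0[of p i k d] slit_coeff_eq_0'[of i p d k] k assms by (auto simp: a_def not_less[symmetric])
      then show ?thesis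
        unfolding E_def E1[symmetric] E2[OF that(2), symmetric]
        by (intro dvd_smult mult_dvd_mono) (auto intro: ff)
    qed simp
  qed
  have "?P1 * ?P2
      dvd (\<Prod>i = 0..<p. slit_poly p d n i (\<pi> i))" if \<pi>: "\<pi> permutes {0..<p}" for \<pi>
  proof -
    have \<pi>p: "\<pi> i < p" if "i < p" for i using permutes_in_image[OF \<pi>, of i] that by simp
    have inj: "inj \<pi>" using \<pi> by (rule permutes_inj)
    \<comment> \<open>The permutation sends these rows to an arbitrary set of \<open>p - a\<close>
      columns, hence the need for a divisor common to all such sets.\<close>
    have "?P1 dvd (\<Prod>j\<in>\<pi> ` {a..<p}. E1 j)"
      unfolding E1_def
      by (rule prod_consecutive_dvd) (use inj \<pi>p in \<open>auto simp: card_image inj_on_subset[OF inj] a_def\<close>)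
    also have "\<dots> = (\<Prod>i = a..<p. E1 (\<pi> i))"
      by (rule prod.reindex_cong[of \<pi>]) (auto simp: inj_on_subset[OF inj])
    also have "\<dots> = (\<Prod>i = 0..<p. if a \<le> i then E1 (\<pi> i) else 1)"
      by (rule prod.mono_neutral_cong_left) auto
    finally have d1: "?P1 dvd (\<Prod>i = 0..<p. if a \<le> i then E1 (\<pi> i) else 1)" .
    have inj2: "inj_on (\<lambda>i. p - 1 - \<pi> i) {0..<p - a}"
    proof (rule inj_onI)
      fix i j assume ij: "i \<in> {0..<p - a}" "j \<in> {0..<p - a}" "p - 1 - \<pi> i = p - 1 - \<pi> j"
      then have "i < p" "j < p" by auto
      then have "\<pi> i = \<pi> j" using \<pi>p[of i] \<pi>p[of j] ij(3) by linarith
      then show "i = j" using inj by (auto dest: injD)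
    qed
    have "?P2 dvd (\<Prod>j\<in>(\<lambda>i. p - 1 - \<pi> i) ` {0..<p - a}. E2 j)"
      unfolding E2_def
    proof (rule prod_consecutive_dvd)
      show "card ((\<lambda>i. p - 1 - \<pi> i) ` {0..<p - a}) = p - a" using card_image[OF inj2] by simp
    qed (use assms in \<open>auto simp: a_def\<close>)
    also have "\<dots> = (\<Prod>i = 0..<p - a. E2 (p - 1 - \<pi> i))"
      by (rule prod.reindex_cong[OF inj2]) auto
    also have "\<dots> = (\<Prod>i = 0..<p. if i < p - a then E2 (p - 1 - \<pi> i) else 1)"
      by (rule prod.mono_neutral_cong_left) auto
    finally have d2: "?P2 dvd
      (\<Prod>i = 0..<p. if i < p - a then E2 (p - 1 - \<pi> i) else 1)" .
    have "?P1 * ?P2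
      dvd (\<Prod>i = 0..<p. E i (\<pi> i))"
      unfolding E_def prod.distrib by (intro mult_dvd_mono d1 d2)
    also have "\<dots> dvd (\<Prod>i = 0..<p. slit_poly p d n i (\<pi> i))"
      by (intro prod_dvd_prod dvd) (auto simp: \<pi>p)
    finally show ?thesis .
  qed
  then have "?P1 * ?P2
      dvd detf p (slit_poly p d n)"
    unfolding detf_leibniz by (intro dvd_sum dvd_mult) auto
  then show ?thesis by (simp add: w1_def w2_def a_def)
qed

lemma slit_det_product:
  assumes "0 < p"
  obtains C where "\<And>x. detf p (\<lambda>i j. slit_fun p d i (x + real j) (real n + real p - 1 - (x + real j)))
    = C * (\<Prod>i = 0..<p - p div 2. \<Prod>k = 0..<d. (x + real i - real k) * (real n - x + real i - real k))"
proof -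
  define s where "s = p - p div 2"
  define \<Pi>1 where "\<Pi>1 = (\<Prod>i = 0..<s. \<Prod>k = 0..<d. [:real i - real k, 1:])"
  define \<Pi>2 where "\<Pi>2 = (\<Prod>i = 0..<s. \<Prod>k = 0..<d. [:real n + (real i - real k), - 1:])"
  have ne: "\<Pi>1 \<noteq> 0" "\<Pi>2 \<noteq> 0" by (auto simp: \<Pi>1_def \<Pi>2_def)
  have "degree \<Pi>1 = s * d" "degree \<Pi>2 = s * d"
    unfolding \<Pi>1_def \<Pi>2_def by (simp_all add: degree_prod_sum_eq)
  then have deg: "degree (\<Pi>1 * \<Pi>2) = 2 * d * s" using ne by (simp add: degree_mult_eq)
  obtain V where V: "detf p (slit_poly p d n) = \<Pi>1 * \<Pi>2 * V"
    using slit_det_dvd[OF assms, of d n] by (auto simp: \<Pi>1_def \<Pi>2_def s_def dvd_def)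
  have "degree V = 0"
  proof (cases "V = 0")
    case False
    then have "degree (\<Pi>1 * \<Pi>2 * V) = 2 * d * s + degree V"
      using ne deg by (simp add: degree_mult_eq)
    then show ?thesis using degree_slit_det_le[OF assms, of d n] V by (simp add: s_def)
  qed simp
  then obtain C where C: "V = [:C:]" by (rule degree_eq_zeroE)
  show ?thesis
  proof (rule that[of C])
    fix x
    have "detf p (\<lambda>i j. slit_fun p d i (x + real j) (real n + real p - 1 - (x + real j)))
        = poly (detf p (slit_poly p d n)) x"
      by (simp add: poly_detf poly_slit_poly)
    also have "\<dots> = C * (poly \<Pi>1 x * poly \<Pi>2 x)" unfolding V C by simp
    also have "poly \<Pi>1 x * poly \<Pi>2 x = (\<Prod>i = 0..<s. \<Prod>k = 0..<d. (x + real i - real k) * (real n - x + real i - real k))"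
      unfolding \<Pi>1_def \<Pi>2_def poly_prod prod.distrib[symmetric]
      by (intro prod.cong) (auto simp: algebra_simps)
    finally show "detf p (\<lambda>i j. slit_fun p d i (x + real j) (real n + real p - 1 - (x + real j)))
      = C * (\<Prod>i = 0..<p - p div 2. \<Prod>k = 0..<d. (x + real i - real k) * (real n - x + real i - real k))"
      by (simp add: s_def)
  qed
qed

subsection \<open>The exact number of tilings\<close>

lemma M_hexd_eq_slit_det:
  assumes d: "d \<le> b" "d \<le> c" "2 * d < b + c" and p: "0 < p"
  shows "real (M (hexd p b c d)) = (\<Prod>j = 0..<p. fact (b + c - 2 * d) / (fact (b + j) * fact (c + (p - 1 - j)))) *
    detf p (\<lambda>i j. slit_fun p d i (real b + real j) (real (b + c) + real p - 1 - (real b + real j)))"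
proof -
  define m where "m = b + c - 2 * d"
  define q where "q = 2 * d + p - 1"
  let ?K = "\<lambda>j. fact m / (fact (b + j) * fact (c + (p - 1 - j))) :: real"
  let ?r = "\<lambda>j. int b - int c + 2 * int j + 1 - int p"
  have "slit_paths d (2 * int i + 1 - int p) m (?r j)
    = ?K j *
      slit_fun p d i (real b + real j) (real (b + c) + real p - 1 - (real b + real j))" if ij: "i < p" "j < p" for i j
  proof -
    have Y: "real (b + c) + real p - 1 - (real b + real j) = real (c + (p - 1 - j))" using ij by (simp add: of_nat_diff)
    have "slit_paths d (2 * int i + 1 - int p) m (?r j)
      = (\<Sum>k\<le>q. slit_coeff p d i k * free_paths m (?r j - (2 * int k - int q)))"
      unfolding q_def by (rule slit_paths_eq_sum[OF ij(1)])
    also have "\<dots> = (\<Sum>k\<le>q. ?K j *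
      (slit_coeff p d i k * (ffact (real (b + j)) k * ffact (real (c + (p - 1 - j))) (q - k))))"
    proof (rule sum.cong)
      fix k assume "k \<in> {..q}"
      then have k: "k \<le> q" by simp
      have arg: "?r j - (2 * int k - int q) = 2 * (int (b + j) - int k) - int m"
        using d p by (simp add: q_def m_def of_nat_diff)
      have sum: "b + j + (c + (p - 1 - j)) = m + q" using ij d by (simp add: m_def q_def)
      show "slit_coeff p d i k * free_paths m (?r j - (2 * int k - int q))
        = ?K j *
          (slit_coeff p d i k * (ffact (real (b + j)) k * ffact (real (c + (p - 1 - j))) (q - k)))"
        unfolding arg free_paths_ffact[OF sum k] by simp
    qed simp
    finally show ?thesis
      unfolding slit_fun_def Y q_def[symmetric] by (simp add: sum_distrib_left)
  qed
  then have "detf p (\<lambda>i j. slit_paths d (2 * int i + 1 - int p) m (?r j))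
    = detf p (\<lambda>i j. ?K j *
      slit_fun p d i (real b + real j) (real (b + c) + real p - 1 - (real b + real j)))"
    by (intro detf_cong) auto
  then show ?thesis
    unfolding M_hexd_eq_detf[OF d] m_def[symmetric] by (simp only: detf_mult_cols)
qed

text \<open>The number of families of paths from \<open>2 i + 1 + e\<close> to \<open>m + 2 j + 1 + e\<close> in \<open>n\<close> steps, for \<open>i, j < a\<close>, that
  stay above \<open>0\<close>.\<close>

definition reflect_det :: "nat \<Rightarrow> nat \<Rightarrow> nat \<Rightarrow> nat \<Rightarrow> real" where
  "reflect_det a e n m = detf a (\<lambda>i j. free_paths n (int m + 2 * int j - 2 * int i)
     - free_paths n (int m + 2 * int j + 2 * int i + 2 + 2 * int e))"

text \<open>Rising by \<open>n\<close> in \<open>n\<close> steps leaves only straight paths: entries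
  with \<open>i < j\<close> and all reflected terms would need a larger displacement than
  \<open>n\<close>.\<close>

lemma reflect_det_self: "reflect_det a e n n = 1"
proof -
  have "reflect_det a e n n = (\<Prod>i = 0..<a. free_paths n (int n + 2 * int i - 2 * int i)
     - free_paths n (int n + 2 * int i + 2 * int i + 2 + 2 * int e))"
    unfolding reflect_det_def by (rule detf_lower_triangular) (simp add: free_paths_eq_0)
  also have "\<dots> = 1"
    using free_paths_choose[of n n] by (simp add: free_paths_eq_0)
  finally show ?thesis .
qed

text \<open>Up to column factors the entries are odd polynomials of degree below
  \<open>2 * a\<close> in the offset \<open>t j\<close> from the centre. So the determinant is a
  constant times the product of the \<open>t j\<close> times a Vandermonde determinant in the
  \<open>t j ^ 2\<close>. The odd expansion is the one for an empty slit, and the constant does not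
  involve \<open>\<delta>\<close>.\<close>

lemma reflect_det_eq_vandermonde:
  assumes e: "e < 2"
  obtains C where "\<And>\<delta>. 2 * \<delta> \<le> n \<Longrightarrow> reflect_det a e n (n - 2 * \<delta>) = C *
    (\<Prod>j = 0..<a. 1 / (fact (n - \<delta> + a + e + j) * fact (\<delta> + (a - 1 - j)))) *
    (\<Prod>j = 0..<a. \<Prod>i = 0..j. real (n - 2 * \<delta> + i + j + 1 + e))"
proof -
  define p where "p = 2 * a + e"
  have p2: "p div 2 = a" using e by (simp add: p_def)
  define \<kappa> where "\<kappa> = (real n + real p - 1) / 2"
  define P where "P i \<gamma> \<longleftrightarrow> (\<forall>t. ffact (\<kappa> + t) (a + e + i) * ffact (\<kappa> - t) (a - 1 - i)
    - ffact (\<kappa> + t) (a - 1 - i) * ffact (\<kappa> - t) (a + e + i) = (\<Sum>l = 0..<a. \<gamma> l * t ^ (2 * l + 1)))" for i \<gamma>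
  have "\<exists>\<gamma>. P i \<gamma>" if "i < a" for i
  proof -
    have i: "a + e + i < p" "p - 1 - (a + e + i) = a - 1 - i" using that by (auto simp: p_def)
    obtain \<gamma> where \<gamma>: "\<And>t. slit_fun p 0 (a + e + i) (\<kappa> + t) (\<kappa> - t) - slit_fun p 0 (p - 1 - (a + e + i)) (\<kappa> + t) (\<kappa> - t)
      = (\<Sum>l\<in>(\<lambda>m. 2 * m + 1) ` {..<p div 2}. \<gamma> l * t ^ l)"
      using slit_fun_odd_expansion[OF i(1)] by blast
    have "(\<Sum>l\<in>(\<lambda>m. 2 * m + 1) ` {..<p div 2}. \<gamma> l * t ^ l) = (\<Sum>l = 0..<a. \<gamma> (2 * l + 1) * t ^ (2 * l + 1))" for t
      unfolding p2 by (subst sum.reindex) (auto simp: inj_on_def lessThan_atLeast0)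
    then have "ffact (\<kappa> + t) (a + e + i) * ffact (\<kappa> - t) (a - 1 - i) - ffact (\<kappa> + t) (a - 1 - i) * ffact (\<kappa> - t) (a + e + i)
        = (\<Sum>l = 0..<a. \<gamma> (2 * l + 1) * t ^ (2 * l + 1))" for t
      using \<gamma>[of t] slit_fun_diff[OF i(1), of 0 "\<kappa> + t" "\<kappa> - t"] i(2) by (simp add: ffact_def)
    then have "P i (\<lambda>l. \<gamma> (2 * l + 1))" unfolding P_def by (intro allI)
    then show ?thesis by blast
  qed
  then obtain \<gamma> where "\<And>i. i < a \<Longrightarrow> P i (\<gamma> i)" by metis
  then have \<gamma>: "i < a \<Longrightarrow>
    ffact (\<kappa> + t) (a + e + i) * ffact (\<kappa> - t) (a - 1 - i) - ffact (\<kappa> + t) (a - 1 - i) * ffact (\<kappa> - t) (a + e + i)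
    = (\<Sum>l = 0..<a. \<gamma> i l * t ^ (2 * l + 1))" for i t unfolding P_def by blast
  define C where "C = fact n ^ a * detf a \<gamma> * (1 / 2) ^ a * (\<Prod>j = 0..<a. \<Prod>i = 0..<j. real j - real i)"
  show ?thesis
  proof (rule that[of C])
    fix \<delta> assume \<delta>: "2 * \<delta> \<le> n"
    define m where "m = n - 2 * \<delta>"
    define t where "t j = (real m + 2 * real j + 1 + real e) / 2" for j
    define K where "K j = 1 / (fact (n - \<delta> + a + e + j) * fact (\<delta> + (a - 1 - j)) :: real)" for j :: nat
    have "reflect_det a e n m = detf a (\<lambda>i j. fact n * K j * (\<Sum>l = 0..<a. \<gamma> i l * t j ^ (2 * l + 1)))"
      unfolding reflect_det_def
    proof (rule detf_cong)
      fix i j assume ij: "i < a" "j < a"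
      define y where "y = n - \<delta> + a + e + j"
      define Y where "Y = \<delta> + (a - 1 - j)"
      have yY: "y + Y = n + (p - 1)" using ij \<delta> by (simp add: y_def Y_def p_def)
      have ky: "real y = \<kappa> + t j" "real Y = \<kappa> - t j"
        using ij \<delta> by (simp_all add: y_def Y_def \<kappa>_def t_def m_def p_def of_nat_diff field_simps)
      have f1: "int m + 2 * int j - 2 * int i = 2 * (int y - int (a + e + i)) - int n"
        "int m + 2 * int j + 2 * int i + 2 + 2 * int e = 2 * (int y - int (a - 1 - i)) - int n"
        using ij \<delta> by (simp_all add: y_def m_def of_nat_diff)
      have q: "a + e + i \<le> p - 1" "a - 1 - i \<le> p - 1" "p - 1 - (a + e + i) = a - 1 - i" "p - 1 - (a - 1 - i) = a + e + i"
        using ij by (auto simp: p_def)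
      show "free_paths n (int m + 2 * int j - 2 * int i) - free_paths n (int m + 2 * int j + 2 * int i + 2 + 2 * int e)
        = fact n * K j * (\<Sum>l = 0..<a. \<gamma> i l * t j ^ (2 * l + 1))"
        unfolding f1 free_paths_ffact[OF yY q(1)] free_paths_ffact[OF yY q(2)] q(3,4) ky \<gamma>[OF ij(1), symmetric] K_def
          y_def[symmetric] Y_def[symmetric]
        by (simp add: diff_divide_distrib right_diff_distrib)
    qed
    also have "\<dots> = (\<Prod>j = 0..<a. fact n * K j) * (detf a \<gamma> * detf a (\<lambda>l j. t j ^ (2 * l + 1)))"
      by (simp only: detf_mult_cols detf_mult)
    also have "detf a (\<lambda>l j. t j ^ (2 * l + 1)) = detf a (\<lambda>l j. t j * (t j ^ 2) ^ l)"
      by (simp add: power_mult)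
    also have "\<dots> = (\<Prod>j = 0..<a. t j) * (\<Prod>j = 0..<a. \<Prod>i = 0..<j. t j ^ 2 - t i ^ 2)"
      by (simp only: detf_mult_cols detf_vandermonde)
    also have "\<dots> = (\<Prod>j = 0..<a. t j * (\<Prod>i = 0..<j. t j ^ 2 - t i ^ 2))"
      by (simp only: prod.distrib)
    also have "\<dots> = (\<Prod>j = 0..<a. 1 / 2 * (\<Prod>i = 0..<j. real j - real i) * (\<Prod>i = 0..j. real (m + i + j + 1 + e)))"
    proof (rule prod.cong)
      fix j
      \<comment> \<open>Up to the factor 1/2, \<open>t j\<close> itself supplies the factor with
        \<open>i = j\<close>, which extends the inner product to \<open>i = j\<close>.\<close>
      have "t j ^ 2 - t i ^ 2 = (real j - real i) * real (m + i + j + 1 + e)" for i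
        by (simp add: t_def power2_eq_square field_simps)
      then show "t j * (\<Prod>i = 0..<j. t j ^ 2 - t i ^ 2)
        = 1 / 2 * (\<Prod>i = 0..<j. real j - real i) * (\<Prod>i = 0..j. real (m + i + j + 1 + e))"
        by (simp add: prod.distrib atLeast0AtMost[symmetric] atLeastLessThanSuc_atLeastAtMost[symmetric] t_def)
    qed simp
    also have "(\<Prod>j = 0..<a. fact n * K j) * (detf a \<gamma> *
        (\<Prod>j = 0..<a. 1 / 2 * (\<Prod>i = 0..<j. real j - real i) * (\<Prod>i = 0..j. real (m + i + j + 1 + e))))
      = C * (\<Prod>j = 0..<a. K j) * (\<Prod>j = 0..<a. \<Prod>i = 0..j. real (m + i + j + 1 + e))"
      unfolding C_def by (simp only: prod.distrib prod_constant card_atLeastLessThan diff_zero mult_ac)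
    finally show "reflect_det a e n (n - 2 * \<delta>) = C *
      (\<Prod>j = 0..<a. 1 / (fact (n - \<delta> + a + e + j) * fact (\<delta> + (a - 1 - j)))) *
      (\<Prod>j = 0..<a. \<Prod>i = 0..j. real (n - 2 * \<delta> + i + j + 1 + e))"
      unfolding m_def K_def .
  qed
qed

lemma prod_reverse: "(\<Prod>j = 0..<a. f (a - 1 - j)) = (\<Prod>j = 0..<a. f j)" for f :: "nat \<Rightarrow> 'a :: comm_monoid_mult"
  by (rule prod.reindex_bij_witness[of _ "\<lambda>j. a - 1 - j" "\<lambda>j. a - 1 - j"]) auto

text \<open>The unknown constant is eliminated by the instance \<open>\<delta> = 0\<close>, where
  the determinant is \<open>1\<close>.\<close>

lemma reflect_det_eq:
  assumes "e < 2" "2 * \<delta> \<le> n"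
  shows "reflect_det a e n (n - 2 * \<delta>) =
    (\<Prod>j = 0..<a. fact (n + a + e + j) * fact j / (fact (n - \<delta> + a + e + j) * fact (\<delta> + j))) *
    (\<Prod>j = 0..<a. \<Prod>i = 0..j. real (n - 2 * \<delta> + i + j + 1 + e) / real (n + i + j + 1 + e))"
proof -
  obtain C where C: "\<And>\<delta>. 2 * \<delta> \<le> n \<Longrightarrow> reflect_det a e n (n - 2 * \<delta>) = C *
    (\<Prod>j = 0..<a. 1 / (fact (n - \<delta> + a + e + j) * fact (\<delta> + (a - 1 - j)))) *
    (\<Prod>j = 0..<a. \<Prod>i = 0..j. real (n - 2 * \<delta> + i + j + 1 + e))"
    using reflect_det_eq_vandermonde[OF assms(1)] by blast
  define F where "F \<delta> = (\<Prod>j = 0..<a. fact (n - \<delta> + a + e + j) * fact (\<delta> + j) :: real)" for \<delta>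
  define V where "V \<delta> = (\<Prod>j = 0..<a. \<Prod>i = 0..j. real (n - 2 * \<delta> + i + j + 1 + e))" for \<delta>
  have K: "(\<Prod>j = 0..<a. 1 / (fact (n - \<delta> + a + e + j) * fact (\<delta> + (a - 1 - j)))) = 1 / F \<delta>" for \<delta>
    unfolding F_def prod.distrib prod_dividef using prod_reverse[of "\<lambda>j. fact (\<delta> + j) :: real" a] by simp
  have pos: "F 0 > 0" "V 0 > 0" unfolding F_def V_def by (intro prod_pos; auto)+
  have "reflect_det a e n (n - 2 * 0) = C * (1 / F 0) * V 0"
    unfolding K[symmetric] V_def by (rule C) simp
  then have "1 = C * (1 / F 0) * V 0" by (simp only: mult_0_right diff_zero reflect_det_self)
  then have "F 0 = F 0 * (C * (1 / F 0) * V 0)" by simp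
  also have "\<dots> = C * V 0" using pos by simp
  finally have "C * V 0 = F 0" by simp
  then have "C = F 0 / V 0" using pos by (simp add: eq_divide_eq)
  then have "reflect_det a e n (n - 2 * \<delta>) = (F 0 / F \<delta>) * (V \<delta> / V 0)"
    using C[OF assms(2)] unfolding K V_def[symmetric] by simp
  then show ?thesis
    unfolding F_def V_def prod_dividef[symmetric] by simp
qed

text \<open>At \<open>b = d\<close> column \<open>j\<close> has \<open>y = d + j\<close>. Rows
  \<open>i \<ge> a\<close> only contain terms with \<open>k \<ge> a + d\<close>, and
  \<open>ffact y k\<close> is \<open>0\<close> for \<open>k > y\<close>, which empties the lower
  left block. The upper left block equals its antisymmetric part, a reflected count over
  \<open>n\<close> steps; the lower right block factors at the tip of the slit.\<close>

lemma slit_det_base: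
  assumes e: "e < 2" and p: "p = 2 * a + e" "0 < p" and d: "2 * d \<le> n"
  shows "detf p (\<lambda>i j. slit_fun p d i (real d + real j) (real n + real p - 1 - (real d + real j)))
    = (\<Prod>j = 0..<p. fact (d + j) * fact (n - d + (p - 1 - j)) / fact (n - 2 * d)) *
      (reflect_det a e n (n - 2 * d) * reflect_det a e (2 * d) 0)"
proof -
  define m where "m = n - 2 * d"
  define q where "q = 2 * d + p - 1"
  define h where "h = a + d"
  define y where "y j = d + j" for j
  define Y where "Y j = n - d + (p - 1 - j)" for j
  define f where "f i j = slit_fun p d i (real (y j)) (real (Y j))" for i j
  define U where "U j = fact (y j) * fact (Y j) / (fact m :: real)" for j
  have pa: "p div 2 = a" "p - p div 2 = a + e" using e p by auto
  have fsum: "f i j = (\<Sum>k\<le>q. slit_coeff p d i k * (ffact (real (y j)) k * ffact (real (Y j)) (q - k)))" for i j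
    by (simp add: f_def slit_fun_def q_def)
  have zero: "f i j = 0" if "a \<le> i" "i < p" "j < a" for i j
    unfolding fsum
  proof (rule sum.neutral, safe)
    fix k
    show "slit_coeff p d i k * (ffact (real (y j)) k * ffact (real (Y j)) (q - k)) = 0"
    proof (cases "k < h")
      case True
      then show ?thesis using slit_coeff_eq_0[of p i k d] that p pa by (simp add: h_def)
    next
      case False
      then have "ffact (real (y j)) k = 0"
        using that by (intro ffact_of_nat_eq_0) (auto simp: h_def y_def)
      then show ?thesis by simp
    qed
  qed
  have "detf p (\<lambda>i j. slit_fun p d i (real d + real j) (real n + real p - 1 - (real d + real j))) = detf (a + (a + e)) f"
  proof -
    have "p = a + (a + e)" using p by simp
    moreover have "detf p (\<lambda>i j. slit_fun p d i (real d + real j) (real n + real p - 1 - (real d + real j))) = detf p f"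
    proof (rule detf_cong)
      fix i j assume "i < p" "j < p"
      then have "real n + real p - 1 - (real d + real j) = real (Y j)" using d by (simp add: Y_def of_nat_diff)
      then show "slit_fun p d i (real d + real j) (real n + real p - 1 - (real d + real j)) = f i j"
        by (simp add: f_def y_def)
    qed
    ultimately show ?thesis by simp
  qed
  also have "\<dots> = detf a f * detf (a + e) (\<lambda>i j. f (a + i) (a + j))"
    by (rule detf_block) (use zero p in auto)
  also have "detf a f = (\<Prod>j = 0..<a. U j) * reflect_det a e n m"
  proof -
    let ?G = "\<lambda>i j. free_paths n (2 * (int (y j) - int i) - int n) - free_paths n (2 * (int (y j) - int (p - 1 - i)) - int n)"
    have "f i j = U j * (?G i j)"
      if ij: "i < a" "j < a" for i j
    proof -
      have i: "i < p" "p - 1 - (p - 1 - i) = i" using ij p by auto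
      \<comment> \<open>The mirror row vanishes in this column, so the entry equals the difference,
        for which \<open>slit_fun_diff\<close> gives a closed form.\<close>
      have "f (p - 1 - i) j = 0" using zero[of "p - 1 - i" j] ij p by auto
      moreover have "real (y j) + real (Y j) - (real p - 1) = real n"
        using ij p d by (simp add: y_def Y_def of_nat_diff)
      ultimately have F: "f i j = ffact (real n) (2 * d) * (ffact (real (y j)) i * ffact (real (Y j)) (p - 1 - i)
          - ffact (real (y j)) (p - 1 - i) * ffact (real (Y j)) i)"
        using slit_fun_diff[OF i(1), of d "real (y j)" "real (Y j)"] unfolding f_def by simp
      have yY: "y j + Y j = n + (p - 1)" using ij p d by (simp add: y_def Y_def)
      have N: "ffact (real n) (2 * d) = fact n / fact m" using d by (simp add: ffact_of_nat m_def)
      have le: "i \<le> p - 1" "p - 1 - i \<le> p - 1" using i by auto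
      show ?thesis
        unfolding F N U_def free_paths_ffact[OF yY le(1)] free_paths_ffact[OF yY le(2)] i(2)
        by (simp add: field_simps)
    qed
    then have "detf a f = detf a (\<lambda>i j. U j * (?G i j))"
      by (intro detf_cong) auto
    also have "\<dots> = (\<Prod>j = 0..<a. U j) * detf a (\<lambda>i j. ?G i j)"
      by (rule detf_mult_cols)
    \<comment> \<open>The paths of this block run below the axis. Reversal lists them from the axis
      outwards, and evenness of \<open>free_paths\<close> turns them upwards.\<close>
    also have "detf a (\<lambda>i j. ?G i j) =
      detf a (\<lambda>i j. ?G (a - 1 - i) (a - 1 - j))"
      by (rule detf_reverse[symmetric])
    also have "\<dots> = reflect_det a e n m"
      unfolding reflect_det_def
    proof (rule detf_cong)
      fix i j assume ij: "i < a" "j < a"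
      have "2 * (int (y (a - 1 - j)) - int (a - 1 - i)) - int n = - (int m + 2 * int j - 2 * int i)"
        "2 * (int (y (a - 1 - j)) - int (p - 1 - (a - 1 - i))) - int n = - (int m + 2 * int j + 2 * int i + 2 + 2 * int e)"
        using ij p d by (simp_all add: y_def m_def of_nat_diff)
      then show "?G (a - 1 - i) (a - 1 - j)
        = free_paths n (int m + 2 * int j - 2 * int i) - free_paths n (int m + 2 * int j + 2 * int i + 2 + 2 * int e)"
        by (simp only: free_paths_uminus)
    qed
    finally show ?thesis .
  qed
  also have "detf (a + e) (\<lambda>i j. f (a + i) (a + j)) = (\<Prod>j = 0..<a + e. U (a + j)) * reflect_det a e (2 * d) 0"
  proof -
    \<comment> \<open>The part of the paths beyond the tip. It is triangular because
      \<open>y\<close> equals \<open>h + j\<close> in column \<open>a + j\<close>, so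
      \<open>ffact\<close> of order \<open>h + l\<close> vanishes for \<open>l > j\<close>.\<close>
    define T where "T l j = ffact (real (y (a + j))) (h + l) * ffact (real (Y (a + j))) (q - (h + l))" for l j
    have "f (a + i) (a + j) = (\<Sum>l = 0..<a + e. slit_coeff p d (a + i) (h + l) * T l j)"
      if ij: "i < a + e" "j < a + e" for i j
    proof -
      have "f (a + i) (a + j) = (\<Sum>k\<in>{h..<h + (a + e)}. slit_coeff p d (a + i) k *
          (ffact (real (y (a + j))) k * ffact (real (Y (a + j))) (q - k)))"
        unfolding fsum
      proof (rule sum.mono_neutral_right)
        show "{h..<h + (a + e)} \<subseteq> {..q}" using p by (auto simp: h_def q_def)
        show "\<forall>k\<in>{..q} - {h..<h + (a + e)}. slit_coeff p d (a + i) k *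
          (ffact (real (y (a + j))) k * ffact (real (Y (a + j))) (q - k)) = 0"
        proof
          fix k assume "k \<in> {..q} - {h..<h + (a + e)}"
          then consider "k < h" | "y (a + j) < k" using ij by (auto simp: y_def h_def)
          then show "slit_coeff p d (a + i) k * (ffact (real (y (a + j))) k * ffact (real (Y (a + j))) (q - k)) = 0"
            using slit_coeff_eq_0[of p "a + i" k d] p pa
            by cases (simp_all add: ffact_of_nat_eq_0 h_def)
        qed
      qed simp
      also have "\<dots> = (\<Sum>l = 0..<a + e. slit_coeff p d (a + i) (h + l) * T l j)"
        unfolding T_def by (rule sum.reindex_bij_witness[of _ "\<lambda>l. h + l" "\<lambda>k. k - h"]) auto
      finally show ?thesis .
    qed
    then have "detf (a + e) (\<lambda>i j. f (a + i) (a + j))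
        = detf (a + e) (\<lambda>i j. \<Sum>l = 0..<a + e. slit_coeff p d (a + i) (h + l) * T l j)"
      by (intro detf_cong) auto
    also have "\<dots> = detf (a + e) (\<lambda>i l. slit_coeff p d (a + i) (h + l)) * detf (a + e) T"
      by (rule detf_mult)
    also have "detf (a + e) T = (\<Prod>j = 0..<a + e. T j j)"
    proof (rule detf_upper_triangular)
      show "T l j = 0" if "l < a + e" "j < l" for l j
      proof -
        have "ffact (real (y (a + j))) (h + l) = 0"
          by (rule ffact_of_nat_eq_0) (use that in \<open>simp add: y_def h_def\<close>)
        then show ?thesis by (simp add: T_def)
      qed
    qed
    also have "\<dots> = (\<Prod>j = 0..<a + e. U (a + j))"
    proof (rule prod.cong)
      fix j assume "j \<in> {0..<a + e}"
      then have j: "j < a + e" by simp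
      have 1: "y (a + j) = h + j" by (simp add: y_def h_def)
      have 2: "q - (h + j) \<le> Y (a + j)" "Y (a + j) - (q - (h + j)) = m"
        using j p d by (simp_all add: q_def h_def Y_def m_def)
      show "T j j = U (a + j)"
        unfolding T_def U_def 1 ffact_of_nat[OF order_refl] ffact_of_nat[OF 2(1)] 2(2) by simp
    qed simp
    also have "detf (a + e) (\<lambda>i l. slit_coeff p d (a + i) (h + l)) = reflect_det a e (2 * d) 0"
    proof -
      let ?h = "\<lambda>i l. half_paths (2 * int i + 1 - int e) (2 * d) (2 * int l + 1 - int e)"
      have c: "slit_coeff p d (a + i) (h + l) = ?h i l" for i l
        unfolding slit_coeff_def by (rule arg_cong2[where f = "\<lambda>u v. half_paths u (2 * d) v"])
          (use p in \<open>auto simp: h_def\<close>)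
      have pos: "half_paths (2 * int i + 1 + int e) (2 * d) (2 * int l + 1 + int e)
        = free_paths (2 * d) (int 0 + 2 * int l - 2 * int i) - free_paths (2 * d) (int 0 + 2 * int l + 2 * int i + 2 + 2 * int e)" for i l
      proof -
        have "2 * int l + 1 + int e - (2 * int i + 1 + int e) = int 0 + 2 * int l - 2 * int i"
          "2 * int l + 1 + int e + (2 * int i + 1 + int e) = int 0 + 2 * int l + 2 * int i + 2 + 2 * int e" by simp_all
        then show ?thesis by (simp only: half_paths_def) (simp add: zero_less_mult_iff)
      qed
      consider "e = 0" | "e = 1" using e by linarith
      then show ?thesis
      proof cases
        case 1
        then show ?thesis unfolding c reflect_det_def pos[symmetric] by simp
      next
        case 2
        \<comment> \<open>For odd \<open>p\<close> the resting particle gives the first row and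
          column; no other path may end at \<open>0\<close>, so it splits off as a block with
          determinant \<open>1\<close>.\<close>
        have "detf (a + e) (\<lambda>i l. slit_coeff p d (a + i) (h + l))
          = detf (1 + a) (\<lambda>i l. ?h i l)"
          unfolding c by (simp add: 2)
        also have "\<dots> = detf 1 (\<lambda>i l. ?h i l) *
          detf a (\<lambda>i l. ?h (1 + i) (1 + l))"
          by (rule detf_block) (auto simp: 2 half_paths_center)
        also have "detf 1 (\<lambda>i l. ?h i l) = 1"
          by (subst detf_upper_triangular) (auto simp: 2 half_paths_center)
        also have "detf a (\<lambda>i l. ?h (1 + i) (1 + l))
          = reflect_det a e (2 * d) 0"
          unfolding reflect_det_def pos[symmetric] by (simp add: 2)
        finally show ?thesis by simp
      qed
    qed
    finally show ?thesis by simp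
  qed
  also have "(\<Prod>j = 0..<a. U j) * reflect_det a e n m * ((\<Prod>j = 0..<a + e. U (a + j)) * reflect_det a e (2 * d) 0)
    = (\<Prod>j = 0..<p. U j) * (reflect_det a e n m * reflect_det a e (2 * d) 0)"
  proof -
    have "(\<Prod>j = 0..<a + e. U (a + j)) = (\<Prod>j = a..<p. U j)"
      by (rule prod.reindex_bij_witness[of _ "\<lambda>j. j - a" "\<lambda>j. a + j"]) (use p in auto)
    moreover have "(\<Prod>j = 0..<a. U j) * (\<Prod>j = a..<p. U j) = (\<Prod>j = 0..<p. U j)"
      using p by (intro prod.atLeastLessThan_concat) auto
    ultimately show ?thesis by (simp add: mult_ac)
  qed
  finally show ?thesis unfolding U_def y_def Y_def m_def .
qed

text \<open>The unknown constant cancels when the product at \<open>b\<close> is divided by the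
  product at \<open>d\<close>, so the count is the known value at \<open>b = d\<close> times
  explicit factorials.\<close>

lemma M_hexd_formula:
  assumes e: "e < 2" and p: "p = 2 * a + e" "0 < p" and d: "d \<le> b" "d \<le> c" "2 * d < b + c"
  shows "real (M (hexd p b c d)) =
    reflect_det a e (b + c) (b + c - 2 * d) * reflect_det a e (2 * d) 0 *
    (\<Prod>j = 0..<p. fact (d + j) * fact (b + c - d + j) / (fact (b + j) * fact (c + j))) *
    (\<Prod>i = 0..<a + e. fact (b + i) * fact (c + i) * fact i * fact (b + c - 2 * d + i) /
      (fact (b - d + i) * fact (c - d + i) * fact (d + i) * fact (b + c - d + i)))"
proof -
  define n where "n = b + c"
  define W where "W x = (\<Prod>i = 0..<a + e. \<Prod>k = 0..<d. (x + real i - real k) * (real n - x + real i - real k))" for x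
  have pa: "p - p div 2 = a + e" using e p by auto
  have W_eq: "W (real z) = (\<Prod>i = 0..<a + e. fact (z + i) * fact (n - z + i) / (fact (z - d + i) * fact (n - z - d + i)))"
    if "d \<le> z" "d \<le> n - z" "z \<le> n" for z
  proof -
    have nz: "real n - real z = real (n - z)" using that(3) by simp
    have "(\<Prod>k = 0..<d. (real z + real i - real k) * (real n - real z + real i - real k))
      = ffact (real (z + i)) d * ffact (real (n - z + i)) d" for i
      unfolding nz by (simp add: ffact_def prod.distrib)
    also have "\<dots> i = fact (z + i) * fact (n - z + i) / (fact (z - d + i) * fact (n - z - d + i))" for i
    proof -
      have le: "d \<le> z + i" "d \<le> n - z + i" "z + i - d = z - d + i" "n - z + i - d = n - z - d + i"
        using that by auto
      show ?thesis unfolding ffact_of_nat[OF le(1)] ffact_of_nat[OF le(2)] le(3,4) by simp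
    qed
    finally show ?thesis unfolding W_def by (simp only:)
  qed
  obtain C where C: "\<And>x. detf p (\<lambda>i j. slit_fun p d i (x + real j) (real n + real p - 1 - (x + real j))) = C * W x"
    using slit_det_product[OF p(2), of d n] unfolding pa W_def by blast
  have Wd: "W (real d) = (\<Prod>i = 0..<a + e. fact (d + i) * fact (n - d + i) / (fact i * fact (n - 2 * d + i)))"
    using W_eq[of d] d by (simp add: n_def mult_2)
  have Wb: "W (real b) = (\<Prod>i = 0..<a + e. fact (b + i) * fact (c + i) / (fact (b - d + i) * fact (c - d + i)))"
    using W_eq[of b] d by (simp add: n_def)
  have W_pos: "W (real d) > 0" unfolding Wd by (intro prod_pos) auto
  define B where "B = (\<Prod>j = 0..<p. fact (d + j) * fact (n - d + (p - 1 - j)) / fact (n - 2 * d) :: real)"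
  define A where "A = (\<Prod>j = 0..<p. fact (n - 2 * d) / (fact (b + j) * fact (c + (p - 1 - j))) :: real)"
  define R where "R = reflect_det a e n (n - 2 * d) * reflect_det a e (2 * d) 0"
  have base: "C * W (real d) = B * R"
  proof -
    have "2 * d \<le> n" using d by (simp add: n_def)
    then show ?thesis using slit_det_base[OF e p, of d n] unfolding C B_def R_def by blast
  qed
  have "real (M (hexd p b c d)) = A * (C * W (real b))"
    unfolding M_hexd_eq_slit_det[OF d p(2)] A_def n_def[symmetric] C ..
  also have "C = B * R / W (real d)" using base W_pos by (simp add: field_simps)
  also have "A * (B * R / W (real d) * W (real b)) = R * (A * B) * (W (real b) / W (real d))" by simp
  also have "A * B = (\<Prod>j = 0..<p. fact (d + j) * fact (n - d + (p - 1 - j)) / (fact (b + j) * fact (c + (p - 1 - j))))"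
    unfolding A_def B_def prod.distrib[symmetric] by (intro prod.cong) auto
  also have "\<dots> = (\<Prod>j = 0..<p. fact (d + j) * fact (n - d + j) / (fact (b + j) * fact (c + j)))"
    unfolding prod_dividef prod.distrib
    using prod_reverse[of "\<lambda>j. fact (n - d + j) :: real" p] prod_reverse[of "\<lambda>j. fact (c + j) :: real" p] by simp
  also have "W (real b) / W (real d) = (\<Prod>i = 0..<a + e. fact (b + i) * fact (c + i) * fact i * fact (n - 2 * d + i) /
      (fact (b - d + i) * fact (c - d + i) * fact (d + i) * fact (n - d + i)))"
    unfolding Wb Wd prod_dividef[symmetric] by (intro prod.cong) (auto simp: field_simps)
  finally show ?thesis unfolding R_def n_def .
qed

subsection \<open>Stirling's formula and the Glaisher constant\<close>

text \<open>From some index on \<open>f + g\<close> decreases, \<open>f - g\<close> increases and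
  their distance tends to \<open>0\<close>; the common limit is squeezed between them, which also
  yields the error bound.\<close>

lemma telescoping_bound_convergent:
  fixes f g :: "nat \<Rightarrow> real"
  assumes g: "g \<longlonglongrightarrow> 0"
    and inc: "eventually (\<lambda>n. \<bar>f (Suc n) - f n\<bar> \<le> g n - g (Suc n)) sequentially"
  obtains c where "f \<longlonglongrightarrow> c" "eventually (\<lambda>n. \<bar>f n - c\<bar> \<le> g n) sequentially"
proof -
  obtain N where N: "\<And>n. n \<ge> N \<Longrightarrow> \<bar>f (Suc n) - f n\<bar> \<le> g n - g (Suc n)"
    using inc by (auto simp: eventually_sequentially)
  define U where "U n = f (n + N) + g (n + N)" for n
  define L where "L n = f (n + N) - g (n + N)" for n
  have U: "decseq U" unfolding decseq_Suc_iff using N[of "_ + N"] by (auto simp: U_def abs_le_iff) (smt (verit) le_add2)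
  have L: "incseq L" unfolding incseq_Suc_iff using N[of "_ + N"] by (auto simp: L_def abs_le_iff) (smt (verit) le_add2)
  have gN: "(\<lambda>n. g (n + N)) \<longlonglongrightarrow> 0" using g by (rule LIMSEQ_ignore_initial_segment)
  have gpos: "g (n + N) \<ge> 0" for n
  proof -
    have "decseq (\<lambda>n. g (n + N))" unfolding decseq_Suc_iff
    proof
      fix n show "g (Suc n + N) \<le> g (n + N)" using N[of "n + N"] by simp
    qed
    then show ?thesis using gN by (rule decseq_ge)
  qed
  have LU: "L n \<le> U n" for n using gpos[of n] by (simp add: L_def U_def)
  have "L 0 \<le> U n" for n using LU[of n] incseqD[OF L, of 0 n] by simp
  then obtain c where c: "U \<longlonglongrightarrow> c" using decseq_convergent[OF U] by blast
  have "(\<lambda>n. U n - 2 * g (n + N)) \<longlonglongrightarrow> c - 2 * 0" by (intro tendsto_intros c gN)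
  moreover have "L = (\<lambda>n. U n - 2 * g (n + N))" by (auto simp: U_def L_def fun_eq_iff)
  ultimately have cL: "L \<longlonglongrightarrow> c" by simp
  have "(\<lambda>n. U n - g (n + N)) \<longlonglongrightarrow> c - 0" by (intro tendsto_intros c gN)
  then have "(\<lambda>n. f (n + N)) \<longlonglongrightarrow> c" by (simp add: U_def)
  then have 1: "f \<longlonglongrightarrow> c" by (rule LIMSEQ_offset)
  have "\<bar>f n - c\<bar> \<le> g n" if "n \<ge> N" for n
    using decseq_ge[OF U c, of "n - N"] incseq_le[OF L cL, of "n - N"] that by (simp add: U_def L_def abs_le_iff)
  then have 2: "eventually (\<lambda>n. \<bar>f n - c\<bar> \<le> g n) sequentially"
    by (auto simp: eventually_sequentially)
  show ?thesis by (rule that[OF 1 2])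
qed

lemma ln_fact_Suc: "ln (fact (Suc n) :: real) = ln (real n + 1) + ln (fact n)"
  by (simp add: ln_mult add.commute)

definition stirling_diff :: "nat \<Rightarrow> real" where
  "stirling_diff n = ln (fact n) - ((real n + 1/2) * ln (real n) - real n)"

text \<open>The first correction term of Stirling's series is subtracted so that the error becomes
  summable; an error of order \<open>1 / n\<close> would be too weak for the increments of
  \<open>glaisher_log\<close>.\<close>

lemma stirling_diff_limit:
  obtains c where "stirling_diff \<longlonglongrightarrow> c"
    "eventually (\<lambda>n. \<bar>stirling_diff n - 1 / (12 * real n) - c\<bar> \<le> 1 / real n ^ 2) sequentially"
proof -
  define f where "f n = stirling_diff n - 1 / (12 * real n)" for n
  have "(\<lambda>n. 1 / real n ^ 2) \<longlonglongrightarrow> 0" by real_asymp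
  moreover have "eventually (\<lambda>n. \<bar>f (Suc n) - f n\<bar> \<le> 1 / real n ^ 2 - 1 / real (Suc n) ^ 2) sequentially"
  proof -
    have "f (Suc n) - f n = ln (real n + 1) - ((real n + 3/2) * ln (real n + 1) - (real n + 1)) - 1 / (12 * (real n + 1))
        + ((real n + 1/2) * ln (real n) - real n) + 1 / (12 * real n)" for n
      unfolding f_def stirling_diff_def ln_fact_Suc by (simp add: add.commute)
    moreover have "eventually (\<lambda>n. \<bar>ln (real n + 1) - ((real n + 3/2) * ln (real n + 1) - (real n + 1)) - 1 / (12 * (real n + 1))
        + ((real n + 1/2) * ln (real n) - real n) + 1 / (12 * real n)\<bar> \<le> 1 / real n ^ 2 - 1 / (real n + 1) ^ 2) sequentially"
      by real_asymp
    ultimately show ?thesis by (simp add: add.commute)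
  qed
  ultimately obtain c where c: "f \<longlonglongrightarrow> c" "eventually (\<lambda>n. \<bar>f n - c\<bar> \<le> 1 / real n ^ 2) sequentially"
    using telescoping_bound_convergent[of "\<lambda>n. 1 / real n ^ 2" f] by blast
  have "(\<lambda>n. f n + 1 / (12 * real n)) \<longlonglongrightarrow> c + 0"
    by (intro tendsto_add c) real_asymp
  then have "stirling_diff \<longlonglongrightarrow> c" by (simp add: f_def)
  then show ?thesis using c(2) by (intro that[of c]) (simp_all add: f_def)
qed

lemma wallis_prod_eq:
  "(\<Prod>k = 1..n. (4 * real k ^ 2) / (4 * real k ^ 2 - 1)) = (2 ^ n * fact n) ^ 4 / ((fact (2 * n)) ^ 2 * (2 * real n + 1))"
proof (induction n)
  case (Suc n)
  define x where "x = real n + 1"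
  have x: "x \<ge> 1" by (simp add: x_def)
  have f: "fact (2 * Suc n) = (2 * x) * (2 * x - 1) * (fact (2 * n) :: real)" "fact (Suc n) = x * (fact n :: real)"
    by (simp_all add: x_def algebra_simps)
  have "(\<Prod>k = 1..Suc n. (4 * real k ^ 2) / (4 * real k ^ 2 - 1))
    = (2 ^ n * fact n) ^ 4 / ((fact (2 * n)) ^ 2 * (2 * x - 1)) * ((4 * x ^ 2) / (4 * x ^ 2 - 1))"
    using Suc by (simp add: x_def algebra_simps)
  also have "4 * x ^ 2 - 1 = (2 * x - 1) * (2 * x + 1)" by (simp add: algebra_simps power2_eq_square)
  also have "(2 ^ n * fact n) ^ 4 / ((fact (2 * n)) ^ 2 * (2 * x - 1)) * ((4 * x ^ 2) / ((2 * x - 1) * (2 * x + 1)))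
    = (2 ^ Suc n * fact (Suc n)) ^ 4 / ((fact (2 * Suc n)) ^ 2 * (2 * x + 1))"
    unfolding f using x by (simp add: divide_simps power_mult_distrib) (simp add: eval_nat_numeral)
  finally show ?case by (simp add: x_def algebra_simps)
qed simp

text \<open>Wallis' partial product is a quotient of \<open>fact n\<close> and
  \<open>fact (2 * n)\<close>. In the limit it gives
  \<open>ln (pi / 2) = 4 * c - 2 * c - 2 * ln 2\<close>, which determines the Stirling constant
  \<open>c\<close>.\<close>

lemma stirling_diff_tendsto: "stirling_diff \<longlonglongrightarrow> ln (2 * pi) / 2"
proof -
  obtain c where c: "stirling_diff \<longlonglongrightarrow> c" using stirling_diff_limit by blast
  have c2: "(\<lambda>n. stirling_diff (2 * n)) \<longlonglongrightarrow> c"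
    by (rule filterlim_compose[OF c]) real_asymp
  have "(\<lambda>n. ln (\<Prod>k = 1..n. (4 * real k ^ 2) / (4 * real k ^ 2 - 1))) \<longlonglongrightarrow> ln (pi / 2)"
    by (intro tendsto_ln wallis) auto
  moreover have "eventually (\<lambda>n. ln (\<Prod>k = 1..n. (4 * real k ^ 2) / (4 * real k ^ 2 - 1))
      = 4 * stirling_diff n - 2 * stirling_diff (2 * n) + (ln (real n) - ln 2 - ln (2 * real n + 1))) sequentially"
    using eventually_gt_at_top[of 0]
  proof eventually_elim
    case (elim n)
    have "ln (\<Prod>k = 1..n. (4 * real k ^ 2) / (4 * real k ^ 2 - 1))
      = 4 * (real n * ln 2 + ln (fact n)) - (2 * ln (fact (2 * n)) + ln (2 * real n + 1))"
      unfolding wallis_prod_eq by (subst ln_div) (auto simp: ln_mult ln_realpow add_pos_nonneg)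
    moreover have "ln (real (2 * n)) = ln 2 + ln (real n)" using elim by (simp add: ln_mult)
    ultimately show ?case
      unfolding stirling_diff_def by (simp add: algebra_simps)
  qed
  ultimately have "(\<lambda>n. 4 * stirling_diff n - 2 * stirling_diff (2 * n) + (ln (real n) - ln 2 - ln (2 * real n + 1)))
      \<longlonglongrightarrow> ln (pi / 2)"
    by (simp add: tendsto_cong)
  moreover have "(\<lambda>n. ln (real n) - ln 2 - ln (2 * real n + 1)) \<longlonglongrightarrow> - 2 * ln 2" by real_asymp
  then have "(\<lambda>n. 4 * stirling_diff n - 2 * stirling_diff (2 * n) + (ln (real n) - ln 2 - ln (2 * real n + 1)))
      \<longlonglongrightarrow> 4 * c - 2 * c + (- 2 * ln 2)"
    by (intro tendsto_intros c c2)
  ultimately have "ln (pi / 2) = 4 * c - 2 * c + (- 2 * ln 2)" by (rule LIMSEQ_unique)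
  then have "c = ln (2 * pi) / 2" by (simp add: ln_mult ln_div)
  with c show ?thesis by (simp only:)
qed

section \<open>Superfactorials and the Glaisher constant\<close>

definition ln_superfact :: "nat \<Rightarrow> real" where
  "ln_superfact n = (\<Sum>i<n. ln (fact i))"

lemma ln_superfact_Suc: "ln_superfact (Suc n) = ln_superfact n + ln (fact n)"
  by (simp add: ln_superfact_def)

definition glaisher_log :: "nat \<Rightarrow> real" where
  "glaisher_log n = real n / 2 * ln (2 * pi) + (real n ^ 2 / 2 - 1 / 12) * ln (real n)
     - 3 / 4 * real n ^ 2 + 1 / 12 - ln_superfact n"

text \<open>\<open>glaisher\<close> is defined by \<open>lim\<close>, which is informative only once
  convergence is known. It holds because the increments of the logarithms are of order
  \<open>1 / n^2\<close>.\<close>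

lemma glaisher_log_tendsto: "glaisher > 0" "glaisher_log \<longlonglongrightarrow> ln glaisher"
proof -
  obtain c where c: "stirling_diff \<longlonglongrightarrow> c"
    "eventually (\<lambda>n. \<bar>stirling_diff n - 1 / (12 * real n) - c\<bar> \<le> 1 / real n ^ 2) sequentially"
    using stirling_diff_limit by blast
  have c': "c = ln (2 * pi) / 2" using LIMSEQ_unique[OF c(1) stirling_diff_tendsto] .
  \<comment> \<open>The increment with \<open>ln (fact n)\<close> replaced by its Stirling
    approximation, including \<open>1 / (12 * n)\<close>; the constant
    \<open>ln (2 * pi) / 2\<close> has cancelled against the linear term of
    \<open>glaisher_log\<close>.\<close>
  define \<beta> where "\<beta> n = ((real n + 1) ^ 2 / 2 - 1 / 12) * ln (real n + 1) - (real n ^ 2 / 2 - 1 / 12) * ln (real n)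
      - 3 / 4 * ((real n + 1) ^ 2 - real n ^ 2) - ((real n + 1/2) * ln (real n) - real n) - 1 / (12 * real n)" for n
  have \<beta>: "eventually (\<lambda>n. \<bar>\<beta> n\<bar> \<le> 1 / real n ^ 2) sequentially"
    unfolding \<beta>_def by real_asymp
  \<comment> \<open>A telescoping majorant for the two errors of size
    \<open>1 / n^2\<close>.\<close>
  have g: "eventually (\<lambda>n. 2 / real n ^ 2 \<le> 3 / real n - 3 / (real n + 1)) sequentially" by real_asymp
  have "(\<lambda>n. 3 / real n) \<longlonglongrightarrow> 0" by real_asymp
  moreover have "eventually (\<lambda>n. \<bar>glaisher_log (Suc n) - glaisher_log n\<bar> \<le> 3 / real n - 3 / real (Suc n)) sequentially"
    using \<beta> g c(2)
  proof eventually_elim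
    case (elim n)
    have s: "real (Suc n) = real n + 1" by simp
    have "glaisher_log (Suc n) - glaisher_log n = \<beta> n - (stirling_diff n - 1 / (12 * real n) - c)"
      unfolding glaisher_log_def ln_superfact_Suc \<beta>_def stirling_diff_def c' s by (simp add: algebra_simps add_divide_distrib)
    then have "\<bar>glaisher_log (Suc n) - glaisher_log n\<bar> \<le> \<bar>\<beta> n\<bar> + \<bar>stirling_diff n - 1 / (12 * real n) - c\<bar>" by linarith
    also have "\<dots> \<le> 2 / real n ^ 2" using elim by simp
    finally show ?case using elim by (simp add: add.commute)
  qed
  ultimately obtain L where L: "glaisher_log \<longlonglongrightarrow> L"
    using telescoping_bound_convergent[of "\<lambda>n. 3 / real n" glaisher_log] by blast
  have "eventually (\<lambda>n. exp (glaisher_log n) = (2 * pi) powr (real n / 2) *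
      real n powr (real n ^ 2 / 2 - 1 / 12) * exp (- 3 / 4 * real n ^ 2 + 1 / 12) / (\<Prod>i<n. fact i)) sequentially"
    using eventually_gt_at_top[of 0]
  proof eventually_elim
    case (elim n)
    have "exp (ln_superfact n) = (\<Prod>i<n. fact i)"
      unfolding ln_superfact_def by (simp add: exp_sum)
    moreover have "exp (glaisher_log n) = exp (real n / 2 * ln (2 * pi)) * exp ((real n ^ 2 / 2 - 1 / 12) * ln (real n)) *
      exp (- 3 / 4 * real n ^ 2 + 1 / 12) / exp (ln_superfact n)"
      unfolding glaisher_log_def exp_add[symmetric] exp_diff[symmetric] by (simp add: algebra_simps)
    ultimately show ?case using elim by (simp add: powr_def)
  qed
  moreover have "(\<lambda>n. exp (glaisher_log n)) \<longlonglongrightarrow> exp L" by (intro tendsto_exp L)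
  ultimately have "(\<lambda>n. (2 * pi) powr (real n / 2) *
      real n powr (real n ^ 2 / 2 - 1 / 12) * exp (- 3 / 4 * real n ^ 2 + 1 / 12) / (\<Prod>i<n. fact i)) \<longlonglongrightarrow> exp L"
    by (simp add: tendsto_cong)
  then have G: "glaisher = exp L" unfolding glaisher_def by (rule limI)
  show "glaisher > 0" unfolding G by (rule exp_gt_zero)
  show "glaisher_log \<longlonglongrightarrow> ln glaisher" unfolding G ln_exp by (rule L)
qed

text \<open>\<open>glaisher_log (x * N)\<close> solved for \<open>ln_superfact (x * N)\<close>, with
  the limit inserted and \<open>ln (x * N)\<close> split so that powers of \<open>N\<close> and
  \<open>ln N\<close> can be compared.\<close>

definition superfact_approx :: "real \<Rightarrow> real \<Rightarrow> real" where
  "superfact_approx x N = x * N / 2 * ln (2 * pi) + ((x * N) ^ 2 / 2 - 1 / 12) * (ln x + ln N)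
     - 3 / 4 * (x * N) ^ 2 + 1 / 12 - ln glaisher"

definition fact_approx :: "real \<Rightarrow> real \<Rightarrow> real" where
  "fact_approx x N = x * N * (ln x + ln N) - x * N + (ln (2 * pi) + ln x + ln N) / 2"

lemma superfact_asymp:
  assumes "0 < x"
  shows "(\<lambda>N. ln_superfact (x * N) - superfact_approx (real x) (real N)) \<longlonglongrightarrow> 0"
proof -
  have "filterlim (\<lambda>N. x * N) at_top sequentially"
    using assms by (intro mult_nat_left_at_top) 
  then have "(\<lambda>N. glaisher_log (x * N)) \<longlonglongrightarrow> ln glaisher"
    by (rule filterlim_compose[OF glaisher_log_tendsto(2)])
  then have "(\<lambda>N. ln glaisher - glaisher_log (x * N)) \<longlonglongrightarrow> ln glaisher - ln glaisher" by (intro tendsto_intros)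
  moreover have "eventually (\<lambda>N. ln glaisher - glaisher_log (x * N) = ln_superfact (x * N) - superfact_approx (real x) (real N)) sequentially"
    using eventually_gt_at_top[of 0]
  proof eventually_elim
    case (elim N)
    then have "ln (real (x * N)) = ln (real x) + ln (real N)" using assms by (simp add: ln_mult)
    then show ?case unfolding glaisher_log_def superfact_approx_def by simp
  qed
  ultimately show ?thesis by (simp add: tendsto_cong)
qed

lemma fact_asymp:
  assumes "0 < x"
  shows "(\<lambda>N. ln (fact (x * N)) - fact_approx (real x) (real N)) \<longlonglongrightarrow> 0"
proof -
  have "filterlim (\<lambda>N. x * N) at_top sequentially"
    using assms by (intro mult_nat_left_at_top) 
  then have "(\<lambda>N. stirling_diff (x * N)) \<longlonglongrightarrow> ln (2 * pi) / 2"
    by (rule filterlim_compose[OF stirling_diff_tendsto])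
  then have "(\<lambda>N. stirling_diff (x * N) - ln (2 * pi) / 2) \<longlonglongrightarrow> ln (2 * pi) / 2 - ln (2 * pi) / 2" by (intro tendsto_intros)
  moreover have "eventually (\<lambda>N. stirling_diff (x * N) - ln (2 * pi) / 2 = ln (fact (x * N)) - fact_approx (real x) (real N)) sequentially"
    using eventually_gt_at_top[of 0]
  proof eventually_elim
    case (elim N)
    then have "ln (real (x * N)) = ln (real x) + ln (real N)" using assms by (simp add: ln_mult)
    then show ?case unfolding stirling_diff_def fact_approx_def by (simp add: field_simps)
  qed
  ultimately show ?thesis by (simp add: tendsto_cong)
qed

subsection \<open>Asymptotics\<close>

lemma ln_superfact_0 [simp]: "ln_superfact 0 = 0"
  by (simp add: ln_superfact_def)

lemma prod_fact_eq_exp: "(\<Prod>j = 0..<k. fact (x + j)) = exp (ln_superfact (x + k) - ln_superfact x)"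
proof (induction k)
  case (Suc k)
  have "exp (ln (fact (x + k) :: real)) = fact (x + k)" by simp
  then show ?case using Suc by (simp add: ln_superfact_Suc exp_add exp_diff)
qed simp

lemma prod_fact_eq_exp_0: "(\<Prod>j = 0..<k. fact j) = exp (ln_superfact k)"
  using prod_fact_eq_exp[of 0 k] by simp

section \<open>Triangular products expressed by superfactorials\<close>

definition ln_tri_prod :: "nat \<Rightarrow> nat \<Rightarrow> real" where
  "ln_tri_prod a m = (\<Sum>j = 0..<a. \<Sum>i = 0..j. ln (real (m + i + j + 1)))"

lemma sum_ln_consecutive: "(\<Sum>i = 0..a. ln (real (k + 1 + i))) = ln (fact (k + a + 1)) - ln (fact k)"
proof (induction a)
  case 0
  show ?case using ln_fact_Suc[of k] by (simp del: fact_Suc add: add_ac)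
next
  case (Suc a)
  have "ln (fact (k + Suc a + 1) :: real) = ln (real (k + 1 + Suc a)) + ln (fact (k + a + 1))"
    using ln_fact_Suc[of "k + a + 1"] by (simp del: fact_Suc add: add_ac)
  then show ?case using Suc by (simp del: fact_Suc)
qed

text \<open>The summand is symmetric in \<open>i\<close> and \<open>j\<close>, so twice the triangle
  is the full square plus the diagonal. Each row of the square is a quotient of two factorials, so
  the square consists of superfactorials.\<close>

lemma ln_tri_prod_eq:
  "2 * ln_tri_prod a m = ln_superfact (m + 2 * a) - 2 * ln_superfact (m + a) + ln_superfact m
     + (\<Sum>j = 0..<a. ln (real (m + 2 * j + 1)))"
proof (induction a)
  case (Suc a)
  have "(\<Sum>i = 0..a. ln (real (m + i + a + 1))) = ln (fact (m + a + a + 1)) - ln (fact (m + a))"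
    using sum_ln_consecutive[of "m + a" a] by (simp only: add_ac)
  then have 1: "ln_tri_prod (Suc a) m = ln_tri_prod a m + (ln (fact (m + a + a + 1)) - ln (fact (m + a)))"
    by (simp only: ln_tri_prod_def sum.atLeast0_lessThan_Suc)
  have e: "m + a + a + 1 = Suc (m + 2 * a)" "m + 2 * Suc a = Suc (Suc (m + 2 * a))" by simp_all
  have 2: "ln (fact (m + a + a + 1) :: real) = ln (real (m + 2 * a + 1)) + ln (fact (m + 2 * a))"
    unfolding e ln_fact_Suc by simp
  have 3: "ln_superfact (m + 2 * Suc a) = ln_superfact (m + 2 * a) + ln (fact (m + 2 * a)) + ln (fact (m + a + a + 1))"
    unfolding e ln_superfact_Suc ..
  have 4: "ln_superfact (m + Suc a) = ln_superfact (m + a) + ln (fact (m + a))"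
    by (simp add: ln_superfact_Suc)
  have "2 * (T + (F1 - F2)) = G2 + F3 + F1 - 2 * (G1 + F2) + G0 + (Z + l)"
    if "2 * T = G2 - 2 * G1 + G0 + Z" "F1 = l + F3" for T F1 F2 F3 G0 G1 G2 Z l :: real
  proof -
    have "G2 + F3 + F1 - 2 * (G1 + F2) + G0 + (Z + l) = (G2 - 2 * G1 + G0 + Z) + (l + F3) + F1 - 2 * F2"
      by (simp add: algebra_simps)
    also have "\<dots> = 2 * T + F1 + F1 - 2 * F2" unfolding that ..
    finally show ?thesis by (simp add: algebra_simps)
  qed
  from this[OF Suc 2] show ?case unfolding 1 3 4 sum.atLeast0_lessThan_Suc .
qed (simp add: ln_tri_prod_def)

text \<open>A product of consecutive odd numbers is a quotient of factorials once the even factors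
  are divided out. Whether this or \<open>sum_ln_even\<close> applies depends on the parity of the
  second argument of \<open>ln_tri_prod\<close>; \<open>b + c = 2 * s\<close> makes it the parity of
  \<open>p\<close>.\<close>

lemma sum_ln_odd:
  "(\<Sum>j = 0..<a. ln (real (2 * \<mu> + 2 * j + 1)))
    = ln (fact (2 * (\<mu> + a))) + ln (fact \<mu>) - ln (fact (2 * \<mu>)) - ln (fact (\<mu> + a)) - real a * ln 2"
proof (induction a)
  case (Suc a)
  define k where "k = \<mu> + a"
  have "ln (2 * (real k + 1)) = ln 2 + ln (real k + 1)" by (rule ln_mult_pos) auto
  then have 1: "ln (fact (2 * Suc k) :: real) = ln 2 + ln (real k + 1) + (ln (2 * real k + 1) + ln (fact (2 * k)))"
    using ln_fact_Suc[of "2 * k"] ln_fact_Suc[of "Suc (2 * k)"] by (simp del: fact_Suc add: algebra_simps)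
  have 2: "ln (fact (Suc k) :: real) = ln (real k + 1) + ln (fact k)" by (rule ln_fact_Suc)
  have 3: "real (2 * \<mu> + 2 * a + 1) = 2 * real k + 1" "\<mu> + Suc a = Suc k" "\<mu> + a = k" by (simp_all add: k_def)
  show ?case using Suc 1 2 unfolding sum.atLeast0_lessThan_Suc 3 by (simp del: fact_Suc add: algebra_simps)
qed simp

lemma sum_ln_even:
  "(\<Sum>j = 0..<a. ln (real (2 * \<mu> + 1 + 2 * j + 1))) = real a * ln 2 + ln (fact (\<mu> + a)) - ln (fact \<mu>)"
proof (induction a)
  case (Suc a)
  have "ln (2 * (real \<mu> + real a + 1)) = ln 2 + ln (real (\<mu> + a) + 1)" by (subst ln_mult_pos) auto
  then show ?case using Suc ln_fact_Suc[of "\<mu> + a"] by (simp del: fact_Suc add: algebra_simps)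
qed simp

lemma reflect_det_eq_exp:
  assumes "e < 2" "2 * \<delta> \<le> n"
  shows "reflect_det a e n (n - 2 * \<delta>) = exp (ln_superfact (n + 2 * a + e) - ln_superfact (n + a + e) + ln_superfact a
    - (ln_superfact (n - \<delta> + 2 * a + e) - ln_superfact (n - \<delta> + a + e)) - (ln_superfact (\<delta> + a) - ln_superfact \<delta>)
    + ln_tri_prod a (n - 2 * \<delta> + e) - ln_tri_prod a (n + e))"
proof -
  have tri: "(\<Prod>j = 0..<a. \<Prod>i = 0..j. real (m + i + j + 1 + e)) = exp (ln_tri_prod a (m + e))" for m
    unfolding ln_tri_prod_def by (simp add: exp_sum add_ac)
  have eqs: "n + a + e + a = n + 2 * a + e" "n - \<delta> + a + e + a = n - \<delta> + 2 * a + e" by auto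
  show ?thesis
    unfolding reflect_det_eq[OF assms] prod_dividef prod.distrib prod_fact_eq_exp prod_fact_eq_exp_0 tri eqs
    by (simp add: exp_add exp_diff)
qed

text \<open>The slit hexagon has sides \<open>d + b\<close> and \<open>d + c\<close>, which avoids
  truncated subtraction. The four summands are the two reflection determinants, the product over
  \<open>p\<close> and the product over \<open>a + e\<close> in
  \<open>M_hexd_formula\<close>.\<close>

definition ln_tilings :: "nat \<Rightarrow> nat \<Rightarrow> nat \<Rightarrow> nat \<Rightarrow> nat \<Rightarrow> real" where
  "ln_tilings a e d b c = (let n = 2 * d + b + c; p = 2 * a + e; G = ln_superfact in
    (G (n + p) - G (n + a + e) + G a - (G (d + b + c + p) - G (d + b + c + a + e)) - (G (d + a) - G d)
      + ln_tri_prod a (b + c + e) - ln_tri_prod a (n + e)) +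
    (G (2 * d + p) - G (2 * d + a + e) + G a - (G (d + p) - G (d + a + e)) - (G (d + a) - G d)
      + ln_tri_prod a e - ln_tri_prod a (2 * d + e)) +
    (G (d + p) - G d + (G (d + b + c + p) - G (d + b + c)) - (G (d + b + p) - G (d + b)) - (G (d + c + p) - G (d + c))) +
    (G (d + b + (a + e)) - G (d + b) + (G (d + c + (a + e)) - G (d + c)) + G (a + e) + (G (b + c + (a + e)) - G (b + c))
      - (G (b + (a + e)) - G b) - (G (c + (a + e)) - G c) - (G (d + (a + e)) - G d) - (G (d + b + c + (a + e)) - G (d + b + c))))"

lemma M_hexd_eq_exp:
  assumes "e < 2" "0 < 2 * a + e" "0 < b + c"
  shows "real (M (hexd (2 * a + e) (d + b) (d + c) d)) = exp (ln_tilings a e d b c)"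
proof -
  define n where "n = 2 * d + b + c"
  have n: "d + b + (d + c) = n" "n - 2 * d = b + c" "n - d = d + b + c" "d + b - d = b" "d + c - d = c" "2 * d - d = d"
    by (auto simp: n_def)
  have r1: "reflect_det a e n (b + c) = exp (ln_superfact (n + 2 * a + e) - ln_superfact (n + a + e) + ln_superfact a
    - (ln_superfact (d + b + c + 2 * a + e) - ln_superfact (d + b + c + a + e)) - (ln_superfact (d + a) - ln_superfact d)
    + ln_tri_prod a (b + c + e) - ln_tri_prod a (n + e))"
    using reflect_det_eq_exp[OF assms(1), of d n a] unfolding n by (simp add: n_def)
  have r2: "reflect_det a e (2 * d) 0 = exp (ln_superfact (2 * d + 2 * a + e) - ln_superfact (2 * d + a + e) + ln_superfact a
    - (ln_superfact (d + 2 * a + e) - ln_superfact (d + a + e)) - (ln_superfact (d + a) - ln_superfact d)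
    + ln_tri_prod a e - ln_tri_prod a (2 * d + e))"
    using reflect_det_eq_exp[OF assms(1), of d "2 * d" a] unfolding n by simp
  have "real (M (hexd (2 * a + e) (d + b) (d + c) d)) =
    reflect_det a e n (b + c) * reflect_det a e (2 * d) 0 *
    (\<Prod>j = 0..<2 * a + e. fact (d + j) * fact (d + b + c + j) / (fact (d + b + j) * fact (d + c + j))) *
    (\<Prod>i = 0..<a + e. fact (d + b + i) * fact (d + c + i) * fact i * fact (b + c + i) /
      (fact (b + i) * fact (c + i) * fact (d + i) * fact (d + b + c + i)))"
  proof -
    have "2 * d < n" using assms(3) by (simp add: n_def)
    then show ?thesis
      using M_hexd_formula[OF assms(1) refl assms(2), of d "d + b" "d + c"] unfolding n by simp
  qed
  then show ?thesis
    unfolding r1 r2 prod_dividef prod.distrib prod_fact_eq_exp prod_fact_eq_exp_0 ln_tilings_def Let_def n_def[symmetric]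
      mult_exp_exp exp_diff[symmetric]
    by (simp add: algebra_simps)
qed

lemma hex_eq_hexd_0: "hex p b c = hexd p b c 0"
  by (simp add: hexd_def)

lemma ln_superfact_1: "ln_superfact (Suc 0) = 0"
  by (simp add: ln_superfact_def)

text \<open>From here on \<open>b\<close>, \<open>c\<close>, \<open>s\<close> (and \<open>B\<close>, \<open>C\<close>, \<open>S\<close>) stand for the paper's \<open>b - d\<close>, \<open>c - d\<close>, \<open>s - d\<close>.\<close>

definition superfact_part :: "(nat \<Rightarrow> real) \<Rightarrow> nat \<Rightarrow> nat \<Rightarrow> nat \<Rightarrow> nat \<Rightarrow> nat \<Rightarrow> real" where
  "superfact_part h a d b c s = h (a + d + b) + h (a + d + c) - h (d + b) - h (d + c)
    - h (a + b) - h (a + c) + h b + h c + 2 * h a + 2 * h d - 2 * h (a + d)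
    + (h (2 * (d + s)) + h (2 * (a + d)) + h (2 * (a + s)) - h (2 * a)
       - h (2 * s) - h (2 * d) - h (2 * (a + d + s))) / 2"

text \<open>The contribution of the diagonal sums in \<open>ln_tri_prod_eq\<close>, by
  \<open>sum_ln_odd\<close>.\<close>

definition fact_part_even :: "(nat \<Rightarrow> real) \<Rightarrow> nat \<Rightarrow> nat \<Rightarrow> nat \<Rightarrow> real" where
  "fact_part_even f a d s = (f (2 * a) - f a + f (2 * (a + s)) + f s - f (2 * s) - f (a + s)
    - f (2 * (a + d)) - f d + f (2 * d) + f (a + d)
    - f (2 * (a + d + s)) - f (d + s) + f (2 * (d + s)) + f (a + d + s)) / 2"

text \<open>Besides the diagonal sums, now from \<open>sum_ln_even\<close>, these factorials come
  from superfactorials whose argument is shifted by one because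
  \<open>p = 2 * a + 1\<close>.\<close>

definition fact_part_odd :: "(nat \<Rightarrow> real) \<Rightarrow> nat \<Rightarrow> nat \<Rightarrow> nat \<Rightarrow> nat \<Rightarrow> nat \<Rightarrow> real" where
  "fact_part_odd f a d b c s = f (a + d + b) + f (a + d + c) - f (a + b) - f (a + c)
    + (f (2 * s) - f (2 * (d + s)) + f (2 * (a + s)) + f (2 * (a + d)) - f (2 * a) - f (2 * d) - f (2 * (a + d + s))
       + f a + f (a + s) - f s - f (a + d) + f d - f (a + d + s) + f (d + s)) / 2"

text \<open>The superfactorials at \<open>2 * s + a\<close>, \<open>2 * d + a\<close> and
  \<open>2 * (d + s) + a\<close> cancel against those in \<open>ln_tri_prod\<close>, and so do the
  multiples of \<open>ln 2\<close>.\<close>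

lemma ln_tilings_diff_even:
  assumes "b + c = 2 * s"
  shows "ln_tilings a 0 d b c - ln_tilings a 0 0 (d + b) (d + c) =
    superfact_part ln_superfact a d b c s + fact_part_even (\<lambda>x. ln (fact x)) a d s"
proof -
  have eqs: "2 * d + b + c = 2 * (d + s)" "2 * 0 + (d + b) + (d + c) = 2 * (d + s)" "d + b + c = d + 2 * s"
    "0 + (d + b) + (d + c) = 2 * (d + s)" "d + b + (d + c) = 2 * (d + s)"
    using assms by auto
  have t: "ln_tri_prod a (2 * \<mu>) = (ln_superfact (2 * (a + \<mu>)) - 2 * ln_superfact (2 * \<mu> + a) + ln_superfact (2 * \<mu>)
     + (ln (fact (2 * (a + \<mu>))) + ln (fact \<mu>) - ln (fact (2 * \<mu>)) - ln (fact (a + \<mu>)) - real a * ln 2)) / 2" for \<mu>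
    using ln_tri_prod_eq[of a "2 * \<mu>"] unfolding sum_ln_odd by (simp add: algebra_simps)
  have t0: "ln_tri_prod a 0 = (ln_superfact (2 * a) - 2 * ln_superfact a
     + (ln (fact (2 * a)) - ln (fact a) - real a * ln 2)) / 2"
    using t[of 0] by simp
  show ?thesis
    unfolding ln_tilings_def Let_def eqs assms add_0_right t t0 superfact_part_def fact_part_even_def
    by (simp add: field_simps)
qed

lemma ln_tilings_diff_odd:
  assumes "b + c = 2 * s"
  shows "ln_tilings a 1 d b c - ln_tilings a 1 0 (d + b) (d + c) =
    superfact_part ln_superfact a d b c s + fact_part_odd (\<lambda>x. ln (fact x)) a d b c s"
proof -
  have eqs: "2 * d + b + c = 2 * (d + s)" "2 * 0 + (d + b) + (d + c) = 2 * (d + s)" "d + b + c = d + 2 * s"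
    "0 + (d + b) + (d + c) = 2 * (d + s)" "d + b + (d + c) = 2 * (d + s)"
    using assms by auto
  have t: "ln_tri_prod a (2 * \<mu> + 1) = (ln_superfact (2 * (a + \<mu>)) + ln (fact (2 * (a + \<mu>)))
     - 2 * ln_superfact (Suc (2 * \<mu> + a)) + ln_superfact (2 * \<mu>) + ln (fact (2 * \<mu>))
     + (real a * ln 2 + ln (fact (a + \<mu>)) - ln (fact \<mu>))) / 2" for \<mu>
    using ln_tri_prod_eq[of a "2 * \<mu> + 1"] ln_superfact_Suc[of "2 * (a + \<mu>)"] ln_superfact_Suc[of "2 * \<mu>"]
    unfolding sum_ln_even by (simp add: algebra_simps)
  have t0: "ln_tri_prod a 1 = (ln_superfact (2 * a) + ln (fact (2 * a)) - 2 * ln_superfact (Suc a)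
     + (real a * ln 2 + ln (fact a))) / 2"
    using t[of 0] by (simp add: ln_superfact_1)
  show ?thesis
    unfolding ln_tilings_def Let_def eqs assms t t0 add_0 superfact_part_def fact_part_odd_def
    by (simp del: fact_Suc add: ln_superfact_Suc field_simps)
qed

section \<open>The ratio of the two tiling counts and its limit\<close>

lemma tilings_ratio_even:
  assumes "0 < a" "0 < b" "b + c = 2 * s"
  shows "real (M (hexd (2 * a) (d + b) (d + c) d)) / real (M (hex (2 * a) (d + b) (d + c)))
    = exp (superfact_part ln_superfact a d b c s + fact_part_even (\<lambda>x. ln (fact x)) a d s)"
proof -
  have "real (M (hexd (2 * a) (d + b) (d + c) d)) = exp (ln_tilings a 0 d b c)"
    using M_hexd_eq_exp[of 0 a b c d] assms by simp
  moreover have "real (M (hexd (2 * a) (d + b) (d + c) 0)) = exp (ln_tilings a 0 0 (d + b) (d + c))"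
    using M_hexd_eq_exp[of 0 a "d + b" "d + c" 0] assms by simp
  ultimately show ?thesis
    unfolding hex_eq_hexd_0 ln_tilings_diff_even[OF assms(3), symmetric] by (simp add: exp_diff)
qed

lemma tilings_ratio_odd:
  assumes "0 < b" "b + c = 2 * s"
  shows "real (M (hexd (2 * a + 1) (d + b) (d + c) d)) / real (M (hex (2 * a + 1) (d + b) (d + c)))
    = exp (superfact_part ln_superfact a d b c s + fact_part_odd (\<lambda>x. ln (fact x)) a d b c s)"
proof -
  have "real (M (hexd (2 * a + 1) (d + b) (d + c) d)) = exp (ln_tilings a 1 d b c)"
    using M_hexd_eq_exp[of 1 a b c d] assms by simp
  moreover have "real (M (hexd (2 * a + 1) (d + b) (d + c) 0)) = exp (ln_tilings a 1 0 (d + b) (d + c))"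
    using M_hexd_eq_exp[of 1 a "d + b" "d + c" 0] assms by simp
  ultimately show ?thesis
    unfolding hex_eq_hexd_0 ln_tilings_diff_odd[OF assms(2), symmetric] by (simp only: exp_diff)
qed

text \<open>All arguments are linear forms in the sides, so the scaling by \<open>N\<close> moves
  inside, and each limit can be taken at a fixed multiple of \<open>N\<close>.\<close>

lemma superfact_part_scale:
  "superfact_part h (a * N) (d * N) (b * N) (c * N) (s * N) = superfact_part (\<lambda>x. h (x * N)) a d b c s"
  "fact_part_even f (a * N) (d * N) (s * N) = fact_part_even (\<lambda>x. f (x * N)) a d s"
  "fact_part_odd f (a * N) (d * N) (b * N) (c * N) (s * N) = fact_part_odd (\<lambda>x. f (x * N)) a d b c s"
  by (simp_all add: superfact_part_def fact_part_even_def fact_part_odd_def distrib_right mult.assoc)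

lemma superfact_part_diff:
  "superfact_part (\<lambda>x. h x - h' x) a d b c s = superfact_part h a d b c s - superfact_part h' a d b c s"
  "fact_part_even (\<lambda>x. h x - h' x) a d s = fact_part_even h a d s - fact_part_even h' a d s"
  "fact_part_odd (\<lambda>x. h x - h' x) a d b c s = fact_part_odd h a d b c s - fact_part_odd h' a d b c s"
  by (simp_all add: superfact_part_def fact_part_even_def fact_part_odd_def field_simps)

lemma superfact_part_tendsto:
  assumes "\<And>x. 0 < x \<Longrightarrow> (\<lambda>N. E N x) \<longlonglongrightarrow> 0" and pos: "0 < a" "0 < d" "0 < b" "0 < c" "0 < s"
  shows "(\<lambda>N. superfact_part (E N) a d b c s) \<longlonglongrightarrow> 0"
    "(\<lambda>N. fact_part_even (E N) a d s) \<longlonglongrightarrow> 0"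
    "(\<lambda>N. fact_part_odd (E N) a d b c s) \<longlonglongrightarrow> 0"
  unfolding superfact_part_def fact_part_even_def fact_part_odd_def
  by (rule tendsto_eq_intros assms(1) | use pos in simp)+

lemma tendsto_1_via_logarithm:
  fixes f g :: "nat \<Rightarrow> real"
  assumes "eventually (\<lambda>N. f N = exp (l N)) sequentially" "eventually (\<lambda>N. g N > 0 \<and> ln (g N) = r N) sequentially"
    and "(\<lambda>N. l N - r N) \<longlonglongrightarrow> 0"
  shows "(\<lambda>N. f N / g N) \<longlonglongrightarrow> 1"
proof -
  have "(\<lambda>N. exp (l N - r N)) \<longlonglongrightarrow> exp 0" by (intro tendsto_exp assms)
  moreover have "eventually (\<lambda>N. exp (l N - r N) = f N / g N) sequentially"
    using assms(1,2) by eventually_elim (metis exp_diff exp_ln)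
  ultimately show ?thesis by (simp add: tendsto_cong)
qed

text \<open>The variables \<open>lADB\<close>, \<open>ltwo\<close>, \<open>lpi\<close>, \<open>lam\<close>, \<open>alp\<close> and so on stand for \<open>ln (A + D + B)\<close>, \<open>ln 2\<close>, \<open>ln (2 * pi)\<close>, \<open>ln N\<close>,
  \<open>ln glaisher\<close>; abstracting from them leaves a ring identity.\<close>

lemma asymptotic_identity:
  fixes A D B C S N lam lpi alp ltwo lADS lS lAS lDS lAD lD lA lC lB lAC lAB lDC lDB lADC lADB :: real
  assumes C: "C = 2 * S - B"
  defines "sa \<equiv> \<lambda>x lx. x * N / 2 * lpi + ((x * N)\<^sup>2 / 2 - 1 / 12) * (lx + lam) - 3 / 4 * (x * N)\<^sup>2 + 1 / 12 - alp"
    and "fa \<equiv> \<lambda>x lx. x * N * (lx + lam) - x * N + (lpi + lx + lam) / 2"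
  defines "com \<equiv> sa (A + D + B) lADB + sa (A + D + C) lADC - sa (D + B) lDB - sa (D + C) lDC
      - sa (A + B) lAB - sa (A + C) lAC + sa B lB + sa C lC + 2 * sa A lA + 2 * sa D lD - 2 * sa (A + D) lAD
      + (sa (2 * (D + S)) (ltwo + lDS) + sa (2 * (A + D)) (ltwo + lAD) + sa (2 * (A + S)) (ltwo + lAS) - sa (2 * A) (ltwo + lA)
       - sa (2 * S) (ltwo + lS) - sa (2 * D) (ltwo + lD) - sa (2 * (A + D + S)) (ltwo + lADS)) / 2"
    and "k3 \<equiv> (2 * (D + S)\<^sup>2 * lDS - ((D + B)\<^sup>2 * lDB + (D + C)\<^sup>2 * lDC))
      + (2 * (A + S)\<^sup>2 * lAS - ((A + B)\<^sup>2 * lAB + (A + C)\<^sup>2 * lAC))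
      + (B\<^sup>2 * lB + C\<^sup>2 * lC - 2 * S\<^sup>2 * lS)
      + ((A + D + B)\<^sup>2 * lADB + (A + D + C)\<^sup>2 * lADC - 2 * (A + D + S)\<^sup>2 * lADS)"
  shows "com + (fa (2 * A) (ltwo + lA) - fa A lA + fa (2 * (A + S)) (ltwo + lAS) + fa S lS - fa (2 * S) (ltwo + lS) - fa (A + S) lAS
      - fa (2 * (A + D)) (ltwo + lAD) - fa D lD + fa (2 * D) (ltwo + lD) + fa (A + D) lAD
      - fa (2 * (A + D + S)) (ltwo + lADS) - fa (D + S) lDS + fa (2 * (D + S)) (ltwo + lDS) + fa (A + D + S) lADS) / 2
    = 7 / 24 * ltwo + 1 / 8 - 3 / 2 * alp - lam / 8
      + (1 / 8 * (lAD - lA - lD) + 1 / 12 * (lDB + lDC + lAB + lAC - lADB - lADC - lB - lC) + 1 / 24 * (lADS + lS - lDS - lAS))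
      + N / 2 * (A * lA + D * lD + (D + S) * lDS + (A + S) * lAS - (A + D) * lAD - (A + D + S) * lADS - S * lS)
      + N\<^sup>2 / 2 * k3"
    and "com + (fa (A + D + B) lADB + fa (A + D + C) lADC - fa (A + B) lAB - fa (A + C) lAC
      + (fa (2 * S) (ltwo + lS) - fa (2 * (D + S)) (ltwo + lDS) + fa (2 * (A + S)) (ltwo + lAS) + fa (2 * (A + D)) (ltwo + lAD)
       - fa (2 * A) (ltwo + lA) - fa (2 * D) (ltwo + lD) - fa (2 * (A + D + S)) (ltwo + lADS)
       + fa A lA + fa (A + S) lAS - fa S lS - fa (A + D) lAD + fa D lD - fa (A + D + S) lADS + fa (D + S) lDS) / 2)
    = - 5 / 24 * ltwo + 1 / 8 - 3 / 2 * alp - lam / 8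
      + (11 / 24 * (lAS - lADS) + 5 / 12 * (lADB + lADC - lAB - lAC) + 1 / 8 * (lAD - lA - lD)
         + 1 / 12 * (lDB + lDC - lB - lC) + 1 / 24 * (lS - lDS))
      + N / 2 * ((A + D) * lAD - A * lA - D * lD + (A + D + S) * lADS + S * lS - (A + S) * lAS - (D + S) * lDS
         + 2 * (- (2 * D * ltwo) + (A + D + B) * lADB + (A + D + C) * lADC - 2 * (A + D + S) * lADS
            + 2 * (A + S) * lAS - (A + B) * lAB - (A + C) * lAC))
      + N\<^sup>2 / 2 * k3"
  unfolding com_def k3_def sa_def fa_def C power2_eq_square
  by (simp_all add: algebra_simps add_divide_distrib diff_divide_distrib)

section \<open>Logarithms of the five constants\<close>

context
  fixes A D B C S :: real
  assumes pos: "0 < A" "0 < D" "0 < B" "0 < C" "0 < S" and BC: "B + C = 2 * S"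
begin

lemma K_args:
  "(D + B) / 2 + (D + C) / 2 = D + S" "A + (D + B) - D = A + B" "A + (D + C) - D = A + C" "A + (D + S) - D = A + S"
  "D + B - D = B" "D + C - D = C" "D + S - D = S" "A + (D + B) = A + D + B" "A + (D + C) = A + D + C" "A + (D + S) = A + D + S"
proof -
  have "(D + B) / 2 + (D + C) / 2 = D + (B + C) / 2" by (simp add: field_simps)
  then show "(D + B) / 2 + (D + C) / 2 = D + S" using BC by simp
qed simp_all

lemma K_pos:
  "0 < A + D" "0 < A + B" "0 < A + C" "0 < A + S" "0 < D + B" "0 < D + C" "0 < D + S"
  "0 < A + D + B" "0 < A + D + C" "0 < A + D + S"
  using pos by simp_all

lemmas K_neq = pos[THEN less_imp_neq, symmetric] K_pos[THEN less_imp_neq, symmetric]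

lemma ln_K1: "0 < K1 A (D + B) (D + C) D"
  "ln (K1 A (D + B) (D + C) D) = 1 / 8 * (ln (A + D) - ln A - ln D)
    + 1 / 12 * (ln (D + B) + ln (D + C) + ln (A + B) + ln (A + C) - ln (A + D + B) - ln (A + D + C) - ln B - ln C)
    + 1 / 24 * (ln (A + D + S) + ln S - ln (D + S) - ln (A + S))"
  unfolding K1_def Let_def K_args
  by (simp_all add: pos K_pos K_neq ln_mult ln_div ln_powr diff_diff_eq)

lemma ln_K2: "0 < K2 A (D + B) (D + C) D"
  "ln (K2 A (D + B) (D + C) D) = A * ln A + D * ln D + (D + S) * ln (D + S) + (A + S) * ln (A + S)
    - (A + D) * ln (A + D) - (A + D + S) * ln (A + D + S) - S * ln S"
  unfolding K2_def Let_def K_args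
  by (simp_all add: pos K_pos K_neq ln_mult ln_div ln_powr diff_diff_eq)

lemma ln_K3: "0 < K3 A (D + B) (D + C) D"
  "ln (K3 A (D + B) (D + C) D) =
      (2 * (D + S)\<^sup>2 * ln (D + S) - ((D + B)\<^sup>2 * ln (D + B) + (D + C)\<^sup>2 * ln (D + C)))
      + (2 * (A + S)\<^sup>2 * ln (A + S) - ((A + B)\<^sup>2 * ln (A + B) + (A + C)\<^sup>2 * ln (A + C)))
      + (B\<^sup>2 * ln B + C\<^sup>2 * ln C - 2 * S\<^sup>2 * ln S)
      + ((A + D + B)\<^sup>2 * ln (A + D + B) + (A + D + C)\<^sup>2 * ln (A + D + C) - 2 * (A + D + S)\<^sup>2 * ln (A + D + S))"
  unfolding K3_def Let_def K_args
  by (simp_all add: pos K_pos K_neq ln_mult ln_div ln_powr diff_diff_eq)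

lemma ln_L1: "0 < L1 A (D + B) (D + C) D"
  "ln (L1 A (D + B) (D + C) D) = 11 / 24 * (ln (A + S) - ln (A + D + S))
    + 5 / 12 * (ln (A + D + B) + ln (A + D + C) - ln (A + B) - ln (A + C)) + 1 / 8 * (ln (A + D) - ln A - ln D)
    + 1 / 12 * (ln (D + B) + ln (D + C) - ln B - ln C) + 1 / 24 * (ln S - ln (D + S))"
  unfolding L1_def Let_def K_args
  by (simp_all add: pos K_pos K_neq ln_mult ln_div ln_powr diff_diff_eq)

lemma ln_L2: "0 < L2 A (D + B) (D + C) D"
  "ln (L2 A (D + B) (D + C) D) = (A + D) * ln (A + D) - A * ln A - D * ln D + (A + D + S) * ln (A + D + S) + S * ln S
    - (A + S) * ln (A + S) - (D + S) * ln (D + S)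
    + 2 * (- (2 * D * ln 2) + (A + D + B) * ln (A + D + B) + (A + D + C) * ln (A + D + C) - 2 * (A + D + S) * ln (A + D + S)
        + 2 * (A + S) * ln (A + S) - (A + B) * ln (A + B) - (A + C) * ln (A + C))"
proof -
  have "ln (4 :: real) = 2 * ln 2" using ln_realpow[of 2 2] by simp
  then show "ln (L2 A (D + B) (D + C) D) = (A + D) * ln (A + D) - A * ln A - D * ln D + (A + D + S) * ln (A + D + S) + S * ln S
    - (A + S) * ln (A + S) - (D + S) * ln (D + S)
    + 2 * (- (2 * D * ln 2) + (A + D + B) * ln (A + D + B) + (A + D + C) * ln (A + D + C) - 2 * (A + D + S) * ln (A + D + S)
        + 2 * (A + S) * ln (A + S) - (A + B) * ln (A + B) - (A + C) * ln (A + C))"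
    unfolding L2_def Let_def K_args
    by (simp add: pos K_pos K_neq ln_mult ln_div ln_powr ln_realpow)
  show "0 < L2 A (D + B) (D + C) D"
    unfolding L2_def Let_def K_args
    by (simp add: pos K_pos K_neq)
qed

end

lemma ln_approx_even:
  fixes a d b c s :: nat and N :: real
  assumes pos: "0 < a" "0 < d" "0 < b" "0 < c" "0 < s" "0 < N" and bc: "b + c = 2 * s"
  defines "R \<equiv> 2 powr (7/24) * exp (1/8) / (glaisher powr (3/2) * N powr (1/8))
     * K1 a (d + b) (d + c) d * K2 a (d + b) (d + c) d powr (N / 2) * K3 a (d + b) (d + c) d powr (N ^ 2 / 2)"
  shows "0 < R \<and> ln R = superfact_part (\<lambda>x. superfact_approx (real x) N) a d b c s
    + fact_part_even (\<lambda>x. fact_approx (real x) N) a d s" (is "_ \<and> _ = ?rhs")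
proof -
  have BC: "real b + real c = 2 * real s" using bc by (metis of_nat_add of_nat_mult of_nat_numeral)
  have rpos: "0 < real a" "0 < real d" "0 < real b" "0 < real c" "0 < real s" using pos by simp_all
  note K = ln_K1[OF rpos BC] ln_K2[OF rpos BC] ln_K3[OF rpos BC]
  note G = glaisher_log_tendsto(1)
  have Rpos: "0 < R"
    unfolding R_def using K(1,3,5) G pos(6)
    by (intro mult_pos_pos divide_pos_pos) (auto simp: less_imp_neq[THEN not_sym])
  have "ln R = 7 / 24 * ln 2 + 1 / 8 - 3 / 2 * ln glaisher - ln N / 8 + ln (K1 a (real d + real b) (real d + real c) d)
    + N / 2 * ln (K2 a (real d + real b) (real d + real c) d) + N\<^sup>2 / 2 * ln (K3 a (real d + real b) (real d + real c) d)"
    unfolding R_def using K(1,3,5) G pos(6) by (simp add: ln_mult ln_div ln_powr less_imp_neq[THEN not_sym])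
  also have "\<dots> = ?rhs"
  proof -
    have ln2: "ln (2 * x) = ln 2 + ln x" if "0 < x" for x :: real using that by (simp add: ln_mult)
    have L: "ln (2 * (real d + real s)) = ln 2 + ln (real d + real s)" "ln (2 * (real a + real d)) = ln 2 + ln (real a + real d)"
      "ln (2 * (real a + real s)) = ln 2 + ln (real a + real s)" "ln (2 * real a) = ln 2 + ln (real a)"
      "ln (2 * real s) = ln 2 + ln (real s)" "ln (2 * real d) = ln 2 + ln (real d)"
      "ln (2 * (real a + real d + real s)) = ln 2 + ln (real a + real d + real s)"
      by (rule ln2, use rpos in simp)+
    have C: "real c = 2 * real s - real b" using BC by simp
    show ?thesis
      unfolding K superfact_part_def fact_part_even_def superfact_approx_def fact_approx_def
        of_nat_add of_nat_mult of_nat_numeral L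
      by (rule asymptotic_identity(1)[OF C, symmetric])
  qed
  finally show ?thesis using Rpos by simp
qed

lemma ln_approx_odd:
  fixes a d b c s :: nat and N :: real
  assumes pos: "0 < a" "0 < d" "0 < b" "0 < c" "0 < s" "0 < N" and bc: "b + c = 2 * s"
  defines "R \<equiv> exp (1/8) / (2 powr (5/24) * glaisher powr (3/2) * N powr (1/8))
     * L1 a (d + b) (d + c) d * L2 a (d + b) (d + c) d powr (N / 2) * K3 a (d + b) (d + c) d powr (N ^ 2 / 2)"
  shows "0 < R \<and> ln R = superfact_part (\<lambda>x. superfact_approx (real x) N) a d b c s
    + fact_part_odd (\<lambda>x. fact_approx (real x) N) a d b c s" (is "_ \<and> _ = ?rhs")
proof -
  have BC: "real b + real c = 2 * real s" using bc by (metis of_nat_add of_nat_mult of_nat_numeral)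
  have rpos: "0 < real a" "0 < real d" "0 < real b" "0 < real c" "0 < real s" using pos by simp_all
  note K = ln_L1[OF rpos BC] ln_L2[OF rpos BC] ln_K3[OF rpos BC]
  note G = glaisher_log_tendsto(1)
  have Rpos: "0 < R"
    unfolding R_def using K(1,3,5) G pos(6)
    by (intro mult_pos_pos divide_pos_pos) (auto simp: less_imp_neq[THEN not_sym])
  have "ln R = - 5 / 24 * ln 2 + 1 / 8 - 3 / 2 * ln glaisher - ln N / 8 + ln (L1 a (real d + real b) (real d + real c) d)
    + N / 2 * ln (L2 a (real d + real b) (real d + real c) d) + N\<^sup>2 / 2 * ln (K3 a (real d + real b) (real d + real c) d)"
    unfolding R_def using K(1,3,5) G pos(6) by (simp add: ln_mult ln_div ln_powr less_imp_neq[THEN not_sym])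
  also have "\<dots> = ?rhs"
  proof -
    have ln2: "ln (2 * x) = ln 2 + ln x" if "0 < x" for x :: real using that by (simp add: ln_mult)
    have L: "ln (2 * (real d + real s)) = ln 2 + ln (real d + real s)" "ln (2 * (real a + real d)) = ln 2 + ln (real a + real d)"
      "ln (2 * (real a + real s)) = ln 2 + ln (real a + real s)" "ln (2 * real a) = ln 2 + ln (real a)"
      "ln (2 * real s) = ln 2 + ln (real s)" "ln (2 * real d) = ln 2 + ln (real d)"
      "ln (2 * (real a + real d + real s)) = ln 2 + ln (real a + real d + real s)"
      by (rule ln2, use rpos in simp)+
    have C: "real c = 2 * real s - real b" using BC by simp
    show ?thesis
      unfolding K superfact_part_def fact_part_odd_def superfact_approx_def fact_approx_def
        of_nat_add of_nat_mult of_nat_numeral L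
      by (rule asymptotic_identity(2)[OF C, symmetric])
  qed
  finally show ?thesis using Rpos by simp
qed

lemma parts_tendsto:
  assumes "0 < a" "0 < d" "0 < b" "0 < c" "0 < s"
  shows "(\<lambda>N. superfact_part (\<lambda>x. ln_superfact (x * N)) a d b c s + fact_part_even (\<lambda>x. ln (fact (x * N))) a d s
      - (superfact_part (\<lambda>x. superfact_approx (real x) (real N)) a d b c s
        + fact_part_even (\<lambda>x. fact_approx (real x) (real N)) a d s)) \<longlonglongrightarrow> 0" (is "?even \<longlonglongrightarrow> 0")
    and "(\<lambda>N. superfact_part (\<lambda>x. ln_superfact (x * N)) a d b c s + fact_part_odd (\<lambda>x. ln (fact (x * N))) a d b c s
      - (superfact_part (\<lambda>x. superfact_approx (real x) (real N)) a d b c s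
        + fact_part_odd (\<lambda>x. fact_approx (real x) (real N)) a d b c s)) \<longlonglongrightarrow> 0" (is "?odd \<longlonglongrightarrow> 0")
proof -
  let ?E = "\<lambda>N x. ln_superfact (x * N) - superfact_approx (real x) (real N)"
  let ?F = "\<lambda>N x. ln (fact (x * N)) - fact_approx (real x) (real N)"
  have E: "(\<lambda>N. superfact_part (?E N) a d b c s) \<longlonglongrightarrow> 0"
    by (rule superfact_part_tendsto(1)[OF superfact_asymp assms])
  have "(\<lambda>N. superfact_part (?E N) a d b c s + fact_part_even (?F N) a d s) \<longlonglongrightarrow> 0 + 0"
    by (intro tendsto_add E superfact_part_tendsto(2)[OF fact_asymp assms])
  then show "?even \<longlonglongrightarrow> 0" by (simp add: superfact_part_diff algebra_simps)
  have "(\<lambda>N. superfact_part (?E N) a d b c s + fact_part_odd (?F N) a d b c s) \<longlonglongrightarrow> 0 + 0"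
    by (intro tendsto_add E superfact_part_tendsto(3)[OF fact_asymp assms])
  then show "?odd \<longlonglongrightarrow> 0" by (simp add: superfact_part_diff algebra_simps)
qed

theorem theorem2p3:
  fixes a b c d :: nat
  assumes "0 < a" "0 < b" "0 < c" "0 < d" "d < b" "b \<le> c" "even b = even c"
  shows "(\<lambda>N::nat. (real (M (hexd (2*a*N) (b*N) (c*N) (d*N))) / real (M (hex (2*a*N) (b*N) (c*N))))
            / (2 powr (7/24) * exp (1/8) / (glaisher powr (3/2) * real N powr (1/8))
               * K1 a b c d * K2 a b c d powr (real N / 2) * K3 a b c d powr (real N ^ 2 / 2)))
           \<longlonglongrightarrow> 1 \<and>
         (\<lambda>N::nat. (real (M (hexd (2*a*N+1) (b*N) (c*N) (d*N))) / real (M (hex (2*a*N+1) (b*N) (c*N))))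
            / (exp (1/8) / (2 powr (5/24) * glaisher powr (3/2) * real N powr (1/8))
               * L1 a b c d * L2 a b c d powr (real N / 2) * K3 a b c d powr (real N ^ 2 / 2)))
           \<longlonglongrightarrow> 1"
proof -
  obtain b' where b': "b = d + b'" "0 < b'" using less_imp_add_positive[OF assms(5)] by blast
  obtain c' where c': "c = d + c'" "0 < c'" using less_imp_add_positive[of d c] assms(5,6) by auto
  \<comment> \<open>Here the congruence of \<open>b\<close> and \<open>c\<close> enters:
    \<open>b' + c'\<close> differs from \<open>b + c\<close> by \<open>2 * d\<close>.\<close>
  have "even (b' + c')" using assms(7) b' c' by auto
  then obtain s where s: "b' + c' = 2 * s" by blast
  have pos: "0 < a" "0 < d" "0 < b'" "0 < c'" "0 < s" using assms b' c' s by auto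
  have scale: "b * N = d * N + b' * N" "c * N = d * N + c' * N" "b' * N + c' * N = 2 * (s * N)" for N
    using b' c' s by (simp_all add: distrib_right[symmetric])
  show ?thesis
  proof (intro conjI, goal_cases)
    case 1
    show ?case
    proof (rule tendsto_1_via_logarithm[OF _ _ parts_tendsto(1)[OF pos]], goal_cases)
      case 1
      show ?case using eventually_gt_at_top[of 0]
      proof eventually_elim
        case (elim N)
        then show ?case
          using tilings_ratio_even[of "a * N" "b' * N" "c' * N" "s * N" "d * N"] pos scale[of N]
          by (simp only: superfact_part_scale mult.assoc) simp
      qed
    next
      case 2
      show ?case using eventually_gt_at_top[of 0]
      proof eventually_elim
        case (elim N)
        then have "0 < real N" by simp
        then show ?case unfolding b'(1) c'(1) by (rule ln_approx_even[OF pos _ s])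
      qed
    qed
  next
    case 2
    show ?case
    proof (rule tendsto_1_via_logarithm[OF _ _ parts_tendsto(2)[OF pos]], goal_cases)
      case 1
      show ?case using eventually_gt_at_top[of 0]
      proof eventually_elim
        case (elim N)
        then show ?case
          using tilings_ratio_odd[of "b' * N" "c' * N" "s * N" "a * N" "d * N"] pos scale[of N]
          by (simp only: superfact_part_scale mult.assoc) simp
      qed
    next
      case 2
      show ?case using eventually_gt_at_top[of 0]
      proof eventually_elim
        case (elim N)
        then have "0 < real N" by simp
        then show ?case unfolding b'(1) c'(1) by (rule ln_approx_odd[OF pos _ s])
      qed
    qed
  qed
qed

end
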